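(* Let $\alpha$ and $\gamma$ be weak compositions with $\alpha$ nonempty and $\gamma$ skew-symmetric. Then $\kappa_\alpha=\kappa^{\mathsf P}_\gamma$ if and only if there are positive integers $1\le i_0<i_1<i_2<\cdots<i_n$ (for some positive integer $n$) such that $$\alpha=\mathbf e_{i_1}+2\mathbf e_{i_2}+3\mathbf e_{i_3}+\cdots+n\mathbf e_{i_n}\quad\text{and}\quad\gamma=(n+1)(\mathbf e_{i_0}+\mathbf e_{i_1}+\mathbf e_{i_2}+\cdots+\mathbf e_{i_n}).$$
   Context: Let $\mathbb P=\{1,2,3,\dots\}$. $S_\infty$ is the group of permutations of $\mathbb P$ generated by $s_i=(i\;\,i+1)$; it acts on $\mathbb Z[x_1,x_2,\dots]$ by permuting variables. Define $\pi_i f=(x_if-x_{i+1}s_if)/(x_i-x_{i+1})$; these satisfy the braid relations, so $\pi_w=\pi_{i_1}\cdots\pi_{i_l}$ is well-defined for any reduced word $i_1\cdots i_l$ of $w\in S_\infty$. A weak composition is a sequence $\alpha=(\alpha_1,\alpha_2,\dots)$ of nonnegative integers with finite sum; $\emptyset=(0,0,\dots)$ is the empty one, "nonempty" means $\ne\emptyset$, and $\mathbf e_i$ is the sequence with $1$ in position $i$ and $0$ elsewhere. Put $x^\alpha=\prod_ix_i^{\alpha_i}$. A partition is a weakly decreasing weak composition. $S_\infty$ acts by $w\alpha=(\alpha_{w^{-1}(1)},\alpha_{w^{-1}(2)},\dots)$. Let $\lambda(\alpha)$ be the partition sorting $\alpha$ and $u(\alpha)$ the minimal-length $u\in S_\infty$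 with $\alpha=u\lambda(\alpha)$. The key polynomial is $\kappa_\alpha=\pi_{u(\alpha)}x^{\lambda(\alpha)}$. Let $\mathsf D_\mu=\{(i,j)\in\mathbb P\times\mathbb P:1\le j\le\mu_i\}$. An addable (removable) corner of a partition is a cell that can be added to (removed from) its Young diagram so that the result is again the Young diagram of a partition. A partition $\lambda$ is skew-symmetric if it equals its transpose and, for every $i$: if $(i,i)$ is a removable corner then $(i,i+1)$ is not an addable corner, and if $(i,i)$ is an addable corner then $(i,i-1)$ is not a removable corner. A weak composition $\gamma$ is skew-symmetric if $\lambda(\gamma)$ is. For a partition $\lambda$ equal to its transpose, $\mathrm{half}_<(\lambda)$ is the strict partition (distinct nonzero parts) with nonzero parts $\{\lambda_i-i:i\in\mathbb P\}\cap\mathbb P$. For such $\gamma$, $\kappa^{\mathsf P}_\gamma=\pi_{u(\gamma)}\prod_{(i,j)\in\mathsf D_\mu}(x_i+x_{i+j})$ with $\mu=\mathrm{half}_<(\lambda(\gamma))$. *)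

theory Defs
  imports "HOL-Library.Poly_Mapping" "HOL-Combinatorics.Transposition"
begin

text \<open>
  Positions and variables are numbered by the positive integers, represented by the elements
  of \<open>{1..}\<close> of type \<open>nat\<close>. Index 0 is never used: weak compositions vanish there, and the
  permutations in \<open>S_inf\<close> fix it. The type \<open>(nat \<Rightarrow>\<^sub>0 nat) \<Rightarrow>\<^sub>0 int\<close> with its convolution product
  is the polynomial ring over the integers in \<open>x\<^sub>0, x\<^sub>1, \<dots>\<close>, which contains the polynomial
  ring in \<open>x\<^sub>1, x\<^sub>2, \<dots>\<close>.
\<close>

type_synonym mpoly = "(nat \<Rightarrow>\<^sub>0 nat) \<Rightarrow>\<^sub>0 int"

definition weak_composition :: "(nat \<Rightarrow>\<^sub>0 nat) \<Rightarrow> bool" where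
  "weak_composition \<alpha> \<longleftrightarrow> Poly_Mapping.lookup \<alpha> 0 = 0"

definition is_partition :: "(nat \<Rightarrow>\<^sub>0 nat) \<Rightarrow> bool" where
  "is_partition \<mu> \<longleftrightarrow> weak_composition \<mu> \<and>
     (\<forall>i\<ge>1. Poly_Mapping.lookup \<mu> (i + 1) \<le> Poly_Mapping.lookup \<mu> i)"

definition var :: "nat \<Rightarrow> mpoly" where
  "var i = Poly_Mapping.single (Poly_Mapping.single i 1) 1"

definition x_pow :: "(nat \<Rightarrow>\<^sub>0 nat) \<Rightarrow> mpoly" where
  "x_pow \<alpha> = (\<Prod>i\<in>Poly_Mapping.keys \<alpha>. var i ^ Poly_Mapping.lookup \<alpha> i)"

lemma var_power: "var i ^ n = Poly_Mapping.single (Poly_Mapping.single i n) 1"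
  by (induction n) (simp_all add: var_def mult_single single_add[symmetric] flip: single_one)

lemma prod_single: "finite A \<Longrightarrow>
  (\<Prod>i\<in>A. Poly_Mapping.single (f i) 1) = (Poly_Mapping.single (\<Sum>i\<in>A. f i) 1 :: mpoly)"
  by (induction A rule: finite_induct) (simp_all add: mult_single)

lemma x_pow_eq_single: "x_pow \<alpha> = Poly_Mapping.single \<alpha> 1"
proof -
  have "(\<Sum>i\<in>Poly_Mapping.keys \<alpha>. Poly_Mapping.single i (Poly_Mapping.lookup \<alpha> i)) = \<alpha>"
    by (rule poly_mapping_eqI)
      (simp add: lookup_sum lookup_single when_def not_in_keys_iff_lookup_eq_zero)
  then show ?thesis
    by (simp add: x_pow_def var_power prod_single)
qed

definition simple_refl :: "nat \<Rightarrow> nat \<Rightarrow> nat" where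
  "simple_refl i = transpose i (i + 1)"

inductive_set S_inf :: "(nat \<Rightarrow> nat) set" where
  S_inf_id: "id \<in> S_inf"
| S_inf_refl: "i \<ge> 1 \<Longrightarrow> simple_refl i \<in> S_inf"
| S_inf_comp: "v \<in> S_inf \<Longrightarrow> w \<in> S_inf \<Longrightarrow> v \<circ> w \<in> S_inf"
| S_inf_inv: "w \<in> S_inf \<Longrightarrow> inv w \<in> S_inf"

definition word_perm :: "nat list \<Rightarrow> nat \<Rightarrow> nat" where
  "word_perm a = foldr (\<lambda>i w. simple_refl i \<circ> w) a id"

definition is_word_of :: "nat list \<Rightarrow> (nat \<Rightarrow> nat) \<Rightarrow> bool" where
  "is_word_of a w \<longleftrightarrow> set a \<subseteq> {1..} \<and> word_perm a = w"

lemma simple_refl_invol [simp]: "simple_refl i \<circ> simple_refl i = id"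
  by (simp add: simple_refl_def)

lemma inv_simple_refl [simp]: "inv (simple_refl i) = simple_refl i"
  by (simp add: simple_refl_def)

lemma bij_simple_refl [simp]: "bij (simple_refl i)"
  by (simp add: simple_refl_def)

lemma S_inf_bij: "w \<in> S_inf \<Longrightarrow> bij w"
proof (induction rule: S_inf.induct)
  case (S_inf_comp v w)
  then show ?case by (intro bij_comp)
qed (rule bij_id bij_simple_refl bij_imp_bij_inv, assumption?)+

lemma S_inf_fixes_0: "w \<in> S_inf \<Longrightarrow> w 0 = 0"
proof (induction rule: S_inf.induct)
  case (S_inf_inv w)
  then show ?case by (metis S_inf_bij bij_inv_eq_iff)
qed (auto simp: simple_refl_def transpose_def)

lemma word_perm_Cons: "word_perm (i # a) = simple_refl i \<circ> word_perm a"
  by (simp add: word_perm_def)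

lemma word_perm_append: "word_perm (a @ b) = word_perm a \<circ> word_perm b"
  by (induction a) (simp_all add: word_perm_Cons o_assoc, simp add: word_perm_def)

lemma bij_word_perm: "bij (word_perm a)"
proof (induction a)
  case Nil
  have "word_perm [] = id" by (simp add: word_perm_def)
  then show ?case by (metis bij_id)
next
  case (Cons i a)
  then show ?case unfolding word_perm_Cons by (rule bij_comp) (rule bij_simple_refl)
qed

lemma word_perm_rev: "word_perm (rev a) = inv (word_perm a)"
proof (induction a)
  case Nil
  then show ?case by (simp add: word_perm_def)
next
  case (Cons i a)
  have "word_perm [i] = simple_refl i" by (simp add: word_perm_def)
  with Cons show ?case
    using o_inv_distrib[OF bij_simple_refl[of i] bij_word_perm[of a]]
    by (metis inv_simple_refl rev.simps(2) word_perm_Cons word_perm_append)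
qed

lemma S_inf_word_exists: "w \<in> S_inf \<Longrightarrow> \<exists>a. is_word_of a w"
proof (induction rule: S_inf.induct)
  case S_inf_id
  have "is_word_of [] id" by (simp add: is_word_of_def word_perm_def)
  then show ?case ..
next
  case (S_inf_refl i)
  then have "is_word_of [i] (simple_refl i)" by (simp add: is_word_of_def word_perm_def)
  then show ?case ..
next
  case (S_inf_comp v w)
  then obtain a b where "is_word_of a v" "is_word_of b w" by blast
  then have "is_word_of (a @ b) (v \<circ> w)" by (simp add: is_word_of_def word_perm_append)
  then show ?case ..
next
  case (S_inf_inv w)
  then obtain a where "is_word_of a w" by blast
  then have "is_word_of (rev a) (inv w)" by (auto simp: is_word_of_def word_perm_rev)
  then show ?case ..
qed

definition perm_length :: "(nat \<Rightarrow> nat) \<Rightarrow> nat" where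
  "perm_length w = (LEAST l. \<exists>a. is_word_of a w \<and> length a = l)"

definition reduced_word :: "nat list \<Rightarrow> (nat \<Rightarrow> nat) \<Rightarrow> bool" where
  "reduced_word a w \<longleftrightarrow> is_word_of a w \<and> length a = perm_length w"

lemma reduced_word_exists:
  assumes "w \<in> S_inf"
  shows "\<exists>a. reduced_word a w"
proof -
  from S_inf_word_exists[OF assms] have "\<exists>l a. is_word_of a w \<and> length a = l" by blast
  then have "\<exists>a. is_word_of a w \<and> length a = perm_length w"
    unfolding perm_length_def by (rule LeastI_ex)
  then show ?thesis by (simp add: reduced_word_def)
qed

definition act :: "(nat \<Rightarrow> nat) \<Rightarrow> (nat \<Rightarrow>\<^sub>0 nat) \<Rightarrow> (nat \<Rightarrow>\<^sub>0 nat)" where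
  "act w \<alpha> = Poly_Mapping.map_key (inv w) \<alpha>"

lemma lookup_act:
  assumes "bij w"
  shows "Poly_Mapping.lookup (act w \<alpha>) k = Poly_Mapping.lookup \<alpha> (inv w k)"
  using assms by (simp add: act_def map_key.rep_eq bij_imp_bij_inv bij_is_inj)

lemma act_id: "act id \<alpha> = \<alpha>"
  by (rule poly_mapping_eqI) (simp add: lookup_act)

lemma act_comp: "bij v \<Longrightarrow> bij w \<Longrightarrow> act v (act w \<alpha>) = act (v \<circ> w) \<alpha>"
  by (rule poly_mapping_eqI) (simp add: lookup_act bij_comp o_inv_distrib)

text \<open>The linear extension of \<open>x\<^sup>\<alpha> \<mapsto> x\<^sup>w\<^sup>\<alpha>\<close>, that is, the substitution of \<open>x\<close> with index \<open>w j\<close>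
  for \<open>x\<^sub>j\<close>.\<close>

definition permute_vars :: "(nat \<Rightarrow> nat) \<Rightarrow> mpoly \<Rightarrow> mpoly" where
  "permute_vars w f = frag_extend (\<lambda>\<alpha>. Poly_Mapping.single (act w \<alpha>) 1) f"

text \<open>The quotient \<open>(x\<^sub>i f - x\<^sub>i\<^sub>+\<^sub>1 s\<^sub>i f) / (x\<^sub>i - x\<^sub>i\<^sub>+\<^sub>1)\<close> in the polynomial ring; it exists and is
  unique by \<open>pi_op_unique\<close> below.\<close>

definition pi_op :: "nat \<Rightarrow> mpoly \<Rightarrow> mpoly" where
  "pi_op i f = (THE g. (var i - var (i + 1)) * g
                  = var i * f - var (i + 1) * permute_vars (simple_refl i) f)"

lemma var_diff_dvd_monomial:
  "(var i - var (i + 1)) dvd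
     (Poly_Mapping.single \<alpha> 1 - permute_vars (simple_refl i) (Poly_Mapping.single \<alpha> 1))"
proof -
  define p q where "p = Poly_Mapping.lookup \<alpha> i" and "q = Poly_Mapping.lookup \<alpha> (i + 1)"
  define \<beta> where
    "\<beta> = \<alpha> - (Poly_Mapping.single i p + Poly_Mapping.single (i + 1) q)"
  have 1: "\<alpha> = \<beta> + Poly_Mapping.single i p + Poly_Mapping.single (i + 1) q"
    by (rule poly_mapping_eqI)
      (auto simp: \<beta>_def lookup_add lookup_minus lookup_single when_def p_def q_def)
  have 2: "act (simple_refl i) \<alpha> = \<beta> + Poly_Mapping.single i q + Poly_Mapping.single (i + 1) p"
    by (rule poly_mapping_eqI)
      (auto simp: \<beta>_def lookup_act lookup_add lookup_minus lookup_single when_def p_def q_def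
        simple_refl_def transpose_def)
  let ?x = "var i" and ?y = "var (i + 1)" and ?b = "Poly_Mapping.single \<beta> 1 :: mpoly"
  have mono: "Poly_Mapping.single (\<beta> + Poly_Mapping.single i a + Poly_Mapping.single (i + 1) b) 1
      = ?b * ?x ^ a * ?y ^ b" for a b
    by (simp add: var_power mult_single)
  have sym: "(?x - ?y) dvd (?x ^ a * ?y ^ b - ?x ^ b * ?y ^ a)" for a b
  proof (induction a b rule: linorder_wlog)
    case (le a b)
    then obtain d where d: "b = a + d" using le_Suc_ex by blast
    have "?x ^ a * ?y ^ b - ?x ^ b * ?y ^ a = - ((?x * ?y) ^ a * (?x ^ d - ?y ^ d))"
      unfolding d by (simp add: algebra_simps power_add power_mult_distrib)
    moreover have "(?x - ?y) dvd (?x ^ d - ?y ^ d)"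
      by (simp add: power_diff_sumr2)
    ultimately show ?case by (metis dvd_minus_iff dvd_mult)
  next
    case (sym a b)
    then show ?case by (metis dvd_minus_iff minus_diff_eq mult.commute)
  qed
  have "Poly_Mapping.single \<alpha> 1 - permute_vars (simple_refl i) (Poly_Mapping.single \<alpha> 1)
      = ?b * (?x ^ p * ?y ^ q - ?x ^ q * ?y ^ p)"
    unfolding permute_vars_def frag_extend_of 2
    by (subst 1) (simp only: mono right_diff_distrib mult.assoc)
  with sym show ?thesis by simp
qed

lemma var_diff_dvd: "(var i - var (i + 1)) dvd (f - permute_vars (simple_refl i) f)"
proof -
  have "Poly_Mapping.keys f \<subseteq> UNIV" by simp
  then show ?thesis
  proof (induction f rule: frag_induction)
    case zero
    then show ?case by (simp add: permute_vars_def)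
  next
    case (one \<alpha>)
    show ?case by (rule var_diff_dvd_monomial)
  next
    case (diff f g)
    have "f - g - permute_vars (simple_refl i) (f - g)
        = (f - permute_vars (simple_refl i) f) - (g - permute_vars (simple_refl i) g)"
      by (simp add: permute_vars_def frag_extend_diff)
    with diff show ?case by (metis dvd_diff)
  qed
qed

lemma var_diff_nonzero: "var i - var (i + 1) \<noteq> 0"
proof
  assume "var i - var (i + 1) = 0"
  then have "Poly_Mapping.single i (1::nat) = Poly_Mapping.single (i + 1) 1"
    by (simp add: var_def frag_of_eq)
  then have "Poly_Mapping.keys (Poly_Mapping.single i (1::nat))
      = Poly_Mapping.keys (Poly_Mapping.single (i + 1) (1::nat))" by (rule arg_cong)
  then show False by simp
qed

lemma pi_op_unique:
  "\<exists>!g. (var i - var (i + 1)) * g = var i * f - var (i + 1) * permute_vars (simple_refl i) f"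
proof -
  have "var i * f - var (i + 1) * permute_vars (simple_refl i) f
      = (var i - var (i + 1)) * f + var (i + 1) * (f - permute_vars (simple_refl i) f)"
    by (simp add: algebra_simps)
  then have "(var i - var (i + 1)) dvd (var i * f - var (i + 1) * permute_vars (simple_refl i) f)"
    using var_diff_dvd by (metis dvd_add dvd_mult dvd_triv_left)
  then obtain g where
    "var i * f - var (i + 1) * permute_vars (simple_refl i) f = (var i - var (i + 1)) * g" ..
  with var_diff_nonzero[of i] show ?thesis by (intro ex1I[of _ g]) auto
qed

text \<open>By the braid relations, the result does not depend on the chosen reduced word.\<close>

definition pi_perm :: "(nat \<Rightarrow> nat) \<Rightarrow> mpoly \<Rightarrow> mpoly" where
  "pi_perm w f = foldr pi_op (SOME a. reduced_word a w) f"

text \<open>A partition is determined by the numbers of its parts of size at least \<open>j\<close>.\<close>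

lemma partition_eqI:
  assumes \<mu>: "is_partition \<mu>" and \<nu>: "is_partition \<nu>"
    and card_eq: "\<And>j. 1 \<le> j \<Longrightarrow> card {i. j \<le> Poly_Mapping.lookup \<mu> i}
                          = card {i. j \<le> Poly_Mapping.lookup \<nu> i}"
  shows "\<mu> = \<nu>"
proof -
  have initial: "{i. j \<le> Poly_Mapping.lookup \<rho> i} = {1..card {i. j \<le> Poly_Mapping.lookup \<rho> i}}"
    if \<rho>: "is_partition \<rho>" and j: "1 \<le> j" for \<rho> j
  proof -
    let ?A = "{i. j \<le> Poly_Mapping.lookup \<rho> i}"
    have "?A \<subseteq> Poly_Mapping.keys \<rho>" using j by (auto simp: in_keys_iff)
    then have fin: "finite ?A" by (rule finite_subset) simp
    have pos: "1 \<le> i" if "i \<in> ?A" for i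
      using that j \<rho> by (cases i) (auto simp: is_partition_def weak_composition_def)
    have down: "i \<in> ?A" if "1 \<le> i" "i \<le> k" "k \<in> ?A" for i k
      using that(2,3,1)
    proof (induction rule: dec_induct)
      case base
      then show ?case by simp
    next
      case (step n)
      have "Poly_Mapping.lookup \<rho> (n + 1) \<le> Poly_Mapping.lookup \<rho> n"
        using \<rho> step.hyps step.prems unfolding is_partition_def by force
      with step show ?case by auto
    qed
    show ?thesis
    proof (cases "?A = {}")
      case True
      then show ?thesis by simp
    next
      case False
      have eq: "?A = {1..Max ?A}"
      proof (intro equalityI subsetI)
        fix i assume "i \<in> ?A"
        with pos Max_ge[OF fin] show "i \<in> {1..Max ?A}" by (simp del: mem_Collect_eq)
      next
        fix i assume "i \<in> {1..Max ?A}"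
        then show "i \<in> ?A" using down[OF _ _ Max_in[OF fin False], of i] by simp
      qed
      have "card ?A = card {1..Max ?A}" by (rule arg_cong[OF eq])
      then have "card ?A = Max ?A" by simp
      with eq show ?thesis by (simp only:)
    qed
  qed
  have "{i. j \<le> Poly_Mapping.lookup \<mu> i} = {i. j \<le> Poly_Mapping.lookup \<nu> i}" if "1 \<le> j" for j
    using initial[OF \<mu> that] initial[OF \<nu> that] card_eq[OF that] by (simp only:)
  then have iff: "j \<le> Poly_Mapping.lookup \<mu> i \<longleftrightarrow> j \<le> Poly_Mapping.lookup \<nu> i" if "1 \<le> j" for i j
    using that by auto
  have "Poly_Mapping.lookup \<mu> i = Poly_Mapping.lookup \<nu> i" for i
    using iff[of "Poly_Mapping.lookup \<mu> i" i] iff[of "Poly_Mapping.lookup \<nu> i" i] by linarith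
  then show ?thesis by (rule poly_mapping_eqI)
qed

definition sort_comp :: "(nat \<Rightarrow>\<^sub>0 nat) \<Rightarrow> (nat \<Rightarrow>\<^sub>0 nat)" where
  "sort_comp \<alpha> = (THE \<mu>. is_partition \<mu> \<and> (\<exists>w\<in>S_inf. \<mu> = act w \<alpha>))"

lemma sort_comp_unique:
  assumes "weak_composition \<alpha>"
  shows "\<exists>!\<mu>. is_partition \<mu> \<and> (\<exists>w\<in>S_inf. \<mu> = act w \<alpha>)"
proof -
  have act0: "weak_composition (act w \<alpha>)" if "w \<in> S_inf" for w
    using assms S_inf_fixes_0[OF S_inf_inv[OF that]] S_inf_bij[OF that]
    by (simp add: weak_composition_def lookup_act)
  define m :: "(nat \<Rightarrow>\<^sub>0 nat) \<Rightarrow> nat" where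
    "m = (\<lambda>\<beta>. \<Sum>i\<in>Poly_Mapping.keys \<beta>. i * Poly_Mapping.lookup \<beta> i)"
  obtain w where w: "w \<in> S_inf" and min: "\<And>v. v \<in> S_inf \<Longrightarrow> m (act w \<alpha>) \<le> m (act v \<alpha>)"
    using exists_least_iff[of "\<lambda>k. \<exists>v\<in>S_inf. m (act v \<alpha>) = k"] S_inf_id
    by (metis linorder_not_less)
  let ?\<beta> = "act w \<alpha>"
  have "Poly_Mapping.lookup ?\<beta> (i + 1) \<le> Poly_Mapping.lookup ?\<beta> i" if i: "1 \<le> i" for i
  proof (rule ccontr)
    assume less: "\<not> ?thesis"
    let ?\<gamma> = "act (simple_refl i) ?\<beta>"
    define K where "K = Poly_Mapping.keys ?\<beta> \<union> Poly_Mapping.keys ?\<gamma> - {i, i + 1}"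
    have m_eq: "m \<delta> = i * Poly_Mapping.lookup \<delta> i + (i + 1) * Poly_Mapping.lookup \<delta> (i + 1)
        + (\<Sum>k\<in>K. k * Poly_Mapping.lookup \<delta> k)" if "\<delta> \<in> {?\<beta>, ?\<gamma>}" for \<delta>
    proof -
      have "m \<delta> = (\<Sum>k\<in>insert i (insert (i + 1) K). k * Poly_Mapping.lookup \<delta> k)"
        unfolding m_def using that
        by (intro sum.mono_neutral_left) (auto simp: K_def in_keys_iff)
      then show ?thesis by (simp add: K_def)
    qed
    have "(\<Sum>k\<in>K. k * Poly_Mapping.lookup ?\<gamma> k) = (\<Sum>k\<in>K. k * Poly_Mapping.lookup ?\<beta> k)"
      by (rule sum.cong) (auto simp: K_def lookup_act simple_refl_def transpose_def)
    moreover have "Poly_Mapping.lookup ?\<gamma> i = Poly_Mapping.lookup ?\<beta> (i + 1)"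
      "Poly_Mapping.lookup ?\<gamma> (i + 1) = Poly_Mapping.lookup ?\<beta> i"
      unfolding lookup_act[OF bij_simple_refl] by (simp_all add: simple_refl_def)
    ultimately have "m ?\<gamma> < m ?\<beta>" using less m_eq[of ?\<beta>] m_eq[of ?\<gamma>] by simp
    moreover have "?\<gamma> = act (simple_refl i \<circ> w) \<alpha>"
      using w by (simp add: act_comp S_inf_bij)
    ultimately show False
      using min[OF S_inf_comp[OF S_inf_refl[OF i] w]] by simp
  qed
  then have part: "is_partition ?\<beta>" using act0[OF w] by (simp add: is_partition_def)
  have card_act: "card {i. j \<le> Poly_Mapping.lookup (act v \<alpha>) i}
      = card {i. j \<le> Poly_Mapping.lookup \<alpha> i}" if "v \<in> S_inf" for v j
  proof -
    have b: "bij v" using that by (rule S_inf_bij)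
    have "{i. j \<le> Poly_Mapping.lookup (act v \<alpha>) i} = v ` {i. j \<le> Poly_Mapping.lookup \<alpha> i}"
      using b by (auto simp: lookup_act image_iff bij_is_inj) (metis bij_inv_eq_iff)
    then show ?thesis by (simp add: card_image b bij_is_inj inj_on_subset[of v UNIV])
  qed
  show ?thesis
  proof (rule ex1I[of _ ?\<beta>])
    show "is_partition ?\<beta> \<and> (\<exists>w\<in>S_inf. ?\<beta> = act w \<alpha>)" using part w by blast
  next
    fix \<mu> assume "is_partition \<mu> \<and> (\<exists>w\<in>S_inf. \<mu> = act w \<alpha>)"
    then show "\<mu> = ?\<beta>" using part w by (auto intro!: partition_eqI simp: card_act)
  qed
qed

definition min_perm :: "(nat \<Rightarrow>\<^sub>0 nat) \<Rightarrow> nat \<Rightarrow> nat" where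
  "min_perm \<alpha> = (ARG_MIN perm_length u. u \<in> S_inf \<and> \<alpha> = act u (sort_comp \<alpha>))"

definition key_poly :: "(nat \<Rightarrow>\<^sub>0 nat) \<Rightarrow> mpoly" where
  "key_poly \<alpha> = pi_perm (min_perm \<alpha>) (x_pow (sort_comp \<alpha>))"

definition diagram :: "(nat \<Rightarrow>\<^sub>0 nat) \<Rightarrow> (nat \<times> nat) set" where
  "diagram \<mu> = {(i, j). 1 \<le> i \<and> 1 \<le> j \<and> j \<le> Poly_Mapping.lookup \<mu> i}"

lemma finite_diagram: "finite (diagram \<mu>)"
proof (rule finite_subset)
  show "diagram \<mu> \<subseteq> (SIGMA i:Poly_Mapping.keys \<mu>. {..Poly_Mapping.lookup \<mu> i})"
    by (auto simp: diagram_def in_keys_iff)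
qed simp

definition addable_corner :: "(nat \<Rightarrow>\<^sub>0 nat) \<Rightarrow> nat \<times> nat \<Rightarrow> bool" where
  "addable_corner \<rho> c \<longleftrightarrow>
     c \<notin> diagram \<rho> \<and> (\<exists>\<mu>. is_partition \<mu> \<and> diagram \<mu> = insert c (diagram \<rho>))"

definition removable_corner :: "(nat \<Rightarrow>\<^sub>0 nat) \<Rightarrow> nat \<times> nat \<Rightarrow> bool" where
  "removable_corner \<rho> c \<longleftrightarrow>
     c \<in> diagram \<rho> \<and> (\<exists>\<mu>. is_partition \<mu> \<and> diagram \<mu> = diagram \<rho> - {c})"

lift_definition partition_transpose :: "(nat \<Rightarrow>\<^sub>0 nat) \<Rightarrow> (nat \<Rightarrow>\<^sub>0 nat)" is
  "\<lambda>\<mu> j. card {i. 1 \<le> i \<and> 1 \<le> j \<and> j \<le> \<mu> i}"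
proof -
  fix \<mu> :: "nat \<Rightarrow> nat"
  assume fin: "finite {i. \<mu> i \<noteq> 0}"
  have "{j. card {i. 1 \<le> i \<and> 1 \<le> j \<and> j \<le> \<mu> i} \<noteq> 0} \<subseteq> (\<Union>i\<in>{i. \<mu> i \<noteq> 0}. {..\<mu> i})"
  proof
    fix j assume "j \<in> {j. card {i. 1 \<le> i \<and> 1 \<le> j \<and> j \<le> \<mu> i} \<noteq> 0}"
    then have "{i. 1 \<le> i \<and> 1 \<le> j \<and> j \<le> \<mu> i} \<noteq> {}" by (metis (mono_tags) card.empty mem_Collect_eq)
    then obtain i where "1 \<le> j" "j \<le> \<mu> i" by blast
    then show "j \<in> (\<Union>i\<in>{i. \<mu> i \<noteq> 0}. {..\<mu> i})" by (intro UN_I[of i]) auto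
  qed
  then show "finite {j. card {i. 1 \<le> i \<and> 1 \<le> j \<and> j \<le> \<mu> i} \<noteq> 0}"
    by (rule finite_subset) (use fin in simp)
qed

text \<open>For \<open>i = 1\<close> the pair \<open>(i, i - 1) = (1, 0)\<close> is not a cell, hence never removable.\<close>

definition skew_symmetric_partition :: "(nat \<Rightarrow>\<^sub>0 nat) \<Rightarrow> bool" where
  "skew_symmetric_partition \<rho> \<longleftrightarrow> is_partition \<rho> \<and> partition_transpose \<rho> = \<rho> \<and>
     (\<forall>i\<ge>1. (removable_corner \<rho> (i, i) \<longrightarrow> \<not> addable_corner \<rho> (i, i + 1)) \<and>
            (addable_corner \<rho> (i, i) \<longrightarrow> \<not> removable_corner \<rho> (i, i - 1)))"

definition skew_symmetric :: "(nat \<Rightarrow>\<^sub>0 nat) \<Rightarrow> bool" where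
  "skew_symmetric \<gamma> \<longleftrightarrow> skew_symmetric_partition (sort_comp \<gamma>)"

definition is_strict_partition :: "(nat \<Rightarrow>\<^sub>0 nat) \<Rightarrow> bool" where
  "is_strict_partition \<mu> \<longleftrightarrow> is_partition \<mu> \<and>
     inj_on (Poly_Mapping.lookup \<mu>) (Poly_Mapping.keys \<mu>)"

text \<open>Subtraction is truncated, so the values \<open>\<rho>\<^sub>i - i \<le> 0\<close> become 0 and are discarded.\<close>

definition half_less :: "(nat \<Rightarrow>\<^sub>0 nat) \<Rightarrow> (nat \<Rightarrow>\<^sub>0 nat)" where
  "half_less \<rho> = (THE \<mu>. is_strict_partition \<mu> \<and>
     Poly_Mapping.lookup \<mu> ` Poly_Mapping.keys \<mu>
       = {Poly_Mapping.lookup \<rho> i - i | i. 1 \<le> i} \<inter> {1..})"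

lemma half_less_unique:
  assumes "is_partition \<rho>"
  shows "\<exists>!\<mu>. is_strict_partition \<mu> \<and>
     Poly_Mapping.lookup \<mu> ` Poly_Mapping.keys \<mu>
       = {Poly_Mapping.lookup \<rho> i - i | i. 1 \<le> i} \<inter> {1..}"
proof -
  let ?S = "{Poly_Mapping.lookup \<rho> i - i | i. 1 \<le> i} \<inter> {1..}"
  define h where "h = (\<lambda>i. Poly_Mapping.lookup \<rho> i - i)"
  define \<mu> where "\<mu> = Abs_poly_mapping h"
  have "finite {i. h i \<noteq> 0}"
    by (rule finite_subset[of _ "Poly_Mapping.keys \<rho>"]) (auto simp: h_def in_keys_iff)
  then have l: "Poly_Mapping.lookup \<mu> = h" by (simp add: \<mu>_def)
  have l0: "h 0 = 0" using assms by (simp add: h_def is_partition_def weak_composition_def)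
  have step: "h (Suc i) \<le> h i - 1" if "1 \<le> i" for i
    using assms that unfolding is_partition_def h_def
    by (metis Suc_eq_plus1 diff_Suc_eq_diff_pred diff_commute diff_le_mono)
  have decr: "h k < h i" if "1 \<le> i" "i < k" "h k \<noteq> 0" for i k
    using that(2,3,1)
  proof (induction rule: strict_inc_induct)
    case (base j)
    then show ?case using step[of j] by auto
  next
    case (step j)
    then show ?case using \<open>\<And>i. 1 \<le> i \<Longrightarrow> h (Suc i) \<le> h i - 1\<close>[of j] by auto
  qed
  have "inj_on h (Poly_Mapping.keys \<mu>)"
  proof (rule linorder_inj_onI)
    fix x y assume "x < y" "x \<in> Poly_Mapping.keys \<mu>" "y \<in> Poly_Mapping.keys \<mu>"
    then show "h x \<noteq> h y" using decr[of x y] l0 by (cases x) (auto simp: in_keys_iff l)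
  qed auto
  moreover have "h (i + 1) \<le> h i" if "1 \<le> i" for i using step[OF that] by simp
  then have "is_partition \<mu>" unfolding is_partition_def weak_composition_def l
    using l0 by simp
  moreover have "h ` Poly_Mapping.keys \<mu> = ?S"
  proof (intro equalityI subsetI)
    fix v assume "v \<in> h ` Poly_Mapping.keys \<mu>"
    then obtain i where "v = h i" "h i \<noteq> 0" by (auto simp: in_keys_iff l)
    moreover from this have "1 \<le> i" using l0 by (cases i) auto
    ultimately show "v \<in> ?S" by (auto simp: h_def)
  qed (auto simp: in_keys_iff l h_def)
  ultimately have ex: "is_strict_partition \<mu> \<and> Poly_Mapping.lookup \<mu> ` Poly_Mapping.keys \<mu> = ?S"
    by (simp add: is_strict_partition_def l)
  have card_eq: "card {i. j \<le> Poly_Mapping.lookup \<nu> i} = card {v \<in> ?S. j \<le> v}"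
    if \<nu>: "is_strict_partition \<nu> \<and> Poly_Mapping.lookup \<nu> ` Poly_Mapping.keys \<nu> = ?S" and j: "1 \<le> j"
    for \<nu> j
  proof -
    let ?A = "{i. j \<le> Poly_Mapping.lookup \<nu> i}"
    have sub: "?A \<subseteq> Poly_Mapping.keys \<nu>" using j by (auto simp: in_keys_iff)
    have "Poly_Mapping.lookup \<nu> ` ?A
      = {v \<in> Poly_Mapping.lookup \<nu> ` Poly_Mapping.keys \<nu>. j \<le> v}"
      using sub by auto
    also have "\<dots> = {v \<in> ?S. j \<le> v}" using \<nu> by (simp only:)
    finally have img: "Poly_Mapping.lookup \<nu> ` ?A = {v \<in> ?S. j \<le> v}" .
    have "inj_on (Poly_Mapping.lookup \<nu>) ?A"
      using \<nu> sub inj_on_subset unfolding is_strict_partition_def by blast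
    from card_image[OF this] show ?thesis unfolding img by (rule sym)
  qed
  show ?thesis
  proof (rule ex1I[of _ \<mu>])
    fix \<nu> assume "is_strict_partition \<nu> \<and> Poly_Mapping.lookup \<nu> ` Poly_Mapping.keys \<nu> = ?S"
    note \<nu> = this
    show "\<nu> = \<mu>"
    proof (rule partition_eqI)
      show "is_partition \<nu>" "is_partition \<mu>"
        using \<nu> ex by (simp_all only: is_strict_partition_def)
      show "card {i. j \<le> Poly_Mapping.lookup \<nu> i} = card {i. j \<le> Poly_Mapping.lookup \<mu> i}"
        if "1 \<le> j" for j
        using card_eq[OF \<nu> that] card_eq[OF ex that] by (simp only:)
    qed
  qed (rule ex)
qed

definition key_poly_P :: "(nat \<Rightarrow>\<^sub>0 nat) \<Rightarrow> mpoly" where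
  "key_poly_P \<gamma> = pi_perm (min_perm \<gamma>)
     (\<Prod>(i, j)\<in>diagram (half_less (sort_comp \<gamma>)). var i + var (i + j))"

end

theory Submission
  imports Defs "HOL-Combinatorics.Permutations" "HOL-Library.Infinite_Set"
begin

text \<open>
  The key polynomial of \<open>\<alpha>\<close> is computed by a climb: start with the monomial of the sorted
  composition and, whenever a descent \<open>\<alpha>\<^sub>i > \<alpha>\<^sub>i\<^sub>+\<^sub>1\<close> is exchanged, apply \<open>\<pi>\<^sub>i\<close>. The braid relations make
  the outcome independent of the route (\<open>climbs_functional\<close>), and a reduced word of the minimal
  permutation is one such route (\<open>climbs_pi_perm\<close>). The polynomials \<open>\<kappa>\<^sup>P\<close> arise from the same climbs
  with another starting polynomial, so both families can be compared step by step.

  Two tools do the rest. The first is the alternating sum over the permutations of \<open>x\<^sub>1, \<dots>, x\<^sub>N\<close>.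
  After multiplication by \<open>x\<^sup>\<delta>\<close> with \<open>\<delta> = (N-1, \<dots>, 1, 0)\<close> it does not see the operators \<open>\<pi>\<^sub>i\<close>
  (\<open>alternate_pi_op\<close>), so a climb can be replaced by its starting polynomial. The second is the
  leading term: \<open>x\<^sup>\<alpha>\<close> is the reverse lexicographically largest monomial of the key polynomial of
  \<open>\<alpha>\<close>, hence key polynomials determine their compositions (\<open>key_poly_inject\<close>).

  Suppose the two polynomials agree, and let \<open>\<mu>\<close> be the strict partition attached to \<open>\<gamma>\<close>.
  Alternation gives that \<open>x\<^sup>\<delta>\<close> times the monomial of the sorted \<open>\<alpha>\<close>, and \<open>x\<^sup>\<delta>\<close> times the product of the
  \<open>x\<^sub>i + x\<^sub>i\<^sub>+\<^sub>j\<close> over the diagram of \<open>\<mu>\<close>, have the same alternating sum. Expanding the product means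
  choosing an end of every edge \<open>{i, i + j}\<close>. Only one choice leads to the exponent \<open>\<delta> + \<mu>\<close> up to
  permutation; if \<open>\<mu>\<^sub>k \<ge> \<mu>\<^sub>k\<^sub>+\<^sub>1 + 2\<close>, then only one choice leads to \<open>\<delta> + \<mu>\<close> with a unit moved from row
  \<open>k\<close> to row \<open>k + 1\<close>. A single monomial cannot produce both, so \<open>\<mu> = (n, \<dots>, 2, 1)\<close>
  (\<open>alternate_diagram_forces_staircase\<close>), and the two corner conditions leave only the square
  \<open>(n + 1)\<^sup>n\<^sup>+\<^sup>1\<close> for the sorted \<open>\<gamma>\<close> (\<open>skew_symmetric_square\<close>).

  For the square the starting polynomial is the product of all \<open>x\<^sub>i + x\<^sub>j\<close> with \<open>i < j \<le> n + 1\<close>, which is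
  itself the key polynomial of \<open>(0, 1, \<dots>, n)\<close>: it is the quotient of the Vandermonde determinants
  in the \<open>x\<^sub>i\<^sup>2\<close> and in the \<open>x\<^sub>i\<close> (\<open>climbs_reversed_staircase\<close>). From there the climb from the square to
  \<open>\<gamma>\<close> runs parallel to a climb towards the composition with entries \<open>0, 1, \<dots>, n\<close> on the support
  of \<open>\<gamma>\<close> (\<open>climbs_block_stairs\<close>). This identifies \<open>\<kappa>\<^sup>P\<close> with a key polynomial, and injectivity
  recovers \<open>\<alpha>\<close>.
\<close>

section \<open>Divided differences and the braid relations\<close>

type_synonym exponents = "nat \<Rightarrow>\<^sub>0 nat"

abbreviation lookup :: "('a \<Rightarrow>\<^sub>0 'b::zero) \<Rightarrow> 'a \<Rightarrow> 'b" where
  "lookup \<equiv> Poly_Mapping.lookup"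

abbreviation single :: "'a \<Rightarrow> 'b \<Rightarrow> ('a \<Rightarrow>\<^sub>0 'b::zero)" where
  "single \<equiv> Poly_Mapping.single"

abbreviation keys :: "('a \<Rightarrow>\<^sub>0 'b::zero) \<Rightarrow> 'a set" where
  "keys \<equiv> Poly_Mapping.keys"

abbreviation swap_entries :: "nat \<Rightarrow> exponents \<Rightarrow> exponents" where
  "swap_entries i \<equiv> act (simple_refl i)"

abbreviation swap_vars :: "nat \<Rightarrow> mpoly \<Rightarrow> mpoly" where
  "swap_vars i \<equiv> permute_vars (simple_refl i)"

text \<open>
  Every polynomial is an integer combination of monomials, so an additive property has to be
  checked on monomials only.
\<close>

lemma mpoly_induct [case_names zero monomial diff]:
  fixes f :: mpoly
  assumes "P 0" and "\<And>\<alpha>. P (single \<alpha> 1)" and "\<And>f g. P f \<Longrightarrow> P g \<Longrightarrow> P (f - g)"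
  shows "P f"
proof -
  have "keys f \<subseteq> UNIV" by simp
  then show ?thesis by (induction f rule: frag_induction) (use assms in auto)
qed

lemma act_add: "bij w \<Longrightarrow> act w (\<alpha> + \<beta>) = act w \<alpha> + act w \<beta>"
  by (rule poly_mapping_eqI) (simp add: lookup_act lookup_add)

lemma act_single: "bij w \<Longrightarrow> act w (single i n) = single (w i) n"
  by (rule poly_mapping_eqI) (auto simp: lookup_act lookup_single when_def bij_inv_eq_iff)

lemma act_zero [simp]: "bij w \<Longrightarrow> act w 0 = 0"
  by (rule poly_mapping_eqI) (simp add: lookup_act)

lemma permute_vars_zero [simp]: "permute_vars w 0 = 0"
  by (simp add: permute_vars_def)

lemma permute_vars_monomial [simp]: "permute_vars w (single \<alpha> 1) = single (act w \<alpha>) 1"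
  by (simp add: permute_vars_def)

lemma permute_vars_diff: "permute_vars w (f - g) = permute_vars w f - permute_vars w g"
  by (simp add: permute_vars_def frag_extend_diff)

lemma permute_vars_add: "permute_vars w (f + g) = permute_vars w f + permute_vars w g"
  by (simp add: permute_vars_def frag_extend_add)

lemma permute_vars_mult:
  assumes "bij w"
  shows "permute_vars w (f * g) = permute_vars w f * permute_vars w g"
proof (induction f rule: mpoly_induct)
  case (monomial \<alpha>)
  show ?case
    by (induction g rule: mpoly_induct)
      (simp_all add: permute_vars_diff right_diff_distrib mult_single act_add assms)
qed (simp_all add: permute_vars_diff left_diff_distrib)

lemma permute_vars_one [simp]: "bij w \<Longrightarrow> permute_vars w 1 = 1"
  using permute_vars_monomial[of w 0] by simp

lemma permute_vars_var [simp]: "bij w \<Longrightarrow> permute_vars w (var i) = var (w i)"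
  unfolding var_def by (simp add: act_single)

lemma permute_vars_power: "bij w \<Longrightarrow> permute_vars w (f ^ n) = permute_vars w f ^ n"
  by (induction n) (simp_all add: permute_vars_mult)

lemma permute_vars_prod:
  "bij w \<Longrightarrow> permute_vars w (\<Prod>i\<in>A. f i) = (\<Prod>i\<in>A. permute_vars w (f i))"
  by (induction A rule: infinite_finite_induct) (simp_all add: permute_vars_mult)

lemma permute_vars_comp:
  "bij v \<Longrightarrow> bij w \<Longrightarrow> permute_vars v (permute_vars w f) = permute_vars (v \<circ> w) f"
  by (induction f rule: mpoly_induct) (simp_all add: permute_vars_diff act_comp)

lemma permute_vars_id [simp]: "permute_vars id f = f"
  by (induction f rule: mpoly_induct) (simp_all add: permute_vars_diff act_id[unfolded id_def] id_def)

lemma simple_refl_simps [simp]: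
  "simple_refl i i = Suc i" "simple_refl i (Suc i) = i"
  by (simp_all add: simple_refl_def)

lemma simple_refl_other [simp]: "k \<noteq> i \<Longrightarrow> k \<noteq> Suc i \<Longrightarrow> simple_refl i k = k"
  by (simp add: simple_refl_def)

lemma swap_vars_swap_vars [simp]: "swap_vars i (swap_vars i f) = f"
  by (simp add: permute_vars_comp)

lemma lookup_swap_entries: "lookup (swap_entries i \<alpha>) k = lookup \<alpha> (simple_refl i k)"
  by (simp add: lookup_act)

lemma swap_entries_swap_entries [simp]: "swap_entries i (swap_entries i \<alpha>) = \<alpha>"
  by (simp add: act_comp act_id)

lemma pi_op_eq: "(var i - var (Suc i)) * pi_op i f = var i * f - var (Suc i) * swap_vars i f"
  using theI'[OF pi_op_unique[of i f]] by (simp add: pi_op_def)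

lemma pi_op_eqI:
  assumes "(var i - var (Suc i)) * g = var i * f - var (Suc i) * swap_vars i f"
  shows "pi_op i f = g"
  using assms pi_op_eq[of i f] var_diff_nonzero[of i] by (metis Suc_eq_plus1 mult_left_cancel)

lemma pi_op_diff: "pi_op i (f - g) = pi_op i f - pi_op i g"
  by (rule pi_op_eqI) (simp add: right_diff_distrib pi_op_eq permute_vars_diff)

lemma pi_op_zero [simp]: "pi_op i 0 = 0"
  by (rule pi_op_eqI) simp

lemma var_diff_neq_0: "var i - var (Suc i) \<noteq> 0" 
  using var_diff_nonzero[of i] by simp

text \<open>
  Exchanging \<open>x\<^sub>i\<close> and \<open>x\<^sub>i\<^sub>+\<^sub>1\<close> changes the sign of both the numerator and the denominator of the
  divided difference.
\<close>

lemma swap_vars_pi_op [simp]: "swap_vars i (pi_op i f) = pi_op i f"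
proof -
  have "swap_vars i ((var i - var (Suc i)) * pi_op i f)
      = swap_vars i (var i * f - var (Suc i) * swap_vars i f)"
    by (simp only: pi_op_eq)
  then have "(var (Suc i) - var i) * swap_vars i (pi_op i f) = var (Suc i) * swap_vars i f - var i * f"
    by (simp add: permute_vars_mult permute_vars_diff)
  then have "(var i - var (Suc i)) * swap_vars i (pi_op i f) = (var i - var (Suc i)) * pi_op i f"
    unfolding pi_op_eq by algebra
  with var_diff_neq_0 show ?thesis by (metis mult_left_cancel)
qed

lemma pi_op_invariant: "swap_vars i f = f \<Longrightarrow> pi_op i f = f"
  by (rule pi_op_eqI) (simp add: left_diff_distrib)

lemma var_inj: "var i = var j \<longleftrightarrow> i = j"
proof
  assume "var i = var j"
  then have "single i (1::nat) = single j 1"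
    by (simp add: var_def frag_of_eq)
  then have "keys (single i (1::nat)) = keys (single j (1::nat))" by (rule arg_cong)
  then show "i = j" by simp
qed simp

lemma simple_refl_commute:
  assumes "Suc i < j"
  shows "simple_refl i \<circ> simple_refl j = simple_refl j \<circ> simple_refl i"
  using assms by (auto simp: simple_refl_def transpose_def fun_eq_iff)

lemma simple_refl_braid:
  "simple_refl i \<circ> simple_refl (Suc i) \<circ> simple_refl i
    = simple_refl (Suc i) \<circ> simple_refl i \<circ> simple_refl (Suc i)"
  by (auto simp: simple_refl_def transpose_def fun_eq_iff)

lemma pi_op_commute:
  assumes ij: "Suc i < j"
  shows "pi_op i (pi_op j f) = pi_op j (pi_op i f)"
proof -
  have sw: "swap_vars i (swap_vars j f) = swap_vars j (swap_vars i f)"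
    using simple_refl_commute[OF ij] by (simp add: permute_vars_comp)
  let ?a = "var i" and ?b = "var (Suc i)" and ?c = "var j" and ?d = "var (Suc j)"
  have 1: "(?c - ?d) * swap_vars i (pi_op j f) = ?c * swap_vars i f - ?d * swap_vars i (swap_vars j f)"
    using arg_cong[OF pi_op_eq[of j f], of "swap_vars i"] ij
    by (simp add: permute_vars_mult permute_vars_diff)
  have 2: "(?a - ?b) * swap_vars j (pi_op i f) = ?a * swap_vars j f - ?b * swap_vars j (swap_vars i f)"
    using arg_cong[OF pi_op_eq[of i f], of "swap_vars j"] ij
    by (simp add: permute_vars_mult permute_vars_diff)
  have "(?c - ?d) * ((?a - ?b) * pi_op i (pi_op j f))
      = ?a * ((?c - ?d) * pi_op j f) - ?b * ((?c - ?d) * swap_vars i (pi_op j f))"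
    unfolding pi_op_eq[of i] by (simp add: algebra_simps)
  also have "\<dots> = ?a * (?c * f - ?d * swap_vars j f)
      - ?b * (?c * swap_vars i f - ?d * swap_vars j (swap_vars i f))"
    unfolding 1 pi_op_eq sw ..
  also have "\<dots> = ?c * (?a * f - ?b * swap_vars i f) - ?d * (?a * swap_vars j f - ?b * swap_vars j (swap_vars i f))"
    by (simp add: algebra_simps)
  also have "\<dots> = (?a - ?b) * ((?c - ?d) * pi_op j (pi_op i f))"
    unfolding pi_op_eq[of j "pi_op i f"] right_diff_distrib[of "?a - ?b"] mult.left_commute[of "?a - ?b"] pi_op_eq 2 ..
  finally have "((?c - ?d) * (?a - ?b)) * pi_op i (pi_op j f) = ((?c - ?d) * (?a - ?b)) * pi_op j (pi_op i f)"
    by (simp add: mult_ac)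
  moreover have "(?c - ?d) * (?a - ?b) \<noteq> 0" using var_diff_neq_0 by simp
  ultimately show ?thesis by (metis mult_left_cancel)
qed

text \<open>
  Cleared of denominators, both sides become the alternating sum of \<open>x\<^sub>i\<^sup>2 x\<^sub>i\<^sub>+\<^sub>1 f\<close> over the six
  permutations of \<open>x\<^sub>i, x\<^sub>i\<^sub>+\<^sub>1, x\<^sub>i\<^sub>+\<^sub>2\<close>.
\<close>

lemma pi_op_braid: "pi_op i (pi_op (Suc i) (pi_op i f)) = pi_op (Suc i) (pi_op i (pi_op (Suc i) f))"
proof -
  define x y z where xyz: "x = var i" "y = var (Suc i)" "z = var (Suc (Suc i))"
  define s t where st: "s = swap_vars i" "t = swap_vars (Suc i)"
  have bij: "bij (simple_refl k)" for k by simp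
  have hom: "s (g * h) = s g * s h" "s (g - h) = s g - s h"
    "t (g * h) = t g * t h" "t (g - h) = t g - t h" for g h
    by (simp_all add: st permute_vars_mult permute_vars_diff)
  have vars: "s x = y" "s y = x" "s z = z" "t x = x" "t y = z" "t z = y"
    by (simp_all add: xyz st)
  have inv: "s (s g) = g" "t (t g) = g" for g by (simp_all add: st)
  have braid: "s (t (s g)) = t (s (t g))" for g
    using simple_refl_braid[of i] by (simp add: st permute_vars_comp bij_comp o_assoc)
  have p: "(x - y) * pi_op i g = x * g - y * s g" "(y - z) * pi_op (Suc i) g = y * g - z * t g" for g
    by (simp_all add: xyz st pi_op_eq)
  have ps: "s (pi_op i g) = pi_op i g" "t (pi_op (Suc i) g) = pi_op (Suc i) g" for g
    by (simp_all add: st)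
  \<comment> \<open>the alternating sum of \<open>x\<^sup>2 y f\<close>, in which \<open>s t s\<close> and \<open>t s t\<close> have been identified\<close>
  define R where "R = x * x * y * f - x * y * y * s f - x * x * z * t f + y * y * z * s (t f)
    + x * z * z * t (s f) - y * z * z * t (s (t f))"
  have nz: "x - y \<noteq> 0" "y - z \<noteq> 0" "x - z \<noteq> 0"
    by (auto simp: xyz var_inj)
  have L: "((x - y) * (y - z) * (x - z)) * pi_op i (pi_op (Suc i) (pi_op i f)) = R"
  proof -
    define g where "g = pi_op i f"
    have g: "(x - y) * g = x * f - y * s f" by (simp add: g_def p)
    have tg: "(x - z) * t g = x * t f - z * t (s f)"
      using arg_cong[OF g, of t] by (simp add: hom vars)
    have sg: "s g = g" by (simp add: g_def ps)
    have stg: "(y - z) * s (t g) = y * s (t f) - z * t (s (t f))"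
      using arg_cong[OF tg, of s] by (simp add: hom vars braid)
    define h where "h = pi_op (Suc i) g"
    have h: "(y - z) * h = y * g - z * t g" by (simp add: h_def p)
    have sh: "(x - z) * s h = x * g - z * s (t g)"
      using arg_cong[OF h, of s] by (simp add: hom vars sg)
    have k: "(x - y) * pi_op i h = x * h - y * s h" by (simp add: p)
    have "((x - y) * (y - z) * (x - z)) * pi_op i h = (y - z) * (x - z) * (x * h - y * s h)"
      using k by algebra
    also have "\<dots> = (x - z) * x * (y * g - z * t g) - (y - z) * y * (x * g - z * s (t g))"
      using h sh by algebra
    also have "\<dots> = R"
      unfolding R_def using g tg stg by algebra
    finally show ?thesis by (simp add: h_def g_def)
  qed
  have M: "((x - y) * (y - z) * (x - z)) * pi_op (Suc i) (pi_op i (pi_op (Suc i) f)) = R"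
  proof -
    define g where "g = pi_op (Suc i) f"
    have g: "(y - z) * g = y * f - z * t f" by (simp add: g_def p)
    have sg: "(x - z) * s g = x * s f - z * s (t f)"
      using arg_cong[OF g, of s] by (simp add: hom vars)
    have tg: "t g = g" by (simp add: g_def ps)
    have tsg: "(x - y) * t (s g) = x * t (s f) - y * t (s (t f))"
      using arg_cong[OF sg, of t] by (simp add: hom vars braid)
    define h where "h = pi_op i g"
    have h: "(x - y) * h = x * g - y * s g" by (simp add: h_def p)
    have th: "(x - z) * t h = x * g - z * t (s g)"
      using arg_cong[OF h, of t] by (simp add: hom vars tg)
    have k: "(y - z) * pi_op (Suc i) h = y * h - z * t h" by (simp add: p)
    have "((x - y) * (y - z) * (x - z)) * pi_op (Suc i) h = (x - y) * (x - z) * (y * h - z * t h)"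
      using k by algebra
    also have "\<dots> = (x - z) * y * (x * g - y * s g) - (x - y) * z * (x * g - z * t (s g))"
      using h th by algebra
    also have "\<dots> = R"
      unfolding R_def using g sg tsg by algebra
    finally show ?thesis by (simp add: h_def g_def)
  qed
  have "(x - y) * (y - z) * (x - z) \<noteq> 0" using nz by simp
  with L M show ?thesis by (metis mult_left_cancel)
qed

section \<open>Climbing from a partition to a composition\<close>

text \<open>
  The number of ascents, counted over all pairs of positions, measures how far a composition is
  from being sorted. It plays the role of the length of the minimal sorting permutation.
\<close>

definition ascents :: "exponents \<Rightarrow> (nat \<times> nat) set" where
  "ascents \<alpha> = {(p, q). 1 \<le> p \<and> p < q \<and> lookup \<alpha> p < lookup \<alpha> q}"

definition ascent_number :: "exponents \<Rightarrow> nat" where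
  "ascent_number \<alpha> = card (ascents \<alpha>)"

lemma finite_ascents: "finite (ascents \<alpha>)"
proof (rule finite_subset)
  show "ascents \<alpha> \<subseteq> (SIGMA q:keys \<alpha>. {..q})\<inverse>"
    by (auto simp: ascents_def in_keys_iff)
qed simp

lemma simple_refl_simple_refl [simp]: "simple_refl i (simple_refl i k) = k"
  by (simp add: simple_refl_def)

lemma simple_refl_eq_iff [simp]: "simple_refl i p = simple_refl i q \<longleftrightarrow> p = q"
  by (metis simple_refl_simple_refl)

lemma simple_refl_less:
  assumes "p < q" "(p, q) \<noteq> (i, Suc i)"
  shows "simple_refl i p < simple_refl i q"
  using assms by (auto simp: simple_refl_def transpose_def)

lemma simple_refl_ge1: "1 \<le> i \<Longrightarrow> 1 \<le> simple_refl i p \<longleftrightarrow> 1 \<le> p"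
  by (auto simp: simple_refl_def transpose_def)

text \<open>
  Relabelling positions by \<open>s\<^sub>i\<close> matches the ascents before and after the exchange, except that
  the pair \<open>(i, i + 1)\<close> becomes an ascent.
\<close>

lemma ascent_number_swap:
  assumes i: "1 \<le> i" and desc: "lookup \<alpha> (Suc i) < lookup \<alpha> i"
  shows "ascent_number (swap_entries i \<alpha>) = Suc (ascent_number \<alpha>)"
proof -
  let ?f = "map_prod (simple_refl i) (simple_refl i)"
  have eq: "ascents (swap_entries i \<alpha>) = insert (i, Suc i) (?f ` ascents \<alpha>)"
  proof (intro equalityI subsetI)
    fix c assume c: "c \<in> ascents (swap_entries i \<alpha>)"
    obtain p q where pq: "c = (p, q)" by (cases c)
    show "c \<in> insert (i, Suc i) (?f ` ascents \<alpha>)"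
    proof (cases "c = (i, Suc i)")
      case False
      then have "(simple_refl i p, simple_refl i q) \<in> ascents \<alpha>"
        using c pq simple_refl_less[of p q i] simple_refl_ge1[OF i, of p]
        by (auto simp: ascents_def lookup_swap_entries)
      then have "?f (simple_refl i p, simple_refl i q) \<in> ?f ` ascents \<alpha>" by (rule imageI)
      then show ?thesis using pq by simp
    qed simp
  next
    fix c assume "c \<in> insert (i, Suc i) (?f ` ascents \<alpha>)"
    then show "c \<in> ascents (swap_entries i \<alpha>)"
    proof
      assume "c = (i, Suc i)"
      then show ?thesis using i desc by (simp add: ascents_def lookup_swap_entries)
    next
      assume "c \<in> ?f ` ascents \<alpha>"
      then obtain p q where pq: "(p, q) \<in> ascents \<alpha>" "c = (simple_refl i p, simple_refl i q)"
        by auto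
      have "(p, q) \<noteq> (i, Suc i)" using pq(1) desc by (auto simp: ascents_def)
      then show ?thesis
        using pq simple_refl_less[of p q i] simple_refl_ge1[OF i, of p]
        by (auto simp: ascents_def lookup_swap_entries)
    qed
  qed
  have "(i, Suc i) \<notin> ?f ` ascents \<alpha>"
  proof
    assume "(i, Suc i) \<in> ?f ` ascents \<alpha>"
    then obtain p q where pq: "(p, q) \<in> ascents \<alpha>" "i = simple_refl i p" "Suc i = simple_refl i q"
      by auto
    then have "p = Suc i" "q = i" by (metis simple_refl_simple_refl simple_refl_simps)+
    with pq(1) show False by (simp add: ascents_def)
  qed
  moreover have "card (?f ` ascents \<alpha>) = card (ascents \<alpha>)"
    by (rule card_image) (auto simp: inj_on_def)
  ultimately show ?thesis
    unfolding ascent_number_def eq using finite_ascents by simp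
qed

lemma swap_entries_equal:
  assumes "lookup \<alpha> i = lookup \<alpha> (Suc i)"
  shows "swap_entries i \<alpha> = \<alpha>"
proof (rule poly_mapping_eqI)
  fix k
  show "lookup (swap_entries i \<alpha>) k = lookup \<alpha> k"
    using assms by (cases "k = i"; cases "k = Suc i") (simp_all add: lookup_swap_entries)
qed

lemma ascent_number_swap_le:
  assumes "1 \<le> i"
  shows "ascent_number (swap_entries i \<alpha>) \<le> Suc (ascent_number \<alpha>)"
proof (cases "lookup \<alpha> (Suc i)" "lookup \<alpha> i" rule: linorder_cases)
  case equal
  then have "swap_entries i \<alpha> = \<alpha>"
    by (simp add: swap_entries_equal)
  then show ?thesis by simp
next
  case greater
  then have "lookup (swap_entries i \<alpha>) (Suc i) < lookup (swap_entries i \<alpha>) i"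
    by (simp add: lookup_swap_entries)
  from ascent_number_swap[OF assms this] show ?thesis by simp
next
  case less
  then show ?thesis using ascent_number_swap[OF assms, of \<alpha>] by simp
qed

lemma partition_decreasing:
  assumes \<mu>: "is_partition \<mu>" and "1 \<le> p" "p \<le> q"
  shows "lookup \<mu> q \<le> lookup \<mu> p"
  using assms(3)
proof (induction rule: dec_induct)
  case (step n)
  have "lookup \<mu> (n + 1) \<le> lookup \<mu> n"
    using \<mu> step.hyps assms(2) unfolding is_partition_def by simp
  with step.IH show ?case by simp
qed simp

lemma ascent_number_partition:
  assumes "is_partition \<mu>"
  shows "ascent_number \<mu> = 0"
proof -
  have "(p, q) \<notin> ascents \<mu>" for p q
    using partition_decreasing[OF assms, of p q] by (auto simp: ascents_def)
  then have "ascents \<mu> = {}" by auto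
  then show ?thesis by (simp add: ascent_number_def)
qed

lemma partition_or_ascent:
  assumes "weak_composition \<alpha>"
  obtains "is_partition \<alpha>" | i where "1 \<le> i" "lookup \<alpha> i < lookup \<alpha> (Suc i)"
proof (cases "\<forall>i\<ge>1. lookup \<alpha> (i + 1) \<le> lookup \<alpha> i")
  case True
  then show ?thesis using that(1) assms by (simp add: is_partition_def)
next
  case False
  then show ?thesis using that(2) by auto
qed

definition rearranges :: "exponents \<Rightarrow> exponents \<Rightarrow> bool" where
  "rearranges \<mu> \<alpha> \<longleftrightarrow> (\<exists>w\<in>S_inf. \<alpha> = act w \<mu>)"

lemma rearranges_swap:
  assumes "rearranges \<mu> \<alpha>" "1 \<le> i"
  shows "rearranges \<mu> (swap_entries i \<alpha>)"
proof -
  obtain w where w: "w \<in> S_inf" "\<alpha> = act w \<mu>" using assms(1) by (auto simp: rearranges_def)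
  then have "swap_entries i \<alpha> = act (simple_refl i \<circ> w) \<mu>" by (simp add: act_comp S_inf_bij)
  then show ?thesis using w assms(2) unfolding rearranges_def
    by (blast intro: S_inf_comp S_inf_refl)
qed

lemma weak_composition_act:
  assumes w: "w \<in> S_inf" and \<alpha>: "weak_composition \<alpha>"
  shows "weak_composition (act w \<alpha>)"
  using S_inf_fixes_0[OF S_inf_inv[OF w]] \<alpha>
  by (simp add: weak_composition_def lookup_act S_inf_bij[OF w])

lemma act_inv_act:
  assumes "bij w"
  shows "act (inv w) (act w \<alpha>) = \<alpha>"
  using act_comp[OF bij_imp_bij_inv[OF assms] assms, of \<alpha>] inv_o_cancel[OF bij_is_inj[OF assms]]
    act_id[of \<alpha>] by simp

lemma rearranges_refl: "rearranges \<mu> \<mu>"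
  unfolding rearranges_def by (rule bexI[of _ id]) (simp_all add: act_id[unfolded id_def] id_def S_inf_id[unfolded id_def])

lemma rearranges_inv:
  assumes "rearranges \<mu> \<alpha>"
  shows "rearranges \<alpha> \<mu>"
proof -
  obtain w where w: "w \<in> S_inf" "\<alpha> = act w \<mu>" using assms by (auto simp: rearranges_def)
  have "\<mu> = act (inv w) \<alpha>" unfolding w(2) by (rule act_inv_act[OF S_inf_bij[OF w(1)], symmetric])
  then show ?thesis unfolding rearranges_def using S_inf_inv[OF w(1)] by (rule bexI)
qed

lemma sort_comp_iff:
  assumes "weak_composition \<alpha>"
  shows "sort_comp \<alpha> = \<mu> \<longleftrightarrow> is_partition \<mu> \<and> rearranges \<mu> \<alpha>"
proof -
  have ex1: "\<exists>!\<mu>. is_partition \<mu> \<and> rearranges \<alpha> \<mu>"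
    unfolding rearranges_def by (rule sort_comp_unique[OF assms])
  have sort: "sort_comp \<alpha> = (THE \<mu>. is_partition \<mu> \<and> rearranges \<alpha> \<mu>)"
    unfolding sort_comp_def rearranges_def ..
  have "sort_comp \<alpha> = \<mu> \<longleftrightarrow> is_partition \<mu> \<and> rearranges \<alpha> \<mu>"
    using theI'[OF ex1] the1_equality[OF ex1] unfolding sort by blast
  then show ?thesis using rearranges_inv by blast
qed

lemma rearranges_sort_comp: "weak_composition \<alpha> \<Longrightarrow> rearranges (sort_comp \<alpha>) \<alpha>"
  using sort_comp_iff by blast

lemma is_partition_sort_comp: "weak_composition \<alpha> \<Longrightarrow> is_partition (sort_comp \<alpha>)"
  using sort_comp_iff by blast

lemma rearranges_partition_unique:
  assumes "is_partition \<mu>" "is_partition \<nu>" "rearranges \<mu> \<nu>"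
  shows "\<mu> = \<nu>"
proof -
  have w: "weak_composition \<nu>" using assms(2) by (simp add: is_partition_def)
  have "sort_comp \<nu> = \<mu>" using sort_comp_iff[OF w] assms by simp
  moreover have "sort_comp \<nu> = \<nu>" using sort_comp_iff[OF w] assms rearranges_refl by simp
  ultimately show ?thesis by simp
qed

text \<open>
  A climb records the polynomial together with the composition that it belongs to. Its starting
  polynomial is a parameter because the key polynomials and the polynomials \<open>\<kappa>\<^sup>P\<close> differ only there.
\<close>

inductive climbs :: "exponents \<Rightarrow> mpoly \<Rightarrow> exponents \<Rightarrow> mpoly \<Rightarrow> bool" for \<mu> f0 where
  start: "climbs \<mu> f0 \<mu> f0"
| step: "climbs \<mu> f0 \<alpha> f \<Longrightarrow> 1 \<le> i \<Longrightarrow> lookup \<alpha> (Suc i) < lookup \<alpha> i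
    \<Longrightarrow> climbs \<mu> f0 (swap_entries i \<alpha>) (pi_op i f)"

lemma climbs_rearranges: "climbs \<mu> f0 \<alpha> f \<Longrightarrow> rearranges \<mu> \<alpha>"
proof (induction rule: climbs.induct)
  case start
  show ?case by (rule rearranges_refl)
qed (simp add: rearranges_swap)

lemma climbs_step_back:
  assumes "climbs \<mu> f0 (swap_entries i \<alpha>) f" "1 \<le> i" "lookup \<alpha> i < lookup \<alpha> (Suc i)"
  shows "climbs \<mu> f0 \<alpha> (pi_op i f)"
  using climbs.step[OF assms(1,2)] assms(3) by (simp add: lookup_swap_entries)

lemma ascent_number_swap_back:
  assumes "1 \<le> i" "lookup \<alpha> i < lookup \<alpha> (Suc i)"
  shows "ascent_number \<alpha> = Suc (ascent_number (swap_entries i \<alpha>))"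
  using ascent_number_swap[OF assms(1), of "swap_entries i \<alpha>"] assms(2)
  by (simp add: lookup_swap_entries)

lemma climbs_exists:
  assumes \<mu>: "is_partition \<mu>" and r: "rearranges \<mu> \<alpha>"
  shows "\<exists>f. climbs \<mu> f0 \<alpha> f"
  using r
proof (induction "ascent_number \<alpha>" arbitrary: \<alpha> rule: less_induct)
  case less
  have "weak_composition \<alpha>"
    using less.prems \<mu> weak_composition_act unfolding rearranges_def is_partition_def by blast
  then show ?case
  proof (cases \<alpha> rule: partition_or_ascent)
    case 1
    then have "\<alpha> = \<mu>" using rearranges_partition_unique[OF \<mu> _ less.prems] by simp
    then show ?thesis using climbs.start by blast
  next
    case (2 i)
    with less.hyps[of "swap_entries i \<alpha>"] rearranges_swap[OF less.prems]
    obtain f where "climbs \<mu> f0 (swap_entries i \<alpha>) f"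
      using ascent_number_swap_back[of i \<alpha>] by auto
    then show ?thesis using climbs_step_back 2 by blast
  qed
qed

lemma climbs_ascent_number_0:
  assumes "climbs \<mu> f0 \<alpha> f" "ascent_number \<alpha> = 0"
  shows "\<alpha> = \<mu> \<and> f = f0"
  using assms by cases (simp_all add: ascent_number_swap)

lemma swap_entries_commute:
  "Suc i < j \<Longrightarrow> swap_entries i (swap_entries j \<alpha>) = swap_entries j (swap_entries i \<alpha>)"
  using simple_refl_commute[of i j] by (simp add: act_comp)

lemma swap_entries_braid:
  "swap_entries i (swap_entries (Suc i) (swap_entries i \<alpha>))
    = swap_entries (Suc i) (swap_entries i (swap_entries (Suc i) \<alpha>))"
  using simple_refl_braid[of i] by (simp add: act_comp bij_comp o_assoc)

text \<open>
  This is a diamond argument in place of the word property of Coxeter groups. If the last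
  exchanges of two climbs happen at positions \<open>i < j\<close>, then \<open>\<alpha>\<close> has ascents at both, so both climbs
  can be rerouted through a common earlier composition: through \<open>s\<^sub>i s\<^sub>j \<alpha>\<close> when \<open>i\<close> and \<open>j\<close> are not
  adjacent, and through the composition with all three entries reversed when they are. The
  operators applied on the two sides of the diamond agree by the braid relations.
\<close>

lemma climbs_functional:
  assumes \<mu>: "is_partition \<mu>"
  shows "climbs \<mu> f0 \<alpha> f \<Longrightarrow> climbs \<mu> f0 \<alpha> g \<Longrightarrow> f = g"
proof (induction "ascent_number \<alpha>" arbitrary: \<alpha> f g rule: less_induct)
  case less
  note IH = less.hyps
  have main: "pi_op i f' = pi_op j g'"
    if f': "climbs \<mu> f0 (swap_entries i \<alpha>) f'" and g': "climbs \<mu> f0 (swap_entries j \<alpha>) g'"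
      and i: "1 \<le> i" "lookup \<alpha> i < lookup \<alpha> (Suc i)"
      and j: "1 \<le> j" "lookup \<alpha> j < lookup \<alpha> (Suc j)" and ij: "i \<le> j"
    for i j f' g'
  proof -
    have r: "rearranges \<mu> \<alpha>" using less.prems climbs_rearranges by blast
    note exists = climbs_exists[OF \<mu>, of _ f0]
    have less_i: "ascent_number (swap_entries i \<alpha>) < ascent_number \<alpha>"
      and less_j: "ascent_number (swap_entries j \<alpha>) < ascent_number \<alpha>"
      using ascent_number_swap_back[OF i] ascent_number_swap_back[OF j] by linarith+
    consider "i = j" | "j = Suc i" | "Suc i < j" using ij by linarith
    then show ?thesis
    proof cases
      case 1
      then have "f' = g'" using IH[OF less_i f', of g'] g' by blast
        then show ?thesis using 1 by simp
    next
      case 3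
      have "rearranges \<mu> (swap_entries i (swap_entries j \<alpha>))"
        by (intro rearranges_swap r i j)
      then obtain h where h: "climbs \<mu> f0 (swap_entries i (swap_entries j \<alpha>)) h"
        using exists by blast
      have "climbs \<mu> f0 (swap_entries j \<alpha>) (pi_op i h)"
        by (rule climbs_step_back) (use 3 i h in \<open>auto simp: lookup_swap_entries\<close>)
      then have "g' = pi_op i h" by (rule IH[OF less_j g'])
      moreover have "climbs \<mu> f0 (swap_entries i \<alpha>) (pi_op j h)"
        by (rule climbs_step_back) (use 3 j h swap_entries_commute[OF 3, of \<alpha>] in \<open>auto simp: lookup_swap_entries\<close>)
      then have "f' = pi_op j h" by (rule IH[OF less_i f'])
      ultimately show ?thesis using pi_op_commute[OF 3] by simp
    next
      case 2
      define \<theta> where "\<theta> = swap_entries i (swap_entries j (swap_entries i \<alpha>))"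
      have \<theta>': "\<theta> = swap_entries j (swap_entries i (swap_entries j \<alpha>))"
        unfolding \<theta>_def 2 by (rule swap_entries_braid)
      have "rearranges \<mu> \<theta>" unfolding \<theta>_def by (intro rearranges_swap r i j)
      then obtain h where h: "climbs \<mu> f0 \<theta> h" using exists by blast
      have "climbs \<mu> f0 (swap_entries j (swap_entries i \<alpha>)) (pi_op i h)"
        by (rule climbs_step_back) (use h i j 2 in \<open>auto simp: lookup_swap_entries \<theta>_def\<close>)
      then have "climbs \<mu> f0 (swap_entries i \<alpha>) (pi_op j (pi_op i h))"
        by (rule climbs_step_back[of _ _ j]) (use i j 2 in \<open>auto simp: lookup_swap_entries\<close>)
      then have "f' = pi_op j (pi_op i h)" by (rule IH[OF less_i f'])
      moreover have "climbs \<mu> f0 (swap_entries i (swap_entries j \<alpha>)) (pi_op j h)"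
        by (rule climbs_step_back) (use h i j 2 in \<open>auto simp: lookup_swap_entries \<theta>'\<close>)
      then have "climbs \<mu> f0 (swap_entries j \<alpha>) (pi_op i (pi_op j h))"
        by (rule climbs_step_back[of _ _ i]) (use i j 2 in \<open>auto simp: lookup_swap_entries\<close>)
      then have "g' = pi_op i (pi_op j h)" by (rule IH[OF less_j g'])
      ultimately show ?thesis using pi_op_braid[of i h] 2 by simp
    qed
  qed
  show ?case
  proof (cases "ascent_number \<alpha> = 0")
    case True
    from climbs_ascent_number_0[OF less.prems(1) this] climbs_ascent_number_0[OF less.prems(2) this]
    show ?thesis by simp
  next
    case False
    have last: "\<exists>i f'. 1 \<le> i \<and> lookup \<alpha> i < lookup \<alpha> (Suc i) \<and> climbs \<mu> f0 (swap_entries i \<alpha>) f'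
        \<and> f = pi_op i f'" if "climbs \<mu> f0 \<alpha> f" for f
      using that
    proof cases
      case start
      then show ?thesis using False ascent_number_partition[OF \<mu>] by simp
    next
      case (step \<beta> f' i)
      then show ?thesis by (intro exI[of _ i] exI[of _ f']) (simp add: lookup_swap_entries)
    qed
    obtain i f' where i: "1 \<le> i" "lookup \<alpha> i < lookup \<alpha> (Suc i)"
      "climbs \<mu> f0 (swap_entries i \<alpha>) f'" "f = pi_op i f'" using last[OF less.prems(1)] by blast
    obtain j g' where j: "1 \<le> j" "lookup \<alpha> j < lookup \<alpha> (Suc j)"
      "climbs \<mu> f0 (swap_entries j \<alpha>) g'" "g = pi_op j g'" using last[OF less.prems(2)] by blast
    show ?thesis
    proof (cases "i \<le> j")
      case True
      show ?thesis unfolding i(4) j(4) by (rule main[OF i(3) j(3) i(1,2) j(1,2) True])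
    next
      case False
      then have "j \<le> i" by simp
      from main[OF j(3) i(3) j(1,2) i(1,2) this] show ?thesis unfolding i(4) j(4) by (rule sym)
    qed
  qed
qed

lemma climbs_word:
  "climbs \<mu> f0 \<alpha> f \<Longrightarrow> is_partition \<mu> \<Longrightarrow>
    \<exists>a. set a \<subseteq> {1..} \<and> length a = ascent_number \<alpha> \<and> \<alpha> = act (word_perm a) \<mu>"
proof (induction rule: climbs.induct)
  case start
  then show ?case
    by (intro exI[of _ "[]"]) (simp add: ascent_number_partition word_perm_def act_id[unfolded id_def] id_def)
next
  case (step \<alpha> f i)
  then obtain a where a: "set a \<subseteq> {1..}" "length a = ascent_number \<alpha>" "\<alpha> = act (word_perm a) \<mu>" by blast
  have "swap_entries i \<alpha> = act (word_perm (i # a)) \<mu>"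
    using act_comp[OF bij_simple_refl[of i] bij_word_perm[of a], of \<mu>] a
    by (simp only: word_perm_Cons)
  moreover have "length (i # a) = ascent_number (swap_entries i \<alpha>)"
    using ascent_number_swap[OF step.hyps(2,3)] a(2) by simp
  moreover have "set (i # a) \<subseteq> {1..}" using step.hyps(2) a(1) by simp
  ultimately show ?case by (intro exI[of _ "i # a"] conjI)
qed

text \<open>
  Every letter creates at most one ascent, which bounds the length of a word from below; a word
  that attains the bound creates one ascent with every letter and is therefore a climb.
\<close>

lemma ascent_number_word_le:
  assumes "set a \<subseteq> {1..}" "is_partition \<mu>"
  shows "ascent_number (act (word_perm a) \<mu>) \<le> length a"
  using assms(1)
proof (induction a)
  case Nil
  then show ?case
    using assms(2) by (simp add: ascent_number_partition word_perm_def act_id[unfolded id_def] id_def)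
next
  case (Cons i a)
  have "ascent_number (act (word_perm (i # a)) \<mu>) \<le> Suc (ascent_number (act (word_perm a) \<mu>))"
    using ascent_number_swap_le[of i "act (word_perm a) \<mu>"] Cons.prems
      act_comp[OF bij_simple_refl[of i] bij_word_perm[of a], of \<mu>]
    unfolding word_perm_Cons by simp
  moreover have "ascent_number (act (word_perm a) \<mu>) \<le> length a" using Cons by simp
  ultimately show ?case by (simp only: list.size)
qed

lemma climbs_of_short_word:
  assumes "set a \<subseteq> {1..}" "is_partition \<mu>" "length a = ascent_number (act (word_perm a) \<mu>)"
  shows "climbs \<mu> f0 (act (word_perm a) \<mu>) (foldr pi_op a f0)"
  using assms(1,3)
proof (induction a)
  case Nil
  then show ?case using climbs.start[of \<mu> f0] by (simp add: word_perm_def act_id[unfolded id_def] id_def)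
next
  case (Cons i a)
  let ?\<beta> = "act (word_perm a) \<mu>"
  have i: "1 \<le> i" using Cons.prems by simp
  have eq: "act (word_perm (i # a)) \<mu> = swap_entries i ?\<beta>"
    by (simp only: word_perm_Cons act_comp[OF bij_simple_refl bij_word_perm])
  have le: "ascent_number ?\<beta> \<le> length a" using Cons.prems by (intro ascent_number_word_le assms) auto
  have num: "ascent_number (swap_entries i ?\<beta>) = Suc (length a)" using Cons.prems(2) unfolding eq by simp
  have desc: "lookup ?\<beta> (Suc i) < lookup ?\<beta> i"
  proof (cases "lookup ?\<beta> (Suc i)" "lookup ?\<beta> i" rule: linorder_cases)
    case equal
    then have "swap_entries i ?\<beta> = ?\<beta>"
      by (simp add: swap_entries_equal)
    then show ?thesis using num le by simp
  next
    case greater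
    then show ?thesis using num le ascent_number_swap_back[OF i greater] by linarith
  qed
  have "length a = ascent_number ?\<beta>"
    using num ascent_number_swap[OF i desc] by simp
  then have "climbs \<mu> f0 ?\<beta> (foldr pi_op a f0)" using Cons by auto
  from climbs.step[OF this i desc] show ?case by (simp only: eq foldr_Cons o_apply)
qed

lemma perm_length_le: "set a \<subseteq> {1..} \<Longrightarrow> perm_length (word_perm a) \<le> length a"
  unfolding perm_length_def by (rule Least_le) (auto simp: is_word_of_def)

lemma word_perm_in_S_inf: "set a \<subseteq> {1..} \<Longrightarrow> word_perm a \<in> S_inf"
proof (induction a)
  case Nil
  have "word_perm [] = id" by (simp add: word_perm_def)
  then show ?case using S_inf_id by (simp only:)
qed (simp add: word_perm_Cons S_inf_comp S_inf_refl)

text \<open>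
  A climb provides a word with as many letters as \<open>\<alpha>\<close> has ascents. Hence the reduced word of the
  minimal permutation has no more letters than that, and the preceding bound makes it a climb.
\<close>

theorem climbs_pi_perm:
  assumes "weak_composition \<alpha>"
  shows "climbs (sort_comp \<alpha>) f0 \<alpha> (pi_perm (min_perm \<alpha>) f0)"
proof -
  define \<mu> where "\<mu> = sort_comp \<alpha>"
  let ?P = "\<lambda>u. u \<in> S_inf \<and> \<alpha> = act u \<mu>"
  let ?u = "min_perm \<alpha>"
  have \<mu>: "is_partition \<mu>" unfolding \<mu>_def by (rule is_partition_sort_comp[OF assms])
  have r: "rearranges \<mu> \<alpha>" unfolding \<mu>_def by (rule rearranges_sort_comp[OF assms])
  then obtain u0 where u0: "?P u0" unfolding rearranges_def by blast
  have u: "?P ?u"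
    unfolding min_perm_def \<mu>_def[symmetric] by (rule arg_min_natI[of ?P, OF u0])
  have min: "perm_length ?u \<le> perm_length v" if "?P v" for v
    unfolding min_perm_def \<mu>_def[symmetric] by (rule arg_min_nat_le[of ?P, OF that])
  define a where "a = (SOME a. reduced_word a ?u)"
  have "reduced_word a ?u"
    unfolding a_def by (rule someI_ex) (rule reduced_word_exists[OF conjunct1[OF u]])
  then have a: "set a \<subseteq> {1..}" "word_perm a = ?u" "length a = perm_length ?u"
    by (auto simp: reduced_word_def is_word_of_def)
  have act_a: "act (word_perm a) \<mu> = \<alpha>" using u a(2) by simp
  obtain c where c: "set c \<subseteq> {1..}" "length c = ascent_number \<alpha>" "\<alpha> = act (word_perm c) \<mu>"
    using climbs_exists[OF \<mu> r] climbs_word[OF _ \<mu>] by blast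
  have "length a \<le> perm_length (word_perm c)"
    unfolding a(3) by (rule min) (use c word_perm_in_S_inf in blast)
  also have "\<dots> \<le> ascent_number \<alpha>" using perm_length_le[OF c(1)] c(2) by simp
  finally have "length a = ascent_number (act (word_perm a) \<mu>)"
    using ascent_number_word_le[OF a(1) \<mu>] act_a by simp
  from climbs_of_short_word[OF a(1) \<mu> this, of f0] show ?thesis
    unfolding act_a unfolding pi_perm_def a_def[symmetric] \<mu>_def[symmetric] .
qed

text \<open>
  Equal neighbouring entries correspond to a symmetry in the two variables. The symmetry is
  inherited along the climb: an exchange far away commutes with it, and for an exchange at an
  adjacent position the climb can be rerouted so that the braid relation transports the symmetry
  from the other pair of neighbours.
\<close>

lemma climbs_equal_entries:
  assumes \<mu>: "is_partition \<mu>"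
    and f0: "\<And>i. 1 \<le> i \<Longrightarrow> lookup \<mu> i = lookup \<mu> (Suc i) \<Longrightarrow> pi_op i f0 = f0"
  shows "climbs \<mu> f0 \<alpha> f \<Longrightarrow> 1 \<le> i \<Longrightarrow> lookup \<alpha> i = lookup \<alpha> (Suc i) \<Longrightarrow> pi_op i f = f"
proof (induction "ascent_number \<alpha>" arbitrary: \<alpha> f i rule: less_induct)
  case less
  note i = less.prems(2,3)
  from less.prems(1) show ?case
  proof cases
    case start
    then show ?thesis using f0 i by simp
  next
    case (step \<beta> g j)
    note \<beta> = \<open>\<alpha> = swap_entries j \<beta>\<close> and f = \<open>f = pi_op j g\<close> and g = \<open>climbs \<mu> f0 \<beta> g\<close>
      and j = \<open>1 \<le> j\<close> \<open>lookup \<beta> (Suc j) < lookup \<beta> j\<close>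
    have num: "ascent_number \<alpha> = Suc (ascent_number \<beta>)" using ascent_number_swap[OF j] \<beta> by simp
    define \<theta> where "\<theta> = swap_entries i \<beta>"
    have "rearranges \<mu> \<theta>" unfolding \<theta>_def using climbs_rearranges[OF g] i by (intro rearranges_swap)
    then obtain h where h: "climbs \<mu> f0 \<theta> h" using climbs_exists[OF \<mu>] by blast
    have adjacent: ?thesis
      if asc: "lookup \<beta> i < lookup \<beta> (Suc i)" and eq: "lookup \<theta> j = lookup \<theta> (Suc j)"
        and braid: "pi_op i (pi_op j (pi_op i h)) = pi_op j (pi_op i (pi_op j h))"
    proof -
      have "climbs \<mu> f0 \<beta> (pi_op i h)" by (rule climbs_step_back) (use h i asc in \<open>auto simp: \<theta>_def\<close>)
      then have "g = pi_op i h" using climbs_functional[OF \<mu>] g by blast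
      moreover have "ascent_number \<theta> < ascent_number \<alpha>"
        using ascent_number_swap_back[OF i(1) asc] num by (simp add: \<theta>_def)
      then have "pi_op j h = h" using less.hyps[OF _ h j(1) eq] by simp
      ultimately show ?thesis using braid f by simp
    qed
    have "i \<noteq> j" using i j \<beta> by (auto simp: lookup_swap_entries)
    then consider "Suc i < j" | "Suc j < i" | "j = Suc i" | "i = Suc j" by linarith
    then show ?thesis
    proof cases
      case 1
      then have "pi_op i g = g"
        using less.hyps[OF _ g] i num by (simp add: \<beta> lookup_swap_entries)
      then show ?thesis using f pi_op_commute[OF 1, of g] by simp
    next
      case 2
      then have "pi_op i g = g"
        using less.hyps[OF _ g] i num by (simp add: \<beta> lookup_swap_entries)
      then show ?thesis using f pi_op_commute[OF 2, of g] by simp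
    next
      case 3
      show ?thesis
        by (rule adjacent) (use 3 i j pi_op_braid[of i h] in \<open>auto simp: \<beta> \<theta>_def lookup_swap_entries\<close>)
    next
      case 4
      show ?thesis
        by (rule adjacent) (use 4 i j pi_op_braid[of j h] in \<open>auto simp: \<beta> \<theta>_def lookup_swap_entries\<close>)
    qed
  qed
qed

lemma climbs_ascent_invariant:
  assumes \<mu>: "is_partition \<mu>" and c: "climbs \<mu> f0 \<alpha> f"
    and i: "1 \<le> i" "lookup \<alpha> i < lookup \<alpha> (Suc i)"
  shows "swap_vars i f = f"
proof -
  have "rearranges \<mu> (swap_entries i \<alpha>)" using climbs_rearranges[OF c] i(1) by (rule rearranges_swap)
  then obtain g where "climbs \<mu> f0 (swap_entries i \<alpha>) g" using climbs_exists[OF \<mu>] by blast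
  from climbs_step_back[OF this i] have "f = pi_op i g" using climbs_functional[OF \<mu> c] by simp
  then show ?thesis by simp
qed

section \<open>Alternating sums and the Vandermonde determinant\<close>

lemma equal_neg_imp_zero:
  fixes a :: "'a::{idom, ring_char_0}"
  assumes "a = - a"
  shows "a = 0"
proof -
  have "a + a = 0" by (rule eq_neg_iff_add_eq_0[THEN iffD1, OF assms])
  then have "2 * a = 0" by (simp only: mult_2)
  then show ?thesis by (simp only: mult_eq_0_iff) simp
qed

text \<open>
  Composition with the transposition of \<open>p\<close> and \<open>q\<close> reverses the sign and fixes the product: a
  determinant with two equal columns vanishes.
\<close>

lemma sum_sign_power_eq_0:
  fixes y :: "'b \<Rightarrow> 'a::{idom, ring_char_0}"
  assumes S: "finite S" and pq: "p \<in> S" "q \<in> S" "p \<noteq> q" and c: "c p = c q"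
  shows "(\<Sum>w | w permutes S. of_int (sign w) * (\<Prod>i\<in>S. y (w i) ^ c i)) = 0"
proof (rule equal_neg_imp_zero)
  let ?t = "transpose p q"
  have t: "?t permutes S" using pq by (simp add: permutes_swap_id)
  have ct: "c (?t i) = c i" for i using c by (simp add: transpose_def)
  have "(\<Sum>w | w permutes S. of_int (sign w) * (\<Prod>i\<in>S. y (w i) ^ c i))
      = (\<Sum>w | w permutes S. of_int (sign (w \<circ> ?t)) * (\<Prod>i\<in>S. y ((w \<circ> ?t) i) ^ c i))"
    by (rule sum_permutations_compose_right[OF t])
  also have "\<dots> = (\<Sum>w | w permutes S. - (of_int (sign w) * (\<Prod>i\<in>S. y (w i) ^ c i)))"
  proof (rule sum.cong[OF refl])
    fix w assume "w \<in> {w. w permutes S}"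
    then have "permutation w" using S permutation_permutes by blast
    then have "sign (w \<circ> ?t) = - sign w"
      using pq by (simp add: sign_compose permutation_swap_id sign_swap_id)
    moreover have "(\<Prod>i\<in>S. y ((w \<circ> ?t) i) ^ c i) = (\<Prod>i\<in>S. y (w i) ^ c i)"
      unfolding prod.permute[OF t, of "\<lambda>i. y (w i) ^ c i"]
      by (rule prod.cong) (simp_all add: ct)
    ultimately show "of_int (sign (w \<circ> ?t)) * (\<Prod>i\<in>S. y ((w \<circ> ?t) i) ^ c i)
        = - (of_int (sign w) * (\<Prod>i\<in>S. y (w i) ^ c i))" by simp
  qed
  finally show "(\<Sum>w | w permutes S. of_int (sign w) * (\<Prod>i\<in>S. y (w i) ^ c i))
      = - (\<Sum>w | w permutes S. of_int (sign w) * (\<Prod>i\<in>S. y (w i) ^ c i))"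
    by (simp add: sum_negf)
qed

lemma prod_linear_factors_expand:
  fixes y :: "'b \<Rightarrow> 'a::comm_ring_1"
  assumes "finite S"
  shows "\<exists>c. \<forall>t. (\<Prod>k\<in>S. t - y k) = t ^ card S + (\<Sum>e<card S. c e * t ^ e)"
  using assms
proof induction
  case empty
  then show ?case by simp
next
  case (insert k S)
  then obtain c where c: "\<And>t. (\<Prod>k\<in>S. t - y k) = t ^ card S + (\<Sum>e<card S. c e * t ^ e)" by blast
  define d where "d = card S"
  define c' where "c' e = (if e = 0 then 0 else c (e - 1)) - y k * (if e = d then 1 else c e)" for e
  have "(t - y k) * (t ^ d + (\<Sum>e<d. c e * t ^ e)) = t ^ Suc d + (\<Sum>e<Suc d. c' e * t ^ e)" for t
  proof -
    have "(\<Sum>e<Suc d. c' e * t ^ e) = (\<Sum>e<Suc d. (if e = 0 then 0 else c (e - 1)) * t ^ e)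
        - y k * (\<Sum>e<Suc d. (if e = d then 1 else c e) * t ^ e)"
      unfolding c'_def sum_distrib_left sum_subtractf[symmetric]
      by (rule sum.cong) (simp_all only: left_diff_distrib mult.assoc)
    also have "(\<Sum>e<Suc d. (if e = d then 1 else c e) * t ^ e) = t ^ d + (\<Sum>e<d. c e * t ^ e)"
      by simp
    also have "(\<Sum>e<Suc d. (if e = 0 then 0 else c (e - 1)) * t ^ e) = t * (\<Sum>e<d. c e * t ^ e)"
      by (simp add: sum.lessThan_Suc_shift sum_distrib_left mult_ac del: sum.lessThan_Suc)
    finally show ?thesis by (simp add: algebra_simps)
  qed
  then show ?case using insert by (intro exI[of _ c']) (simp add: c d_def)
qed

text \<open>
  Adding to the column of highest powers multiples of the lower ones replaces its entries
  \<open>y\<^sub>b\<^sup>N\<^sup>-\<^sup>m\<close> by the values at \<open>y\<^sub>b\<close> of the monic polynomial with roots \<open>y\<^sub>k\<close> for \<open>m < k \<le> N\<close>. Only the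
  entry for \<open>b = m\<close> survives, and expansion along this column leaves the determinant for
  \<open>{Suc m..N}\<close>.
\<close>

lemma vandermonde:
  fixes y :: "nat \<Rightarrow> 'a::{idom, ring_char_0}"
  assumes "m \<le> Suc N"
  shows "(\<Sum>w | w permutes {m..N}. of_int (sign w) * (\<Prod>i\<in>{m..N}. y (w i) ^ (N - i)))
    = (\<Prod>i\<in>{m..N}. \<Prod>j\<in>{Suc i..N}. y i - y j)"
  using assms
proof (induction m rule: inc_induct)
  case base
  then show ?case by simp
next
  case (step m)
  let ?S = "{Suc m..N}"
  have ins: "{m..N} = insert m ?S" using step.hyps by auto
  define d where "d = card ?S"
  have d: "d = N - m" by (simp add: d_def)
  define T where "T e = (\<Sum>w | w permutes {m..N}.
    of_int (sign w) * (y (w m) ^ e * (\<Prod>i\<in>?S. y (w i) ^ (N - i))))" for e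
  have T0: "T e = 0" if "e < d" for e
  proof -
    \<comment> \<open>the columns \<open>m\<close> and \<open>N - e\<close> now have the same exponent \<open>e\<close>\<close>
    have "T e = (\<Sum>w | w permutes {m..N}. of_int (sign w) * (\<Prod>i\<in>{m..N}. y (w i) ^ (if i = m then e else N - i)))"
      unfolding T_def ins by (intro sum.cong refl) simp
    also have "\<dots> = 0"
      by (rule sum_sign_power_eq_0[of _ m "N - e"]) (use that d in auto)
    finally show ?thesis .
  qed
  let ?p = "\<lambda>t. \<Prod>k\<in>?S. t - y k"
  obtain c where c: "\<And>t. ?p t = t ^ d + (\<Sum>e<d. c e * t ^ e)"
    using prod_linear_factors_expand[of ?S y] unfolding d_def by blast
  define f where "f w = of_int (sign w) * (?p (y (w m)) * (\<Prod>i\<in>?S. y (w i) ^ (N - i)))" for w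
  have "(\<Sum>w | w permutes {m..N}. of_int (sign w) * (\<Prod>i\<in>{m..N}. y (w i) ^ (N - i))) = T d"
    unfolding T_def d ins by (intro sum.cong refl) simp
  also have "\<dots> = T d + (\<Sum>e<d. c e * T e)" using T0 by simp
  also have "\<dots> = sum f {w. w permutes {m..N}}"
  proof -
    have "(\<Sum>e<d. c e * T e) = (\<Sum>w | w permutes {m..N}. \<Sum>e<d.
        c e * (of_int (sign w) * (y (w m) ^ e * (\<Prod>i\<in>?S. y (w i) ^ (N - i)))))"
      unfolding T_def sum_distrib_left by (rule sum.swap)
    also have "\<dots> = (\<Sum>w | w permutes {m..N}. of_int (sign w) *
        ((\<Sum>e<d. c e * y (w m) ^ e) * (\<Prod>i\<in>?S. y (w i) ^ (N - i))))"
      unfolding sum_distrib_left sum_distrib_right by (intro sum.cong refl) (simp only: mult_ac)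
    finally show ?thesis
      unfolding T_def f_def c sum.distrib[symmetric] by (simp only: distrib_left distrib_right sum.distrib)
  qed
  also have "\<dots> = (\<Sum>b\<in>insert m ?S. \<Sum>q | q permutes ?S. f (transpose m b \<circ> q))"
    unfolding ins by (rule sum_over_permutations_insert) auto
  also have "\<dots> = (\<Sum>q | q permutes ?S. f q)"
  proof -
    have "f (transpose m b \<circ> q) = 0" if "b \<in> ?S" "q permutes ?S" for b q
    proof -
      have "q m = m" using that(2) by (simp add: permutes_not_in)
      moreover have "?p (y b) = 0" using that(1) by (intro prod_zero) auto
      ultimately show ?thesis by (simp add: f_def)
    qed
    then have "(\<Sum>b\<in>?S. \<Sum>q | q permutes ?S. f (transpose m b \<circ> q)) = 0"
      by (intro sum.neutral ballI) blast
    then show ?thesis by (subst sum.insert) simp_all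
  qed
  also have "\<dots> = (\<Sum>q | q permutes ?S. ?p (y m) * (of_int (sign q) * (\<Prod>i\<in>?S. y (q i) ^ (N - i))))"
  proof (rule sum.cong[OF refl])
    fix q assume "q \<in> {q. q permutes ?S}"
    then have "q m = m" by (simp add: permutes_not_in)
    then show "f q = ?p (y m) * (of_int (sign q) * (\<Prod>i\<in>?S. y (q i) ^ (N - i)))"
      unfolding f_def by (simp only: mult.left_commute)
  qed
  also have "\<dots> = ?p (y m) * (\<Prod>i\<in>?S. \<Prod>j\<in>{Suc i..N}. y i - y j)"
    unfolding sum_distrib_left[symmetric] step.IH ..
  also have "\<dots> = (\<Prod>i\<in>{m..N}. \<Prod>j\<in>{Suc i..N}. y i - y j)"
    unfolding ins by (rule prod.insert[symmetric]) auto
  finally show ?case .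
qed

definition alternate :: "nat \<Rightarrow> mpoly \<Rightarrow> mpoly" where
  "alternate N f = (\<Sum>w | w permutes {1..N}. of_int (sign w) * permute_vars w f)"

lemma alternate_add: "alternate N (f + g) = alternate N f + alternate N g"
  by (simp add: alternate_def permute_vars_add distrib_left sum.distrib)

lemma alternate_diff: "alternate N (f - g) = alternate N f - alternate N g"
  by (simp add: alternate_def permute_vars_diff right_diff_distrib sum_subtractf)

lemma alternate_sum: "alternate N (\<Sum>i\<in>A. f i) = (\<Sum>i\<in>A. alternate N (f i))"
  by (induction A rule: infinite_finite_induct) (simp_all add: alternate_add, simp_all add: alternate_def)

lemma alternate_swap_vars:
  assumes i: "1 \<le> i" "i < N"
  shows "alternate N (swap_vars i f) = - alternate N f"
proof -
  let ?s = "simple_refl i"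
  have s: "?s permutes {1..N}" using i by (simp add: simple_refl_def permutes_swap_id)
  have bij: "bij w" if "w permutes {1..N}" for w using permutes_bij[OF that] .
  have sgn: "sign (w \<circ> ?s) = - sign w" if "w permutes {1..N}" for w
  proof -
    have "permutation w" using that permutation_permutes by blast
    then have "sign (w \<circ> ?s) = sign w * sign ?s"
      by (rule sign_compose) (simp add: simple_refl_def permutation_swap_id)
    then show ?thesis by (simp add: simple_refl_def sign_swap_id)
  qed
  have "alternate N f = (\<Sum>w | w permutes {1..N}. of_int (sign (w \<circ> ?s)) * permute_vars (w \<circ> ?s) f)"
    unfolding alternate_def by (rule sum_permutations_compose_right[OF s])
  also have "\<dots> = (\<Sum>w | w permutes {1..N}. - (of_int (sign w) * permute_vars w (swap_vars i f)))"
    by (rule sum.cong) (simp_all add: sgn permute_vars_comp bij)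
  finally show ?thesis by (simp add: alternate_def sum_negf)
qed

definition staircase :: "nat \<Rightarrow> exponents" where
  "staircase N = (\<Sum>p=1..N. single p (N - p))"

lemma lookup_staircase: "lookup (staircase N) p = (if p = 0 then 0 else N - p)"
  by (auto simp: staircase_def lookup_sum lookup_single when_def)

text \<open>
  Since \<open>x\<^sup>\<delta>\<close> is \<open>x\<^sub>i\<close> times a monomial \<open>m\<close> invariant under \<open>s\<^sub>i\<close>, and since \<open>x\<^sub>i \<pi>\<^sub>i f\<close> and \<open>x\<^sub>i f\<close> have the
  same antisymmetric part under \<open>s\<^sub>i\<close>, the difference of the two products is fixed by \<open>s\<^sub>i\<close>. The
  alternating sum turns that invariance into a change of sign.
\<close>

lemma alternate_pi_op:
  assumes i: "1 \<le> i" "i < N"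
  shows "alternate N (single (staircase N) 1 * pi_op i f) = alternate N (single (staircase N) 1 * f)"
proof -
  define m :: mpoly where "m = single (staircase N - single i 1) 1"
  have "staircase N = (staircase N - single i 1) + single i 1"
    by (rule poly_mapping_eqI) (use i in \<open>auto simp: lookup_add lookup_minus lookup_staircase lookup_single when_def\<close>)
  then have st: "(single (staircase N) 1 :: mpoly) = m * var i"
    unfolding m_def var_def mult_single by simp
  have "swap_entries i (staircase N - single i 1) = staircase N - single i 1"
    by (rule swap_entries_equal) (use i in \<open>auto simp: lookup_minus lookup_staircase lookup_single when_def\<close>)
  then have m: "swap_vars i m = m" by (simp add: m_def)
  let ?h = "m * (var i * pi_op i f)" and ?k = "m * (var i * f)"
  have "?h - swap_vars i ?h = m * ((var i - var (Suc i)) * pi_op i f)"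
    by (simp add: permute_vars_mult m algebra_simps)
  also have "\<dots> = ?k - swap_vars i ?k"
    unfolding pi_op_eq by (simp add: permute_vars_mult m algebra_simps)
  finally have eq: "?h - ?k = swap_vars i (?h - ?k)" by (simp add: permute_vars_diff algebra_simps)
  have "alternate N (?h - ?k) = - alternate N (?h - ?k)"
    by (subst eq) (rule alternate_swap_vars[OF i])
  then have "alternate N (?h - ?k) = 0" by (rule equal_neg_imp_zero)
  then show ?thesis by (simp add: alternate_diff st mult.assoc)
qed

text \<open>
  An exchange moves the larger, hence nonzero, entry to the right. So a climb that ends inside
  \<open>{1..N}\<close> has stayed there and uses only the operators that the alternating sum can absorb.
\<close>

lemma climbs_alternate:
  assumes "climbs \<mu> f0 \<alpha> f" "keys \<alpha> \<subseteq> {1..N}"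
  shows "alternate N (single (staircase N) 1 * f) = alternate N (single (staircase N) 1 * f0)"
  using assms
proof (induction rule: climbs.induct)
  case (step \<alpha> f i)
  have "lookup (swap_entries i \<alpha>) (Suc i) \<noteq> 0" using step.hyps by (simp add: lookup_swap_entries)
  then have "Suc i \<in> keys (swap_entries i \<alpha>)" by (simp add: in_keys_iff)
  then have iN: "i < N" using step.prems by auto
  have "p \<in> {1..N}" if "p \<in> keys \<alpha>" for p
  proof -
    have "simple_refl i p \<in> keys (swap_entries i \<alpha>)"
      using that by (simp add: in_keys_iff lookup_swap_entries)
    then have "simple_refl i p \<in> {1..N}" using step.prems by blast
    then show ?thesis using step.hyps(2) iN by (auto simp: simple_refl_def transpose_def split: if_splits)
  qed
  then have "keys \<alpha> \<subseteq> {1..N}" by blast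
  then show ?case using step.IH alternate_pi_op[OF step.hyps(2) iN] by simp
qed simp

lemma transpose_step: "a \<noteq> b \<Longrightarrow> a \<noteq> Suc b \<Longrightarrow>
  transpose a (Suc b) = simple_refl b \<circ> transpose a b \<circ> simple_refl b"
  by (auto simp: fun_eq_iff simple_refl_def transpose_def)

lemma symmetric_permute_vars:
  assumes sym: "\<And>i. 1 \<le> i \<Longrightarrow> i < N \<Longrightarrow> swap_vars i f = f"
    and w: "w permutes {1..N}"
  shows "permute_vars w f = f"
proof -
  have less: "permute_vars (transpose a b) f = f" if "1 \<le> a" "a < b" "b \<le> N" for a b
    using that(2,3)
  proof (induction b)
    case (Suc b)
    show ?case
    proof (cases "a = b")
      case True
      then show ?thesis using sym[of a] Suc.prems that(1) by (simp add: simple_refl_def)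
    next
      case False
      then have ab: "a < b" using Suc.prems by simp
      have "permute_vars (transpose a (Suc b)) f
          = permute_vars (simple_refl b) (permute_vars (transpose a b) (permute_vars (simple_refl b) f))"
        using ab by (simp add: transpose_step permute_vars_comp bij_comp o_assoc)
      also have "\<dots> = f" using sym[of b] Suc ab that(1) by simp
      finally show ?thesis .
    qed
  qed simp
  have tr: "permute_vars (transpose a b) f = f" if "a \<in> {1..N}" "b \<in> {1..N}" "a \<noteq> b" for a b
    using less[of a b] less[of b a] that by (cases "a < b") (auto simp: transpose_commute)
  from w have "finite {1..N}" "w permutes {1..N}" by simp_all
  then show ?thesis
  proof (induction rule: permutes_rev_induct)
    case id
    show ?case by (rule permute_vars_id)
  next
    case (swap a b p)
    have "permute_vars (p \<circ> transpose a b) f = permute_vars p (permute_vars (transpose a b) f)"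
      using permutes_bij[OF swap.hyps(4)] by (simp add: permute_vars_comp)
    also have "\<dots> = f" using tr[OF swap.hyps(1-3)] swap.IH by simp
    finally show ?case .
  qed
qed

lemma alternate_symmetric_mult:
  assumes sym: "\<And>i. 1 \<le> i \<Longrightarrow> i < N \<Longrightarrow> swap_vars i f = f"
  shows "alternate N (f * g) = f * alternate N g"
  unfolding alternate_def sum_distrib_left
  by (rule sum.cong)
    (use symmetric_permute_vars[OF sym] in \<open>auto simp: permute_vars_mult permutes_bij mult_ac\<close>)

lemma monomial_staircase: "(single (staircase N) 1 :: mpoly) = (\<Prod>p=1..N. var p ^ (N - p))"
  by (simp add: staircase_def var_power prod_single del: One_nat_def)

lemma alternate_staircase_power:
  "alternate N (single (staircase N) 1 ^ k) = (\<Prod>i\<in>{1..N}. \<Prod>j\<in>{Suc i..N}. var i ^ k - var j ^ k)"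
proof -
  have "alternate N (single (staircase N) 1 ^ k)
      = (\<Sum>w | w permutes {1..N}. of_int (sign w) * (\<Prod>p\<in>{1..N}. (var (w p) ^ k) ^ (N - p)))"
    unfolding alternate_def monomial_staircase
  proof (rule sum.cong[OF refl])
    fix w assume "w \<in> {w. w permutes {1..N}}"
    then have w: "bij w" using permutes_bij by blast
    have "permute_vars w ((\<Prod>p\<in>{1..N}. var p ^ (N - p)) ^ k)
        = (\<Prod>p\<in>{1..N}. (var (w p) ^ (N - p)) ^ k)"
      by (simp only: permute_vars_power[OF w] permute_vars_prod[OF w] permute_vars_var[OF w]
          prod_power_distrib)
    also have "\<dots> = (\<Prod>p\<in>{1..N}. (var (w p) ^ k) ^ (N - p))"
      by (simp only: power_mult[symmetric] mult.commute)
    finally show "of_int (sign w) * permute_vars w ((\<Prod>p\<in>{1..N}. var p ^ (N - p)) ^ k)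
        = of_int (sign w) * (\<Prod>p\<in>{1..N}. (var (w p) ^ k) ^ (N - p))" by simp
  qed
  also have "\<dots> = (\<Prod>i\<in>{1..N}. \<Prod>j\<in>{Suc i..N}. var i ^ k - var j ^ k)"
    by (rule vandermonde) simp
  finally show ?thesis .
qed

lemma staircase_partition: "is_partition (staircase N)"
  by (auto simp: is_partition_def weak_composition_def lookup_staircase)

text \<open>
  The polynomial \<open>f\<close> at the end of the climb is symmetric in \<open>x\<^sub>1, \<dots>, x\<^sub>N\<close>, so it can be pulled out
  of the alternating sum of \<open>f x\<^sup>\<delta>\<close>, which leaves a Vandermonde determinant. As alternation does not
  see the climb, the same sum is the alternating sum of \<open>x\<^sup>2\<^sup>\<delta>\<close>, the Vandermonde determinant in the
  squares. The quotient of \<open>x\<^sub>i\<^sup>2 - x\<^sub>j\<^sup>2\<close> by \<open>x\<^sub>i - x\<^sub>j\<close> is \<open>x\<^sub>i + x\<^sub>j\<close>.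
\<close>

lemma climbs_reversed_staircase:
  assumes climbs: "climbs (staircase N) (single (staircase N) 1) \<alpha> f"
    and \<alpha>: "keys \<alpha> \<subseteq> {1..N}" and inc: "\<And>i. 1 \<le> i \<Longrightarrow> i < N \<Longrightarrow> lookup \<alpha> i < lookup \<alpha> (Suc i)"
  shows "f = (\<Prod>i\<in>{1..N}. \<Prod>j\<in>{Suc i..N}. var i + var j)"
proof -
  let ?x = "single (staircase N) 1 :: mpoly"
  let ?V = "\<Prod>i\<in>{1..N}. \<Prod>j\<in>{Suc i..N}. var i - var j"
  let ?G = "\<Prod>i\<in>{1..N}. \<Prod>j\<in>{Suc i..N}. var i + var j"
  have sym: "swap_vars i f = f" if "1 \<le> i" "i < N" for i
    by (rule climbs_ascent_invariant[OF staircase_partition climbs that(1) inc[OF that]])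
  have "f * ?V = alternate N (f * ?x)"
    using alternate_staircase_power[of N 1] alternate_symmetric_mult[OF sym, of N ?x] by simp
  also have "\<dots> = alternate N (?x ^ 2)"
    using climbs_alternate[OF climbs \<alpha>] by (simp add: mult.commute power2_eq_square)
  also have "\<dots> = (\<Prod>i\<in>{1..N}. \<Prod>j\<in>{Suc i..N}. (var i + var j) * (var i - var j))"
    unfolding alternate_staircase_power by (intro prod.cong refl) (simp add: power2_eq_square algebra_simps)
  also have "\<dots> = ?G * ?V" by (simp only: prod.distrib)
  finally have "f * ?V = ?G * ?V" .
  moreover have "?V \<noteq> 0" by (auto simp: var_inj)
  ultimately show ?thesis using mult_right_cancel[of ?V f ?G] by blast
qed

section \<open>Key polynomials obtained from squares\<close>

lemma transpose_in_S_inf: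
  assumes "1 \<le> a" "a < b"
  shows "transpose a b \<in> S_inf"
  using assms(2)
proof (induction b)
  case (Suc b)
  show ?case
  proof (cases "a = b")
    case True
    then show ?thesis using S_inf_refl[OF assms(1)] by (simp add: simple_refl_def)
  next
    case False
    then have ab: "a < b" using Suc.prems by simp
    then have "simple_refl b \<in> S_inf" using assms(1) by (simp add: S_inf_refl)
    with Suc.IH[OF ab] have "simple_refl b \<circ> transpose a b \<circ> simple_refl b \<in> S_inf"
      by (intro S_inf_comp)
    moreover have "transpose a (Suc b) = simple_refl b \<circ> transpose a b \<circ> simple_refl b"
      by (rule transpose_step) (use ab in auto)
    ultimately show ?thesis by (simp only:)
  qed
qed simp

lemma permutes_in_S_inf:
  assumes "w permutes {1..N}"
  shows "w \<in> S_inf"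
proof -
  have tr: "transpose a b \<in> S_inf" if "a \<in> {1..N}" "b \<in> {1..N}" "a \<noteq> b" for a b
    using transpose_in_S_inf[of a b] transpose_in_S_inf[of b a] that
    by (cases "a < b") (auto simp: transpose_commute)
  from assms have "finite {1..N}" "w permutes {1..N}" by simp_all
  then show ?thesis
  proof (induction rule: permutes_rev_induct)
    case (swap a b p)
    from S_inf_comp[OF swap.IH tr[OF swap.hyps(1-3)]] show ?case .
  qed (rule S_inf_id)
qed

text \<open>
  These are the shapes of \<open>\<gamma>\<close> and \<open>\<alpha>\<close> in the theorem, given by the set \<open>I\<close> of the positions
  \<open>i\<^sub>0 < i\<^sub>1 < \<dots> < i\<^sub>n\<close>; the position \<open>i\<^sub>0\<close> carries the entry 0 of \<open>stairs I\<close>.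
\<close>

definition block :: "nat set \<Rightarrow> exponents" where
  "block I = (\<Sum>p\<in>I. single p (card I))"

definition stairs :: "nat set \<Rightarrow> exponents" where
  "stairs I = (\<Sum>p\<in>I. single p (card {q \<in> I. q < p}))"

lemma lookup_block: "finite I \<Longrightarrow> lookup (block I) p = (if p \<in> I then card I else 0)"
  by (simp add: block_def lookup_sum lookup_single when_def)

lemma lookup_stairs:
  "finite I \<Longrightarrow> lookup (stairs I) p = (if p \<in> I then card {q \<in> I. q < p} else 0)"
  by (simp add: stairs_def lookup_sum lookup_single when_def)

lemma mem_simple_refl_image: "p \<in> simple_refl i ` I \<longleftrightarrow> simple_refl i p \<in> I"
  by (metis image_iff simple_refl_simple_refl)

lemma card_simple_refl_image: "card (simple_refl i ` I) = card I"
  by (rule card_image) (simp add: inj_on_def)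

lemma swap_block: "finite I \<Longrightarrow> swap_entries i (block I) = block (simple_refl i ` I)"
  by (rule poly_mapping_eqI)
    (simp add: lookup_swap_entries lookup_block mem_simple_refl_image card_simple_refl_image)

lemma swap_stairs:
  assumes I: "finite I" and i: "i \<in> I" "Suc i \<notin> I"
  shows "swap_entries i (stairs I) = stairs (simple_refl i ` I)"
proof (rule poly_mapping_eqI)
  fix p
  have "card {q \<in> simple_refl i ` I. q < p} = card {q \<in> I. q < simple_refl i p}"
    if p: "simple_refl i p \<in> I"
  proof -
    have eq: "{q \<in> simple_refl i ` I. q < p} = simple_refl i ` {q \<in> I. q < simple_refl i p}"
    proof (intro equalityI subsetI)
      fix q assume q: "q \<in> {q \<in> simple_refl i ` I. q < p}"
      have "simple_refl i q < simple_refl i p"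
        by (rule simple_refl_less) (use q i p in \<open>auto simp: mem_simple_refl_image\<close>)
      with q show "q \<in> simple_refl i ` {q \<in> I. q < simple_refl i p}"
        by (simp add: mem_simple_refl_image)
    next
      fix q assume q: "q \<in> simple_refl i ` {q \<in> I. q < simple_refl i p}"
      then have "simple_refl i q < simple_refl i p" "simple_refl i q \<in> I"
        by (simp_all add: mem_simple_refl_image)
      moreover have "simple_refl i (simple_refl i q) < simple_refl i (simple_refl i p)"
        by (rule simple_refl_less) (use calculation i p in auto)
      ultimately show "q \<in> {q \<in> simple_refl i ` I. q < p}"
        by (simp add: mem_simple_refl_image)
    qed
    show ?thesis unfolding eq by (rule card_simple_refl_image)
  qed
  then show "lookup (swap_entries i (stairs I)) p = lookup (stairs (simple_refl i ` I)) p"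
    using I by (simp add: lookup_swap_entries lookup_stairs mem_simple_refl_image)
qed

lemma rearranges_staircase_stairs: "rearranges (staircase N) (stairs {1..N})"
proof -
  define w where "w p = (if p \<in> {1..N} then Suc N - p else p)" for p
  have ww: "w (w p) = p" for p by (auto simp: w_def)
  have "w permutes {1..N}"
    by (rule bij_imp_permutes[OF bij_betw_byWitness[where f' = w]]) (use ww in \<open>auto simp: w_def\<close>)
  then have w: "w \<in> S_inf" by (rule permutes_in_S_inf)
  have inv: "inv w = w" by (rule inv_equality) (rule ww)+
  have "stairs {1..N} = act w (staircase N)"
  proof (rule poly_mapping_eqI)
    fix p
    have "{q \<in> {1..N}. q < p} = {1..<p}" if "p \<in> {1..N}" using that by auto
    then show "lookup (stairs {1..N}) p = lookup (act w (staircase N)) p"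
      unfolding lookup_act[OF S_inf_bij[OF w]] inv lookup_staircase
      by (auto simp: lookup_stairs w_def)
  qed
  then show ?thesis unfolding rearranges_def using w by blast
qed

lemma pi_op_monomial_equal:
  "lookup \<mu> i = lookup \<mu> (Suc i) \<Longrightarrow> pi_op i (single \<mu> 1) = single \<mu> 1"
  by (rule pi_op_invariant) (simp add: swap_entries_equal)

text \<open>
  Both climbs exchange the same positions. An exchange that moves the first element of \<open>I\<close> is not
  a descent of \<open>stairs I\<close>, where it exchanges two zeros; there the operator acts as the identity
  by \<open>climbs_equal_entries\<close>, so the climb towards \<open>stairs I\<close> may pause.
\<close>

lemma climbs_block_stairs:
  assumes N: "1 \<le> N"
    and climbs: "climbs (block {1..N}) (\<Prod>i\<in>{1..N}. \<Prod>j\<in>{Suc i..N}. var i + var j) \<gamma> f"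
  shows "\<exists>I. finite I \<and> 0 \<notin> I \<and> card I = N \<and> \<gamma> = block I
    \<and> climbs (staircase N) (single (staircase N) 1) (stairs I) f"
  using climbs
proof (induction rule: climbs.induct)
  case start
  obtain f where f: "climbs (staircase N) (single (staircase N) 1) (stairs {1..N}) f"
    using climbs_exists[OF staircase_partition rearranges_staircase_stairs] by blast
  have st: "lookup (stairs {1..N}) p = (if p \<in> {1..N} then p - 1 else 0)" for p
  proof -
    have "{q \<in> {1..N}. q < p} = {1..<p}" if "p \<in> {1..N}" using that by auto
    then show ?thesis by (simp add: lookup_stairs)
  qed
  have "keys (stairs {1..N}) \<subseteq> {1..N}"
  proof
    fix p assume "p \<in> keys (stairs {1..N})"
    then show "p \<in> {1..N}" unfolding in_keys_iff st by (simp split: if_splits)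
  qed
  then have "f = (\<Prod>i\<in>{1..N}. \<Prod>j\<in>{Suc i..N}. var i + var j)"
    by (rule climbs_reversed_staircase[OF f]) (unfold st, auto)
  with f show ?case by (intro exI[of _ "{1..N}"]) simp
next
  case (step \<gamma> f i)
  then obtain I where I: "finite I" "0 \<notin> I" "card I = N" "\<gamma> = block I"
    and c: "climbs (staircase N) (single (staircase N) 1) (stairs I) f" by blast
  have i: "i \<in> I" "Suc i \<notin> I" using step.hyps(3) I N by (auto simp: lookup_block split: if_splits)
  have "0 \<notin> simple_refl i ` I"
    using I(2) step.hyps(2) by (simp add: mem_simple_refl_image)
  moreover have "climbs (staircase N) (single (staircase N) 1) (stairs (simple_refl i ` I)) (pi_op i f)"
  proof (cases "lookup (stairs I) i = 0")
    case True
    then have eq: "lookup (stairs I) i = lookup (stairs I) (Suc i)"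
      using I i by (simp add: lookup_stairs)
    have "pi_op i f = f"
      by (rule climbs_equal_entries[OF staircase_partition pi_op_monomial_equal c step.hyps(2) eq])
    moreover have "stairs (simple_refl i ` I) = stairs I"
      unfolding swap_stairs[OF I(1) i, symmetric] by (rule swap_entries_equal[OF eq])
    ultimately show ?thesis using c by simp
  next
    case False
    moreover have "lookup (stairs I) (Suc i) = 0" using I i by (simp add: lookup_stairs)
    ultimately have "lookup (stairs I) (Suc i) < lookup (stairs I) i" by simp
    from climbs.step[OF c step.hyps(2) this] show ?thesis by (simp only: swap_stairs[OF I(1) i])
  qed
  ultimately show ?case
    using I by (intro exI[of _ "simple_refl i ` I"]) (simp add: swap_block card_simple_refl_image)
qed

lemma weak_composition_stairs: "finite I \<Longrightarrow> 0 \<notin> I \<Longrightarrow> weak_composition (stairs I)"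
  by (simp add: weak_composition_def lookup_stairs)

lemma climbs_key_poly:
  assumes "weak_composition \<alpha>"
  shows "climbs (sort_comp \<alpha>) (single (sort_comp \<alpha>) 1) \<alpha> (key_poly \<alpha>)"
  using climbs_pi_perm[OF assms] by (simp add: key_poly_def x_pow_eq_single)

section \<open>Leading terms of key polynomials\<close>

lemma pi_op_mult_invariant:
  assumes "swap_vars i m = m"
  shows "pi_op i (m * f) = m * pi_op i f"
proof (rule pi_op_eqI)
  have "(var i - var (Suc i)) * (m * pi_op i f) = m * ((var i - var (Suc i)) * pi_op i f)"
    by (simp only: mult.left_commute)
  then show "(var i - var (Suc i)) * (m * pi_op i f)
      = var i * (m * f) - var (Suc i) * swap_vars i (m * f)"
    unfolding pi_op_eq by (simp add: permute_vars_mult assms algebra_simps)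
qed

lemma pi_op_var_power:
  "pi_op i (var i ^ d) = (\<Sum>k<Suc d. var (Suc i) ^ (d - k) * var i ^ k)"
  by (rule pi_op_eqI) (use power_diff_sumr2[of "var i" "Suc d" "var (Suc i)"]
    in \<open>simp add: permute_vars_power\<close>)

lemma pi_op_var_power_Suc:
  "pi_op i (var (Suc i) ^ Suc e)
    = - (var i * var (Suc i) * (\<Sum>k<e. var (Suc i) ^ (e - Suc k) * var i ^ k))"
proof (rule pi_op_eqI)
  have "(var i - var (Suc i)) * - (var i * var (Suc i) * (\<Sum>k<e. var (Suc i) ^ (e - Suc k) * var i ^ k))
      = - (var i * var (Suc i) * (var i ^ e - var (Suc i) ^ e))"
    unfolding power_diff_sumr2[of "var i" e "var (Suc i)"] by (simp only: mult_minus_right mult.left_commute)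
  then show "(var i - var (Suc i)) * - (var i * var (Suc i) * (\<Sum>k<e. var (Suc i) ^ (e - Suc k) * var i ^ k))
      = var i * var (Suc i) ^ Suc e - var (Suc i) * swap_vars i (var (Suc i) ^ Suc e)"
    by (simp add: permute_vars_power permute_vars_mult algebra_simps)
qed

definition with_entries :: "exponents \<Rightarrow> nat \<Rightarrow> nat \<Rightarrow> nat \<Rightarrow> exponents" where
  "with_entries \<nu> i a b = \<nu> - single i (lookup \<nu> i) - single (Suc i) (lookup \<nu> (Suc i))
     + single i a + single (Suc i) b"

lemma lookup_with_entries:
  "lookup (with_entries \<nu> i a b) q = (if q = i then a else if q = Suc i then b else lookup \<nu> q)"
  by (auto simp: with_entries_def lookup_add lookup_minus lookup_single when_def)

lemma monomial_factorization:
  "\<exists>m. (\<forall>a b. single (with_entries \<nu> i a b) 1 = m * (var i ^ a * var (Suc i) ^ b)) \<and> swap_vars i m = m"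
proof -
  let ?m = "single (\<nu> - single i (lookup \<nu> i) - single (Suc i) (lookup \<nu> (Suc i))) 1 :: mpoly"
  have "swap_vars i ?m = ?m"
    by (simp add: swap_entries_equal lookup_minus lookup_single)
  moreover have "single (with_entries \<nu> i a b) 1 = ?m * (var i ^ a * var (Suc i) ^ b)" for a b
    by (simp add: with_entries_def var_power mult_single add.assoc)
  ultimately show ?thesis by blast
qed

lemma with_entries_same: "with_entries \<nu> i (lookup \<nu> i) (lookup \<nu> (Suc i)) = \<nu>"
  by (rule poly_mapping_eqI) (simp add: lookup_with_entries)

lemma with_entries_swap: "with_entries \<nu> i (lookup \<nu> (Suc i)) (lookup \<nu> i) = swap_entries i \<nu>"
  by (rule poly_mapping_eqI) (auto simp: lookup_with_entries lookup_swap_entries)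

text \<open>
  On \<open>x\<^sub>i\<^sup>p x\<^sub>i\<^sub>+\<^sub>1\<^sup>q\<close> with \<open>p \<ge> q\<close> the operator gives the whole string of monomials between
  the exponents \<open>(p, q)\<close> and \<open>(q, p)\<close>.
\<close>

lemma pi_op_monomial_descent:
  assumes "lookup \<nu> (Suc i) \<le> lookup \<nu> i"
  defines "d \<equiv> lookup \<nu> i - lookup \<nu> (Suc i)"
  shows "pi_op i (single \<nu> 1)
    = (\<Sum>k<Suc d. single (with_entries \<nu> i (lookup \<nu> (Suc i) + k) (lookup \<nu> i - k)) 1)"
proof -
  define q where "q = lookup \<nu> (Suc i)"
  have p: "lookup \<nu> i = q + d" using assms by (simp add: q_def)
  let ?x = "var i" and ?y = "var (Suc i)"
  obtain m where m: "\<And>a b. single (with_entries \<nu> i a b) 1 = m * (?x ^ a * ?y ^ b)"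
    and inv: "swap_vars i m = m"
    using monomial_factorization[of \<nu> i] by blast
  have inv': "swap_vars i (m * (?x * ?y) ^ q) = m * (?x * ?y) ^ q"
    using inv by (simp add: permute_vars_mult permute_vars_power mult.commute)
  have "single \<nu> 1 = m * (?x ^ (q + d) * ?y ^ q)"
    using m[of "q + d" q] with_entries_same[of \<nu> i] by (simp add: p q_def)
  also have "\<dots> = m * (?x * ?y) ^ q * ?x ^ d" by (simp add: power_add power_mult_distrib mult_ac)
  finally have "pi_op i (single \<nu> 1) = m * (?x * ?y) ^ q * (\<Sum>k<Suc d. ?y ^ (d - k) * ?x ^ k)"
    by (simp only: pi_op_mult_invariant[OF inv'] pi_op_var_power)
  also have "\<dots> = (\<Sum>k<Suc d. single (with_entries \<nu> i (q + k) (q + d - k)) 1)"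
    unfolding sum_distrib_left m
  proof (rule sum.cong[OF refl])
    fix k assume "k \<in> {..<Suc d}"
    then have "q + d - k = q + (d - k)" by simp
    then show "m * (?x * ?y) ^ q * (?y ^ (d - k) * ?x ^ k) = m * (?x ^ (q + k) * ?y ^ (q + d - k))"
      by (simp add: power_add power_mult_distrib mult_ac)
  qed
  finally show ?thesis by (simp add: p q_def)
qed

text \<open>
  For \<open>p < q\<close> the result is minus the string of monomials strictly between \<open>(p, q)\<close> and \<open>(q, p)\<close>.
\<close>

lemma pi_op_monomial_ascent:
  assumes "lookup \<nu> i < lookup \<nu> (Suc i)"
  defines "e \<equiv> lookup \<nu> (Suc i) - lookup \<nu> i - 1"
  shows "pi_op i (single \<nu> 1)
    = - (\<Sum>k<e. single (with_entries \<nu> i (lookup \<nu> i + Suc k) (lookup \<nu> (Suc i) - Suc k)) 1)"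
proof -
  define p where "p = lookup \<nu> i"
  have q: "lookup \<nu> (Suc i) = p + Suc e" using assms by (simp add: p_def)
  let ?x = "var i" and ?y = "var (Suc i)"
  obtain m where m: "\<And>a b. single (with_entries \<nu> i a b) 1 = m * (?x ^ a * ?y ^ b)"
    and inv: "swap_vars i m = m"
    using monomial_factorization[of \<nu> i] by blast
  have inv': "swap_vars i (m * (?x * ?y) ^ p) = m * (?x * ?y) ^ p"
    using inv by (simp add: permute_vars_mult permute_vars_power mult.commute)
  have "single \<nu> 1 = m * (?x ^ p * ?y ^ (p + Suc e))"
    using m[of p "p + Suc e"] with_entries_same[of \<nu> i] by (simp add: p_def q)
  also have "\<dots> = m * (?x * ?y) ^ p * ?y ^ Suc e"
    by (simp only: power_add power_mult_distrib mult_ac)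
  finally have "pi_op i (single \<nu> 1)
      = m * (?x * ?y) ^ p * - (?x * ?y * (\<Sum>k<e. ?y ^ (e - Suc k) * ?x ^ k))"
    by (simp only: pi_op_mult_invariant[OF inv'] pi_op_var_power_Suc)
  also have "\<dots> = - (\<Sum>k<e. m * (?x * ?y) ^ p * (?x * ?y * (?y ^ (e - Suc k) * ?x ^ k)))"
    by (simp only: sum_distrib_left mult_minus_right)
  also have "\<dots> = - (\<Sum>k<e. single (with_entries \<nu> i (p + Suc k) (p + Suc e - Suc k)) 1)"
    unfolding m
  proof (intro arg_cong[of _ _ uminus] sum.cong refl)
    fix k assume "k \<in> {..<e}"
    then have e: "p + Suc e - Suc k = p + Suc (e - Suc k)" by simp
    show "m * (?x * ?y) ^ p * (?x * ?y * (?y ^ (e - Suc k) * ?x ^ k))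
        = m * (?x ^ (p + Suc k) * ?y ^ (p + Suc e - Suc k))"
      unfolding e by (simp only: power_add power_Suc power_mult_distrib mult_ac)
  qed
  finally show ?thesis by (simp add: p_def q)
qed

lemma keys_sum_monomials:
  assumes "\<nu>' \<in> keys (\<Sum>k\<in>K. single (g k) (1::int))"
  shows "\<exists>k\<in>K. \<nu>' = g k"
proof -
  have "keys (\<Sum>k\<in>K. single (g k) (1::int)) \<subseteq> (\<Union>k\<in>K. keys (single (g k) (1::int)))"
    by (rule keys_sum)
  with assms show ?thesis by auto
qed

lemma keys_pi_op_monomial:
  assumes "\<nu>' \<in> keys (pi_op i (single \<nu> 1))"
  shows "lookup \<nu>' (Suc i) \<le> max (lookup \<nu> i) (lookup \<nu> (Suc i))"
    and "q \<noteq> i \<Longrightarrow> q \<noteq> Suc i \<Longrightarrow> lookup \<nu>' q = lookup \<nu> q"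
proof -
  have "\<exists>a b. \<nu>' = with_entries \<nu> i a b \<and> b \<le> max (lookup \<nu> i) (lookup \<nu> (Suc i))"
  proof (cases "lookup \<nu> (Suc i) \<le> lookup \<nu> i")
    case True
    from keys_sum_monomials[OF assms[unfolded pi_op_monomial_descent[OF True]]]
    obtain k where "\<nu>' = with_entries \<nu> i (lookup \<nu> (Suc i) + k) (lookup \<nu> i - k)" by blast
    then show ?thesis by (intro exI conjI) auto
  next
    case False
    then have "lookup \<nu> i < lookup \<nu> (Suc i)" by simp
    from keys_sum_monomials[OF assms[unfolded pi_op_monomial_ascent[OF this] keys_minus]]
    obtain k where "\<nu>' = with_entries \<nu> i (lookup \<nu> i + Suc k) (lookup \<nu> (Suc i) - Suc k)" by blast
    then show ?thesis by (intro exI conjI) auto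
  qed
  then show "lookup \<nu>' (Suc i) \<le> max (lookup \<nu> i) (lookup \<nu> (Suc i))"
    and "q \<noteq> i \<Longrightarrow> q \<noteq> Suc i \<Longrightarrow> lookup \<nu>' q = lookup \<nu> q"
    by (auto simp: lookup_with_entries)
qed

lemma keys_pi_op_monomial_tail:
  assumes desc: "lookup \<nu> (Suc i) < lookup \<nu> i"
    and "\<nu>' \<in> keys (pi_op i (single \<nu> 1) - single (swap_entries i \<nu>) 1)"
  shows "lookup \<nu>' (Suc i) < lookup \<nu> i"
    and "q \<noteq> i \<Longrightarrow> q \<noteq> Suc i \<Longrightarrow> lookup \<nu>' q = lookup \<nu> q"
proof -
  define g where "g k = with_entries \<nu> i (lookup \<nu> (Suc i) + k) (lookup \<nu> i - k)" for k
  have "single (g 0) 1 = single (swap_entries i \<nu>) 1"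
    by (simp add: g_def with_entries_swap)
  then have "pi_op i (single \<nu> 1) - single (swap_entries i \<nu>) 1
      = (\<Sum>k<lookup \<nu> i - lookup \<nu> (Suc i). single (g (Suc k)) (1::int))"
    unfolding pi_op_monomial_descent[OF less_imp_le[OF desc]] g_def[symmetric]
    by (simp add: sum.lessThan_Suc_shift del: sum.lessThan_Suc)
  from keys_sum_monomials[OF assms(2)[unfolded this]]
  obtain k where "\<nu>' = g (Suc k)" by blast
  then show "lookup \<nu>' (Suc i) < lookup \<nu> i"
    and "q \<noteq> i \<Longrightarrow> q \<noteq> Suc i \<Longrightarrow> lookup \<nu>' q = lookup \<nu> q"
    using desc by (auto simp: g_def lookup_with_entries)
qed

text \<open>
  The exponents that are reverse lexicographically smaller than \<open>\<theta>\<close>, where the last position of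
  disagreement is required to lie in \<open>T\<close>. The restriction matters because the operators do not
  respect the order in general: an error at a position that is still to be moved can be
  turned into a larger exponent.
\<close>

definition revlex_less :: "nat set \<Rightarrow> exponents \<Rightarrow> exponents set" where
  "revlex_less T \<theta> = {\<nu>. \<exists>p\<in>T. lookup \<nu> p < lookup \<theta> p \<and> (\<forall>q>p. lookup \<nu> q = lookup \<theta> q)}"

lemma revlex_less_mono: "T \<subseteq> T' \<Longrightarrow> revlex_less T \<theta> \<subseteq> revlex_less T' \<theta>"
  by (auto simp: revlex_less_def)

lemma keys_pi_op_subset:
  assumes "keys f \<subseteq> S" and "\<And>\<nu>. \<nu> \<in> S \<Longrightarrow> keys (pi_op i (single \<nu> 1)) \<subseteq> S'"
  shows "keys (pi_op i f) \<subseteq> S'"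
  using assms(1)
proof (induction f rule: frag_induction)
  case (diff f g)
  then show ?case using keys_diff[of "pi_op i f" "pi_op i g"] by (auto simp: pi_op_diff)
qed (use assms(2) in auto)

text \<open>
  An entry \<open>\<theta>\<^sub>j\<close> is moved past a smaller one. Exponents that already disagree to the right of \<open>t\<close> are
  not touched there. Those that disagree last at \<open>j\<close> have both exponents at \<open>j\<close> and \<open>j + 1\<close> smaller
  than \<open>\<theta>\<^sub>j\<close>, so what arrives at position \<open>j + 1\<close> remains too small.
\<close>

lemma revlex_less_step:
  assumes desc: "lookup \<theta> (Suc j) < lookup \<theta> j" and "j < t"
    and f: "keys (f - single \<theta> 1) \<subseteq> revlex_less (insert j {t<..}) \<theta>"
  shows "keys (pi_op j f - single (swap_entries j \<theta>) 1)
    \<subseteq> revlex_less (insert (Suc j) {t<..}) (swap_entries j \<theta>)" (is "_ \<subseteq> ?B")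
proof -
  have 1: "keys (pi_op j (f - single \<theta> 1)) \<subseteq> ?B"
  proof (rule keys_pi_op_subset[OF f], rule subsetI)
    fix \<nu> \<nu>' assume "\<nu> \<in> revlex_less (insert j {t<..}) \<theta>" and \<nu>': "\<nu>' \<in> keys (pi_op j (single \<nu> 1))"
    then obtain p where p: "p = j \<or> t < p" "lookup \<nu> p < lookup \<theta> p"
      "\<And>q. p < q \<Longrightarrow> lookup \<nu> q = lookup \<theta> q" by (auto simp: revlex_less_def)
    note k = keys_pi_op_monomial[OF \<nu>']
    show "\<nu>' \<in> ?B"
    proof (cases "p = j")
      case True
      then have "lookup \<nu>' (Suc j) < lookup \<theta> j" using k(1) p desc by fastforce
      moreover have "lookup \<nu>' q = lookup \<theta> q" if "Suc j < q" for q
        using k(2)[of q] p(3)[of q] that True by simp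
      ultimately show ?thesis by (auto simp: revlex_less_def lookup_swap_entries)
    next
      case False
      with p(1) have "t < p" by simp
      then have "lookup \<nu>' q = lookup \<nu> q" if "p \<le> q" for q using k(2)[of q] that \<open>j < t\<close> by simp
      then show ?thesis unfolding revlex_less_def using p \<open>t < p\<close> \<open>j < t\<close>
        by (auto simp: lookup_swap_entries intro!: bexI[of _ p])
    qed
  qed
  have 2: "keys (pi_op j (single \<theta> 1) - single (swap_entries j \<theta>) 1) \<subseteq> ?B"
  proof
    fix \<nu>' assume \<nu>': "\<nu>' \<in> keys (pi_op j (single \<theta> 1) - single (swap_entries j \<theta>) 1)"
    note k = keys_pi_op_monomial_tail[OF desc \<nu>']
    show "\<nu>' \<in> ?B" using k by (auto simp: revlex_less_def lookup_swap_entries)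
  qed
  have "pi_op j f - single (swap_entries j \<theta>) 1
      = pi_op j (f - single \<theta> 1) + (pi_op j (single \<theta> 1) - single (swap_entries j \<theta>) 1)"
    by (simp add: pi_op_diff)
  then have "keys (pi_op j f - single (swap_entries j \<theta>) 1)
      \<subseteq> keys (pi_op j (f - single \<theta> 1)) \<union> keys (pi_op j (single \<theta> 1) - single (swap_entries j \<theta>) 1)"
    using Poly_Mapping.keys_add by metis
  with 1 2 show ?thesis by blast
qed

text \<open>
  The climb is chosen as an insertion sort run backwards: the entries at positions \<open>M, M - 1, \<dots>\<close> are
  moved to their final places one after the other, while the entries on \<open>{1..t}\<close> are still sorted.
  While the entry meant for position \<open>t + 1\<close> travels from the left, it stands at position \<open>j\<close> and
  every error term disagrees last either at \<open>j\<close> or beyond \<open>t + 1\<close>.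
\<close>

lemma climbs_leading_term:
  assumes \<mu>: "is_partition \<mu>"
  shows "t \<le> M \<Longrightarrow> rearranges \<mu> \<theta> \<Longrightarrow> keys \<theta> \<subseteq> {1..M}
    \<Longrightarrow> (\<And>p q. 1 \<le> p \<Longrightarrow> p < q \<Longrightarrow> q \<le> t \<Longrightarrow> lookup \<theta> q \<le> lookup \<theta> p)
    \<Longrightarrow> \<exists>f. climbs \<mu> (single \<mu> 1) \<theta> f \<and> keys (f - single \<theta> 1) \<subseteq> revlex_less {t<..} \<theta>"
proof (induction t arbitrary: \<theta> rule: inc_induct)
  case base
  have "lookup \<theta> (i + 1) \<le> lookup \<theta> i" if "1 \<le> i" for i
  proof (cases "i + 1 \<le> M")
    case False
    then have "i + 1 \<notin> keys \<theta>" using base.prems(2) by auto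
    then show ?thesis by (simp add: in_keys_iff)
  qed (use base.prems(3) that in auto)
  moreover have "0 \<notin> keys \<theta>" using base.prems(2) by auto
  ultimately have "is_partition \<theta>" by (simp add: is_partition_def weak_composition_def in_keys_iff)
  then have "\<theta> = \<mu>" using rearranges_partition_unique[OF \<mu> _ base.prems(1)] by simp
  then show ?case using climbs.start[of \<mu> "single \<mu> 1"] by (intro exI[of _ "single \<mu> 1"]) simp
next
  case (step t)
  let ?T = "Suc t"
  have inner: "\<exists>f. climbs \<mu> (single \<mu> 1) \<theta> f \<and> keys (f - single \<theta> 1) \<subseteq> revlex_less (insert j {?T<..}) \<theta>"
    if "1 \<le> j" "j \<le> ?T" "rearranges \<mu> \<theta>" "keys \<theta> \<subseteq> {1..M}"
      and "\<And>p q. 1 \<le> p \<Longrightarrow> p < q \<Longrightarrow> q \<le> ?T \<Longrightarrow> p \<noteq> j \<Longrightarrow> q \<noteq> j \<Longrightarrow> lookup \<theta> q \<le> lookup \<theta> p"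
      and "\<And>q. j < q \<Longrightarrow> q \<le> ?T \<Longrightarrow> lookup \<theta> q < lookup \<theta> j" for j \<theta>
    using that
  proof (induction j arbitrary: \<theta> rule: nat_induct_at_least)
    case base
    have "lookup \<theta> q \<le> lookup \<theta> p" if "1 \<le> p" "p < q" "q \<le> ?T" for p q
      using base.prems(4)[of p q] base.prems(5)[of q] that by (cases "p = 1") auto
    then obtain f where "climbs \<mu> (single \<mu> 1) \<theta> f" "keys (f - single \<theta> 1) \<subseteq> revlex_less {?T<..} \<theta>"
      using step.IH[OF base.prems(2,3)] by blast
    then show ?case using revlex_less_mono[of "{?T<..}" "insert 1 {?T<..}"] by blast
  next
    case (Suc k)
    show ?case
    proof (cases "lookup \<theta> (Suc k) \<le> lookup \<theta> k")
      case True
      have "lookup \<theta> q \<le> lookup \<theta> p" if pq: "1 \<le> p" "p < q" "q \<le> ?T" for p q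
      proof -
        consider "p = Suc k" | "q = Suc k" "p = k" | "q = Suc k" "p < k" | "p \<noteq> Suc k" "q \<noteq> Suc k"
          using pq by linarith
        then show ?thesis
        proof cases
          case 1
          then show ?thesis using Suc.prems(5)[of q] pq by simp
        next
          case 2
          then show ?thesis using True by simp
        next
          case 3
          then show ?thesis using Suc.prems(4)[of p k] True pq by simp
        next
          case 4
          then show ?thesis using Suc.prems(4)[of p q] pq by simp
        qed
      qed
      then obtain f where "climbs \<mu> (single \<mu> 1) \<theta> f" "keys (f - single \<theta> 1) \<subseteq> revlex_less {?T<..} \<theta>"
        using step.IH[OF Suc.prems(2,3)] by blast
      then show ?thesis using revlex_less_mono[of "{?T<..}" "insert (Suc k) {?T<..}"] by blast
    next
      case False
      then have asc: "lookup \<theta> k < lookup \<theta> (Suc k)" by simp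
      define \<theta>' where "\<theta>' = swap_entries k \<theta>"
      have kT: "k < ?T" using Suc.prems(1) by simp
      have val: "lookup \<theta>' q = (if q = k then lookup \<theta> (Suc k) else if q = Suc k then lookup \<theta> k
          else lookup \<theta> q)" for q
        by (simp add: \<theta>'_def lookup_swap_entries)
      have "keys \<theta>' \<subseteq> {1..M}"
      proof
        fix q assume "q \<in> keys \<theta>'"
        then have nz: "lookup \<theta>' q \<noteq> 0" by (simp add: in_keys_iff)
        show "q \<in> {1..M}"
        proof (cases "q = k \<or> q = Suc k")
          case True
          then show ?thesis using Suc.hyps Suc.prems(1) step.hyps by auto
        next
          case False
          then have "q \<in> keys \<theta>" using nz by (simp add: val in_keys_iff)
          then show ?thesis using Suc.prems(3) by blast
        qed
      qed
      moreover have "rearranges \<mu> \<theta>'" unfolding \<theta>'_def by (rule rearranges_swap[OF Suc.prems(2) Suc.hyps])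
      moreover have "lookup \<theta>' q \<le> lookup \<theta>' p"
        if pq: "1 \<le> p" "p < q" "q \<le> ?T" "p \<noteq> k" "q \<noteq> k" for p q
      proof -
        consider "p = Suc k" | "q = Suc k" "p < k" | "p \<noteq> Suc k" "q \<noteq> Suc k"
          using pq by linarith
        then show ?thesis
        proof cases
          case 1
          then show ?thesis using Suc.prems(4)[of k q] Suc.hyps pq by (simp add: val)
        next
          case 2
          then show ?thesis using Suc.prems(4)[of p k] Suc.hyps pq by (simp add: val)
        next
          case 3
          then show ?thesis using Suc.prems(4)[of p q] pq by (simp add: val)
        qed
      qed
      moreover have "lookup \<theta>' q < lookup \<theta>' k" if "k < q" "q \<le> ?T" for q
        using Suc.prems(5)[of q] asc that by (auto simp: val)
      ultimately obtain f where f: "climbs \<mu> (single \<mu> 1) \<theta>' f"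
        "keys (f - single \<theta>' 1) \<subseteq> revlex_less (insert k {?T<..}) \<theta>'"
        using Suc.IH[of \<theta>'] kT by force
      have "climbs \<mu> (single \<mu> 1) \<theta> (pi_op k f)"
        by (rule climbs_step_back[OF f(1)[unfolded \<theta>'_def] Suc.hyps asc])
      moreover have "lookup \<theta>' (Suc k) < lookup \<theta>' k" using asc by (simp add: val)
      from revlex_less_step[OF this kT f(2)]
      have "keys (pi_op k f - single \<theta> 1) \<subseteq> revlex_less (insert (Suc k) {?T<..}) \<theta>"
        by (simp add: \<theta>'_def)
      ultimately show ?thesis by blast
    qed
  qed
  \<comment> \<open>at the start of the inner argument the entry stands at its final position \<open>j = t + 1\<close>\<close>
  have eq: "{t<..} = insert ?T {?T<..}" by auto
  show ?case unfolding eq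
    by (rule inner) (use step.prems in auto)
qed

lemma key_poly_leading_term:
  assumes "weak_composition \<alpha>"
  shows "keys (key_poly \<alpha> - single \<alpha> 1) \<subseteq> revlex_less {0<..} \<alpha>"
proof -
  let ?\<mu> = "sort_comp \<alpha>"
  have \<mu>: "is_partition ?\<mu>" by (rule is_partition_sort_comp[OF assms])
  obtain M where "\<forall>p\<in>keys \<alpha>. p \<le> M" using finite_nat_set_iff_bounded_le[of "keys \<alpha>"] by auto
  moreover have "0 \<notin> keys \<alpha>" using assms by (simp add: weak_composition_def in_keys_iff)
  ultimately have "keys \<alpha> \<subseteq> {1..M}" by (auto simp: Suc_le_eq intro!: gr0I)
  then obtain f where f: "climbs ?\<mu> (single ?\<mu> 1) \<alpha> f" "keys (f - single \<alpha> 1) \<subseteq> revlex_less {0<..} \<alpha>"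
    using climbs_leading_term[OF \<mu> _ rearranges_sort_comp[OF assms], of 0 M] by auto
  moreover have "f = key_poly \<alpha>"
    by (rule climbs_functional[OF \<mu> f(1) climbs_key_poly[OF assms]])
  ultimately show ?thesis by simp
qed

text \<open>
  If two compositions had the same key polynomial, each would be an exponent of it, and
  each would be strictly smaller than the other in the reverse lexicographic order.
\<close>

theorem key_poly_inject:
  assumes \<alpha>: "weak_composition \<alpha>" and \<beta>: "weak_composition \<beta>" and eq: "key_poly \<alpha> = key_poly \<beta>"
  shows "\<alpha> = \<beta>"
proof (rule ccontr)
  assume ne: "\<alpha> \<noteq> \<beta>"
  have revlex_less: "\<alpha> \<in> revlex_less {0<..} \<beta>"
    if "weak_composition \<alpha>" "weak_composition \<beta>" "key_poly \<alpha> = key_poly \<beta>" "\<alpha> \<noteq> \<beta>" for \<alpha> \<beta>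
  proof -
    have "\<alpha> \<notin> revlex_less {0<..} \<alpha>" by (auto simp: revlex_less_def)
    then have "\<alpha> \<notin> keys (key_poly \<alpha> - single \<alpha> 1)" using key_poly_leading_term[OF that(1)] by blast
    then have "lookup (key_poly \<alpha>) \<alpha> = 1" by (simp add: in_keys_iff lookup_minus)
    then have "\<alpha> \<in> keys (key_poly \<beta> - single \<beta> 1)"
      using that(3,4) by (simp add: in_keys_iff lookup_minus lookup_single)
    then show ?thesis using key_poly_leading_term[OF that(2)] by blast
  qed
  obtain p where p: "lookup \<alpha> p < lookup \<beta> p" "\<And>q. p < q \<Longrightarrow> lookup \<alpha> q = lookup \<beta> q"
    using revlex_less[OF \<alpha> \<beta> eq ne] by (auto simp: revlex_less_def)
  obtain p' where p': "lookup \<beta> p' < lookup \<alpha> p'" "\<And>q. p' < q \<Longrightarrow> lookup \<beta> q = lookup \<alpha> q"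
    using revlex_less[OF \<beta> \<alpha> eq[symmetric] ne[symmetric]] by (auto simp: revlex_less_def)
  show False using p p'(1) p'(2)[of p] p(2)[of p'] by (cases p p' rule: linorder_cases) auto
qed

section \<open>Expanding the product over a strict diagram\<close>

lemma strict_partition_gap:
  assumes \<mu>: "is_strict_partition \<mu>" and p: "1 \<le> p" "p \<le> q" and pos: "0 < lookup \<mu> q"
  shows "lookup \<mu> q + (q - p) \<le> lookup \<mu> p"
  using p(2) pos
proof (induction rule: dec_induct)
  case (step n)
  have part: "is_partition \<mu>" using \<mu> by (simp add: is_strict_partition_def)
  have le: "lookup \<mu> (Suc n) \<le> lookup \<mu> n"
    using partition_decreasing[OF part, of n "Suc n"] step.hyps p(1) by simp
  moreover have "lookup \<mu> (Suc n) \<noteq> lookup \<mu> n"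
  proof
    assume "lookup \<mu> (Suc n) = lookup \<mu> n"
    moreover have "Suc n \<in> keys \<mu>" "n \<in> keys \<mu>" using step.prems le by (simp_all add: in_keys_iff)
    ultimately have "Suc n = n"
      using \<mu> unfolding is_strict_partition_def inj_on_def by blast
    then show False by simp
  qed
  ultimately show ?case using step by simp
qed simp

text \<open>
  The exponent of the monomial obtained from the product of all \<open>x\<^sub>i + x\<^sub>i\<^sub>+\<^sub>j\<close> with \<open>(i, j) \<in> D\<close> by choosing
  \<open>x\<^sub>i\<^sub>+\<^sub>j\<close> for the cells in \<open>S\<close> and \<open>x\<^sub>i\<close> for the others. It is the vector of outdegrees of an
  orientation of the graph with edges \<open>{i, i + j}\<close>.
\<close>

definition chosen :: "(nat \<times> nat) set \<Rightarrow> (nat \<times> nat) set \<Rightarrow> exponents" where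
  "chosen D S = (\<Sum>c\<in>S. single (fst c + snd c) 1) + (\<Sum>c\<in>D - S. single (fst c) 1)"

lemma lookup_chosen:
  assumes "finite D" "S \<subseteq> D"
  shows "lookup (chosen D S) i = card {c \<in> S. fst c + snd c = i} + card {c \<in> D - S. fst c = i}"
proof -
  have fin: "finite S" "finite (D - S)" using assms finite_subset by auto
  have "lookup (\<Sum>c\<in>A. single (g c) 1) i = card {c \<in> A. g c = i}" if "finite A"
    for A :: "(nat \<times> nat) set" and g
    using that by (simp add: lookup_sum lookup_single when_def sum.If_cases Int_def)
  then show ?thesis using fin by (simp only: chosen_def lookup_add)
qed

lemma prod_diagram_expand:
  assumes D: "finite D"
  shows "(\<Prod>(i, j)\<in>D. var i + var (i + j)) = (\<Sum>S\<in>Pow D. single (chosen D S) 1)"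
proof -
  have "(\<Prod>(i, j)\<in>D. var i + var (i + j)) = (\<Prod>c\<in>D. var (fst c + snd c) + var (fst c))"
    by (rule prod.cong) (auto simp: add.commute)
  also have "\<dots> = (\<Sum>S\<in>Pow D. (\<Prod>c\<in>S. var (fst c + snd c)) * (\<Prod>c\<in>D - S. var (fst c)))"
    by (rule prod_add[OF D])
  also have "\<dots> = (\<Sum>S\<in>Pow D. single (chosen D S) 1)"
  proof (rule sum.cong[OF refl])
    fix S assume "S \<in> Pow D"
    then have "finite S" "finite (D - S)" using D finite_subset by auto
    then show "(\<Prod>c\<in>S. var (fst c + snd c)) * (\<Prod>c\<in>D - S. var (fst c)) = single (chosen D S) 1"
      by (simp add: var_def prod_single mult_single chosen_def)
  qed
  finally show ?thesis .
qed

lemma diagram_row: "1 \<le> i \<Longrightarrow> {c \<in> diagram \<mu>. fst c = i} = {i} \<times> {1..lookup \<mu> i}"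
  by (auto simp: diagram_def)

lemma chosen_row:
  assumes S: "S \<subseteq> diagram \<mu>" and low: "\<And>c. c \<in> S \<Longrightarrow> k \<le> fst c" and k: "1 \<le> k"
  shows "lookup (chosen (diagram \<mu>) S) k + card {c \<in> S. fst c = k} = lookup \<mu> k"
proof -
  let ?D = "diagram \<mu>"
  have "fst c + snd c \<noteq> k" if "c \<in> S" for c
    using low[OF that] S that by (auto simp: diagram_def)
  then have empty: "{c \<in> S. fst c + snd c = k} = {}" by auto
  have "lookup (chosen ?D S) k = card {c \<in> ?D - S. fst c = k}"
    unfolding lookup_chosen[OF finite_diagram S] empty by simp
  moreover have "card {c \<in> ?D - S. fst c = k} + card {c \<in> S. fst c = k} = card {c \<in> ?D. fst c = k}"
    using finite_diagram[of \<mu>] S finite_subset[OF S finite_diagram]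
    by (subst card_Un_disjoint[symmetric]) (auto intro!: arg_cong[of _ _ card])
  moreover have "card {c \<in> ?D. fst c = k} = lookup \<mu> k"
    unfolding diagram_row[OF k] by (simp add: card_cartesian_product)
  ultimately show ?thesis by simp
qed

lemma chosen_out_le:
  assumes "1 \<le> i"
  shows "card {c \<in> diagram \<mu> - S. fst c = i} \<le> lookup \<mu> i"
proof -
  have "card {c \<in> diagram \<mu> - S. fst c = i} \<le> card {c \<in> diagram \<mu>. fst c = i}"
    by (rule card_mono) (auto intro: finite_subset[OF _ finite_diagram[of \<mu>]])
  then show ?thesis unfolding diagram_row[OF assms] by (simp add: card_cartesian_product)
qed

text \<open>
  At most \<open>\<mu>\<^sub>i\<close> cells contribute through their own row and at most \<open>i - k\<close> cells from the rows \<open>k, \<dots>, i - 1\<close>.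
  Strictness gives \<open>\<mu>\<^sub>i + (i - k) \<le> \<mu>\<^sub>k\<close> as long as \<open>\<mu>\<^sub>i > 0\<close>; if \<open>\<mu>\<^sub>i = 0\<close>, a single contributing cell in
  row \<open>a \<ge> k\<close> already shows that \<open>\<mu>\<^sub>k \<ge> \<mu>\<^sub>a + (a - k) \<ge> i - k\<close>.
\<close>

lemma chosen_le:
  assumes \<mu>: "is_strict_partition \<mu>" and S: "S \<subseteq> diagram \<mu>"
    and low: "\<And>c. c \<in> S \<Longrightarrow> k \<le> fst c" and k: "1 \<le> k" "k \<le> i"
  shows "lookup (chosen (diagram \<mu>) S) i \<le> lookup \<mu> k"
proof -
  let ?in = "{c \<in> S. fst c + snd c = i}"
  have pos: "1 \<le> snd c" "snd c \<le> lookup \<mu> (fst c)" if "c \<in> S" for c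
    using that S by (auto simp: diagram_def)
  have "card ?in = card (fst ` ?in)"
    by (rule card_image[symmetric]) (auto simp: inj_on_def prod_eq_iff)
  also have "\<dots> \<le> card {k..<i}"
    by (rule card_mono) (use low pos in fastforce)+
  finally have in_le: "card ?in \<le> i - k" by simp
  have eq: "lookup (chosen (diagram \<mu>) S) i = card ?in + card {c \<in> diagram \<mu> - S. fst c = i}"
    by (rule lookup_chosen[OF finite_diagram S])
  have out_le: "card {c \<in> diagram \<mu> - S. fst c = i} \<le> lookup \<mu> i"
    by (rule chosen_out_le) (use k in simp)
  show ?thesis
  proof (cases "0 < lookup \<mu> i")
    case True
    then show ?thesis using strict_partition_gap[OF \<mu> k True] in_le out_le eq by simp
  next
    case False
    show ?thesis
    proof (cases "?in = {}")
      case True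
      with False out_le eq show ?thesis by simp
    next
      case nonempty: False
      then obtain c where c: "c \<in> S" "fst c + snd c = i" by blast
      have "lookup \<mu> (fst c) + (fst c - k) \<le> lookup \<mu> k"
        by (rule strict_partition_gap[OF \<mu> k(1) low[OF c(1)]]) (use pos[OF c(1)] in simp)
      then have "i - k \<le> lookup \<mu> k" using pos[OF c(1)] c(2) low[OF c(1)] by linarith
      then show ?thesis using False out_le eq in_le by simp
    qed
  qed
qed

text \<open>
  The value \<open>\<mu>\<^sub>k + (N - k)\<close> is too small for the positions before \<open>k\<close>, whose rows are intact, and too
  large for those after \<open>k\<close> by \<open>chosen_le\<close>. So it sits at position \<open>k\<close>, which forces all cells
  of row \<open>k\<close> to keep their first variable.
\<close>

lemma chosen_row_step:
  assumes \<mu>: "is_strict_partition \<mu>" and S: "S \<subseteq> diagram \<mu>"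
    and low: "\<And>c. c \<in> S \<Longrightarrow> k \<le> fst c" and k: "1 \<le> k" "k \<le> N" and i: "1 \<le> i" "i \<le> N"
    and eq: "lookup (chosen (diagram \<mu>) S) i + (N - i) = lookup \<mu> k + (N - k)"
    and c: "c \<in> S"
  shows "Suc k \<le> fst c"
proof -
  have part: "is_partition \<mu>" using \<mu> by (simp add: is_strict_partition_def)
  have "i = k"
  proof (cases "i < k")
    case True
    have "lookup (chosen (diagram \<mu>) S) i + card {c \<in> S. fst c = i} = lookup \<mu> i"
      by (rule chosen_row[OF S _ i(1)]) (use low True in fastforce)
    moreover have "{c \<in> S. fst c = i} = {}" using low True by fastforce
    ultimately have "lookup (chosen (diagram \<mu>) S) i = lookup \<mu> i" by simp
    then show ?thesis using eq partition_decreasing[OF part i(1), of k] True k by simp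
  next
    case False
    then have "lookup (chosen (diagram \<mu>) S) i \<le> lookup \<mu> k"
      by (intro chosen_le[OF \<mu> S low k(1)]) auto
    then show ?thesis using eq False i by simp
  qed
  then have "card {c \<in> S. fst c = k} = 0" using chosen_row[OF S low k(1)] eq by simp
  then have "{c \<in> S. fst c = k} = {}" using finite_subset[OF S finite_diagram] by simp
  then show ?thesis using low[OF c] c by fastforce
qed

lemma chosen_rows_empty:
  assumes \<mu>: "is_strict_partition \<mu>" and S: "S \<subseteq> diagram \<mu>" and k: "1 \<le> k"
    and low: "\<And>c. c \<in> S \<Longrightarrow> k \<le> fst c"
    and T: "k \<le> T" "T \<le> Suc N"
    and eq: "\<And>p. k \<le> p \<Longrightarrow> p < T
      \<Longrightarrow> \<exists>i\<in>{1..N}. lookup (chosen (diagram \<mu>) S) i + (N - i) = lookup \<mu> p + (N - p)"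
  shows "\<forall>c\<in>S. T \<le> fst c"
  using T eq
proof (induction T rule: dec_induct)
  case base
  then show ?case using low by blast
next
  case (step m)
  have "\<forall>c\<in>S. m \<le> fst c" by (rule step.IH) (use step.prems in auto)
  then have lowm: "\<And>c. c \<in> S \<Longrightarrow> m \<le> fst c" by blast
  obtain i where i: "i \<in> {1..N}"
    and e: "lookup (chosen (diagram \<mu>) S) i + (N - i) = lookup \<mu> m + (N - m)"
    using step.prems(2)[of m] step.hyps by auto
  show ?case
  proof
    fix c assume "c \<in> S"
    then show "Suc m \<le> fst c"
      by (intro chosen_row_step[OF \<mu> S lowm _ _ _ _ e]) (use k step i in auto)
  qed
qed

lemma chosen_unique_top:
  assumes \<mu>: "is_strict_partition \<mu>" and S: "S \<subseteq> diagram \<mu>" and k: "1 \<le> k" "k \<le> Suc N"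
    and N: "\<And>c. c \<in> diagram \<mu> \<Longrightarrow> fst c \<le> N"
    and low: "\<And>c. c \<in> S \<Longrightarrow> k \<le> fst c"
    and eq: "\<And>p. k \<le> p \<Longrightarrow> p \<le> N \<Longrightarrow> \<exists>i\<in>{1..N}. lookup (chosen (diagram \<mu>) S) i + (N - i) = lookup \<mu> p + (N - p)"
  shows "S = {}"
proof -
  have "\<forall>c\<in>S. Suc N \<le> fst c" by (rule chosen_rows_empty[OF \<mu> S k(1) low k(2) order_refl eq]) auto
  then show ?thesis using N S by fastforce
qed

text \<open>
  A cell \<open>(k, j)\<close> of \<open>S\<close> contributes to position \<open>k + j\<close>; outside row \<open>k\<close> nothing else changes when
  it is taken out of \<open>S\<close>.
\<close>

lemma chosen_insert_row:
  assumes S: "S \<subseteq> diagram \<mu>" and j: "(k, j) \<in> S" and i: "i \<noteq> k"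
  shows "lookup (chosen (diagram \<mu>) S) i
    = lookup (chosen (diagram \<mu>) (S - {(k, j)})) i + (if i = k + j then 1 else 0)"
proof -
  let ?S' = "S - {(k, j)}"
  have S': "?S' \<subseteq> diagram \<mu>" using S by auto
  have fin: "finite S" by (rule finite_subset[OF S finite_diagram])
  have "{c \<in> diagram \<mu> - ?S'. fst c = i} = {c \<in> diagram \<mu> - S. fst c = i}" using i by auto
  moreover have "card {c \<in> S. fst c + snd c = i}
      = card {c \<in> ?S'. fst c + snd c = i} + (if i = k + j then 1 else 0)"
  proof (cases "i = k + j")
    case True
    then have "{c \<in> S. fst c + snd c = i} = insert (k, j) {c \<in> ?S'. fst c + snd c = i}"
      using j by auto
    then show ?thesis using fin True by simp
  next
    case False
    then have "{c \<in> S. fst c + snd c = i} = {c \<in> ?S'. fst c + snd c = i}" by auto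
    then show ?thesis using False by simp
  qed
  ultimately show ?thesis
    by (simp add: lookup_chosen[OF finite_diagram S] lookup_chosen[OF finite_diagram S'])
qed

text \<open>
  The rows before \<open>k\<close> are intact as before. The gap between \<open>\<mu>\<^sub>k\<close> and \<open>\<mu>\<^sub>k\<^sub>+\<^sub>1\<close> excludes that position
  \<open>k + 1\<close> carries the value expected at \<open>k\<close>, so exactly one cell of row \<open>k\<close> is chosen the other way.
  The value expected at \<open>k + 1\<close> exceeds what the remaining rows can produce by one, so that cell
  points to \<open>k + 1\<close>; after its removal all later rows are intact.
\<close>

lemma chosen_unique_gap:
  assumes \<mu>: "is_strict_partition \<mu>" and S: "S \<subseteq> diagram \<mu>" and k: "1 \<le> k" "Suc k \<le> N"
    and gap: "lookup \<mu> (Suc k) + 2 \<le> lookup \<mu> k"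
    and N: "\<And>c. c \<in> diagram \<mu> \<Longrightarrow> fst c \<le> N"
    and eq: "\<And>p. 1 \<le> p \<Longrightarrow> p \<le> N \<Longrightarrow> \<exists>i\<in>{1..N}. lookup (chosen (diagram \<mu>) S) i + (N - i)
      = (if p = k then lookup \<mu> k - 1 else if p = Suc k then lookup \<mu> (Suc k) + 1 else lookup \<mu> p) + (N - p)"
  shows "S = {(k, 1)}"
proof -
  have part: "is_partition \<mu>" using \<mu> by (simp add: is_strict_partition_def)
  note decr = partition_decreasing[OF part]
  let ?b = "\<lambda>S. lookup (chosen (diagram \<mu>) S)"
  have fin: "finite S" by (rule finite_subset[OF S finite_diagram])
  have pre: "\<exists>i\<in>{1..N}. ?b S i + (N - i) = lookup \<mu> p + (N - p)" if "1 \<le> p" "p < k" for p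
  proof -
    have "p \<noteq> k" "p \<noteq> Suc k" "p \<le> N" using that k by auto
    then show ?thesis using eq[of p] that(1) by simp
  qed
  have "\<forall>c\<in>S. k \<le> fst c"
    by (rule chosen_rows_empty[OF \<mu> S order_refl _ k(1) _ pre]) (use S k in \<open>auto simp: diagram_def\<close>)
  then have low: "k \<le> fst c" if "c \<in> S" for c using that by auto
  have before: "?b S i = lookup \<mu> i" if i: "1 \<le> i" "i < k" for i
  proof -
    have "?b S i + card {c \<in> S. fst c = i} = lookup \<mu> i"
      by (rule chosen_row[OF S _ i(1)]) (use low i in fastforce)
    moreover have "{c \<in> S. fst c = i} = {}" using low i by fastforce
    ultimately show ?thesis by simp
  qed
  \<comment> \<open>the position that carries the value expected at \<open>k\<close>\<close>
  obtain i where i: "1 \<le> i" "i \<le> N" "?b S i + (N - i) = lookup \<mu> k - 1 + (N - k)"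
    using eq[of k] k by auto
  have "i = k"
  proof (rule ccontr)
    assume "i \<noteq> k"
    then consider "i < k" | "i = Suc k" | "Suc (Suc k) \<le> i" by linarith
    then show False
    proof cases
      case 1
      then show False using before[of i] decr[of i k] i k gap by simp
    next
      case 2
      have sub: "{c \<in> S. fst c + snd c = i} \<subseteq> {(k, 1)}"
      proof
        fix c assume c: "c \<in> {c \<in> S. fst c + snd c = i}"
        then have "k \<le> fst c" "1 \<le> snd c" using low S by (auto simp: diagram_def)
        then show "c \<in> {(k, 1)}" using c 2 by (cases c) auto
      qed
      have "card {c \<in> S. fst c + snd c = i} \<le> 1" using card_mono[OF _ sub] by simp
      moreover have "card {c \<in> diagram \<mu> - S. fst c = i} \<le> lookup \<mu> i" by (rule chosen_out_le[OF i(1)])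
      ultimately have "?b S i \<le> lookup \<mu> (Suc k) + 1"
        using 2 lookup_chosen[OF finite_diagram S, of i] by simp
      then show False using i 2 gap k by simp
    next
      case 3
      then have "?b S i \<le> lookup \<mu> k" by (intro chosen_le[OF \<mu> S low k(1)]) auto
      then show False using i 3 gap by simp
    qed
  qed
  then have bk: "?b S k = lookup \<mu> k - 1" using i by simp
  then have "card {c \<in> S. fst c = k} = 1" using chosen_row[OF S low k(1)] gap by simp
  then obtain c0 where c0: "{c \<in> S. fst c = k} = {c0}" by (rule card_1_singletonE)
  then have "c0 \<in> {c \<in> S. fst c = k}" by simp
  then obtain j where j: "(k, j) \<in> S" "c0 = (k, j)" by (cases c0) auto
  define S' where "S' = S - {(k, j)}"
  have S': "S' \<subseteq> diagram \<mu>" using S by (auto simp: S'_def)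
  have low': "Suc k \<le> fst c" if "c \<in> S'" for c
  proof -
    have "fst c \<noteq> k" using that c0 j(2) unfolding S'_def by blast
    then show ?thesis using low[of c] that by (auto simp: S'_def)
  qed
  have bS: "?b S i = ?b S' i + (if i = k + j then 1 else 0)" if "i \<noteq> k" for i
    unfolding S'_def by (rule chosen_insert_row[OF S j(1) that])
  \<comment> \<open>the position that carries the value expected at \<open>k + 1\<close>\<close>
  obtain i where i: "1 \<le> i" "i \<le> N" "?b S i + (N - i) = lookup \<mu> (Suc k) + 1 + (N - Suc k)"
    using eq[of "Suc k"] k by auto
  have ge: "Suc k \<le> i"
  proof (rule ccontr)
    assume "\<not> Suc k \<le> i"
    then consider "i < k" | "i = k" by linarith
    then show False
    proof cases
      case 1
      then show False using before[of i] decr[of i k] i k gap by simp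
    next
      case 2
      then show False using bk i gap k by simp
    qed
  qed
  have b': "?b S' i \<le> lookup \<mu> (Suc k)"
    by (rule chosen_le[OF \<mu> S' low' _ ge]) simp_all
  have bSi: "?b S i \<le> ?b S' i + 1" using bS[of i] ge by simp
  have ik: "i = Suc k" using bSi b' i ge k by linarith
  have "?b S (Suc k) = lookup \<mu> (Suc k) + 1" using i(3) ik by simp
  then have j1: "j = 1" and b'k: "?b S' (Suc k) = lookup \<mu> (Suc k)"
    using bS[of "Suc k"] b' unfolding ik by (simp_all split: if_splits)
  have "card {c \<in> S'. fst c = Suc k} = 0" using chosen_row[OF S' low'] b'k by simp
  then have "{c \<in> S'. fst c = Suc k} = {}" using finite_subset[OF S' finite_diagram] by simp
  then have low'': "Suc (Suc k) \<le> fst c" if "c \<in> S'" for c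
    using low'[OF that] that by fastforce
  have "S' = {}"
  proof (rule chosen_unique_top[OF \<mu> S' _ _ N low''])
    fix p assume p: "Suc (Suc k) \<le> p" "p \<le> N"
    then obtain i where i: "i \<in> {1..N}" "?b S i + (N - i) = lookup \<mu> p + (N - p)"
      using eq[of p] by auto
    have "lookup \<mu> p \<le> lookup \<mu> (Suc k)" using decr[of "Suc k" p] p by simp
    then have "i \<noteq> k" "i \<noteq> Suc k" using bk bS[of "Suc k"] b'k j1 i p gap k by auto
    then have "?b S i = ?b S' i" using bS[of i] j1 by simp
    then show "\<exists>i\<in>{1..N}. ?b S' i + (N - i) = lookup \<mu> p + (N - p)" using i by metis
  qed (use k in auto)
  then show ?thesis using j(1) j1 unfolding S'_def by blast
qed

section \<open>Coefficients of alternating sums\<close>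

lemma of_int_sign_mult: "of_int (sign w) * f = (if sign w = 1 then f else - f)" for f :: mpoly
  by (rule sign_cases[of w]) simp_all

lemma lookup_alternate_monomial:
  "lookup (alternate N (single \<sigma> 1)) \<tau> = (\<Sum>w | w permutes {1..N}. if act w \<sigma> = \<tau> then sign w else 0)"
  unfolding alternate_def lookup_sum
proof (rule sum.cong[OF refl])
  fix w
  show "lookup (of_int (sign w) * permute_vars w (single \<sigma> 1)) \<tau> = (if act w \<sigma> = \<tau> then sign w else 0)"
    by (rule sign_cases[of w]) (simp_all add: of_int_sign_mult lookup_single when_def)
qed

lemma staircase_plus_partition:
  assumes "is_partition \<rho>"
  shows "is_partition (staircase N + \<rho>)" "inj_on (lookup (staircase N + \<rho>)) {1..N}"
proof -
  show "is_partition (staircase N + \<rho>)"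
    using assms staircase_partition[of N]
    by (auto simp: is_partition_def weak_composition_def lookup_add intro!: add_mono)
  show "inj_on (lookup (staircase N + \<rho>)) {1..N}"
  proof (rule linorder_inj_onI)
    fix p q assume "p < q" "p \<in> {1..N}" "q \<in> {1..N}"
    then show "lookup (staircase N + \<rho>) p \<noteq> lookup (staircase N + \<rho>) q"
      using partition_decreasing[OF assms, of p q] by (auto simp: lookup_add lookup_staircase)
  qed auto
qed

lemma lookup_alternate_same:
  assumes inj: "inj_on (lookup \<tau>) {1..N}"
  shows "lookup (alternate N (single \<tau> 1)) \<tau> = 1"
proof -
  have id: "w = id" if w: "w permutes {1..N}" "act w \<tau> = \<tau>" for w
  proof -
    have iw: "inv w permutes {1..N}" by (rule permutes_inv[OF w(1)])
    have "inv w i = i" for i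
    proof (cases "i \<in> {1..N}")
      case True
      have "lookup \<tau> (inv w i) = lookup \<tau> i"
        using lookup_act[OF permutes_bij[OF w(1)], of \<tau> i] w(2) by simp
      then show ?thesis using inj True permutes_in_image[OF iw] by (simp add: inj_on_eq_iff)
    qed (rule permutes_not_in[OF iw])
    then have "inv w = id" by auto
    then show ?thesis using inv_inv_eq[OF permutes_bij[OF w(1)]] by (metis inv_id)
  qed
  have "lookup (alternate N (single \<tau> 1)) \<tau>
      = (\<Sum>w | w permutes {1..N}. if w = id then 1 else 0)"
    unfolding lookup_alternate_monomial
    by (rule sum.cong) (use id in \<open>auto simp: act_id[unfolded id_def] id_def[symmetric] act_id\<close>)
  also have "\<dots> = 1" by (simp add: finite_permutations permutes_id)
  finally show ?thesis .
qed

lemma lookup_alternate_nonzero: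
  assumes "lookup (alternate N (single \<sigma> 1)) \<tau> \<noteq> 0"
  obtains w where "w permutes {1..N}" "act w \<sigma> = \<tau>"
proof -
  have "\<exists>w. w permutes {1..N} \<and> act w \<sigma> = \<tau>"
  proof (rule ccontr)
    assume "\<not> ?thesis"
    then have "lookup (alternate N (single \<sigma> 1)) \<tau> = 0"
      unfolding lookup_alternate_monomial by (intro sum.neutral) auto
    with assms show False by simp
  qed
  then show ?thesis using that by blast
qed

text \<open>
  In the alternating sum of \<open>x\<^sup>\<delta>\<close> times the product, the coefficient of \<open>x\<^sup>\<delta>\<^sup>+\<^sup>\<rho>\<close> is contributed by the
  choices whose exponent is a permutation of \<open>\<delta> + \<rho>\<close>. If there is only one, the coefficient is
  nonzero, so \<open>\<delta> + \<nu>\<close> has to be a permutation of \<open>\<delta> + \<rho>\<close>, and both are sorted.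
\<close>

lemma alternate_diagram_coefficient:
  assumes \<rho>: "is_partition \<rho>" "is_partition \<nu>" and D: "finite D" and S0: "S0 \<subseteq> D" "chosen D S0 = \<rho>"
    and unique: "\<And>S. S \<subseteq> D
      \<Longrightarrow> (\<And>p. 1 \<le> p \<Longrightarrow> p \<le> N \<Longrightarrow> \<exists>i\<in>{1..N}. lookup (chosen D S) i + (N - i) = lookup \<rho> p + (N - p))
      \<Longrightarrow> S = S0"
    and eq: "alternate N (single (staircase N) 1 * single \<nu> 1)
      = alternate N (single (staircase N) 1 * (\<Prod>(i, j)\<in>D. var i + var (i + j)))"
  shows "\<nu> = \<rho>"
proof -
  let ?\<tau> = "staircase N + \<rho>"
  let ?a = "\<lambda>S. lookup (alternate N (single (staircase N + chosen D S) 1)) ?\<tau>"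
  have "?a S = 0" if S: "S \<in> Pow D - {S0}" for S
  proof (rule ccontr)
    assume "?a S \<noteq> 0"
    then obtain w where w: "w permutes {1..N}" "act w (staircase N + chosen D S) = ?\<tau>"
      by (rule lookup_alternate_nonzero)
    have "S = S0"
    proof (rule unique)
      fix p assume p: "1 \<le> p" "p \<le> N"
      let ?i = "inv w p"
      have i: "?i \<in> {1..N}" using p permutes_in_image[OF permutes_inv[OF w(1)]] by auto
      have "lookup (staircase N + chosen D S) ?i = lookup ?\<tau> p"
        using lookup_act[OF permutes_bij[OF w(1)], of "staircase N + chosen D S" p] w(2) by simp
      then show "\<exists>i\<in>{1..N}. lookup (chosen D S) i + (N - i) = lookup \<rho> p + (N - p)"
        using i p by (intro bexI[of _ ?i]) (auto simp: lookup_add lookup_staircase add.commute)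
    qed (use S in auto)
    with S show False by simp
  qed
  then have "(\<Sum>S\<in>Pow D. ?a S) = ?a S0"
    using D S0(1) by (subst sum.remove[of _ S0]) (auto intro!: sum.neutral)
  also have "\<dots> = 1"
    unfolding S0(2) by (rule lookup_alternate_same[OF staircase_plus_partition(2)[OF \<rho>(1)]])
  finally have "lookup (alternate N (single (staircase N) 1 * (\<Prod>(i, j)\<in>D. var i + var (i + j)))) ?\<tau> = 1"
    by (simp add: prod_diagram_expand[OF D] sum_distrib_left alternate_sum lookup_sum mult_single)
  then have "lookup (alternate N (single (staircase N + \<nu>) 1)) ?\<tau> \<noteq> 0"
    unfolding eq[symmetric] by (simp add: mult_single)
  then obtain w where w: "w permutes {1..N}" "act w (staircase N + \<nu>) = ?\<tau>"
    by (rule lookup_alternate_nonzero)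
  have "rearranges (staircase N + \<nu>) ?\<tau>"
    unfolding rearranges_def using w(2)[symmetric] permutes_in_S_inf[OF w(1)] by (rule bexI)
  from rearranges_partition_unique[OF _ _ this] have "staircase N + \<nu> = ?\<tau>"
    using staircase_plus_partition(1) \<rho> by blast
  then show ?thesis by simp
qed

text \<open>
  A gap of at least two after row \<open>k\<close> yields two different partitions \<open>\<rho>\<close> to which
  \<open>alternate_diagram_coefficient\<close> applies, namely \<open>\<mu>\<close> itself and \<open>\<mu>\<close> with a unit moved from row \<open>k\<close> to row
  \<open>k + 1\<close>; both would have to be equal to \<open>\<nu>\<close>.
\<close>

lemma alternate_diagram_forces_staircase:
  assumes \<mu>: "is_strict_partition \<mu>" and \<nu>: "is_partition \<nu>" and N: "keys \<mu> \<subseteq> {..<N}"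
    and eq: "alternate N (single (staircase N) 1 * single \<nu> 1)
      = alternate N (single (staircase N) 1 * (\<Prod>(i, j)\<in>diagram \<mu>. var i + var (i + j)))"
  shows "\<nu> = \<mu>" and "1 \<le> k \<Longrightarrow> lookup \<mu> k \<le> lookup \<mu> (Suc k) + 1"
proof -
  let ?D = "diagram \<mu>"
  have part: "is_partition \<mu>" using \<mu> by (simp add: is_strict_partition_def)
  have rows: "fst c \<le> N" if "c \<in> ?D" for c
  proof -
    have "fst c \<in> keys \<mu>" using that by (auto simp: diagram_def in_keys_iff)
    then show ?thesis using N by auto
  qed
  have b0: "lookup (chosen ?D {}) i = lookup \<mu> i" for i
  proof (cases "i = 0")
    case True
    have empty: "{c \<in> {}. fst c + snd c = i} = {}" "{c \<in> ?D - {}. fst c = i} = {}"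
      using True by (auto simp: diagram_def)
    show ?thesis
      unfolding lookup_chosen[OF finite_diagram empty_subsetI] empty
      using part True by (simp add: is_partition_def weak_composition_def)
  next
    case False
    then show ?thesis using chosen_row[of "{}" \<mu> i] by simp
  qed
  have c0: "chosen ?D {} = \<mu>" by (rule poly_mapping_eqI) (rule b0)
  show nu: "\<nu> = \<mu>"
  proof (rule alternate_diagram_coefficient[OF part \<nu> finite_diagram _ c0 _ eq])
    fix S assume S: "S \<subseteq> ?D" and all: "\<And>p. 1 \<le> p \<Longrightarrow> p \<le> N \<Longrightarrow>
      \<exists>i\<in>{1..N}. lookup (chosen ?D S) i + (N - i) = lookup \<mu> p + (N - p)"
    show "S = {}"
      by (rule chosen_unique_top[OF \<mu> S order_refl _ rows _ all]) (use S in \<open>auto simp: diagram_def\<close>)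
  qed simp
  assume k: "1 \<le> k"
  show "lookup \<mu> k \<le> lookup \<mu> (Suc k) + 1"
  proof (rule ccontr)
    assume "\<not> ?thesis"
    then have gap: "lookup \<mu> (Suc k) + 2 \<le> lookup \<mu> k" by simp
    then have "k \<in> keys \<mu>" by (simp add: in_keys_iff)
    then have kN: "Suc k \<le> N" using N by auto
    define \<rho> where "\<rho> = chosen ?D {(k, 1)}"
    have S0: "{(k, 1)} \<subseteq> ?D" using k gap by (auto simp: diagram_def)
    have val: "lookup \<rho> p = (if p = k then lookup \<mu> k - 1 else if p = Suc k then lookup \<mu> (Suc k) + 1
        else lookup \<mu> p)" for p
    proof (cases "p = k")
      case True
      have "lookup \<rho> k + card {c \<in> {(k, 1::nat)}. fst c = k} = lookup \<mu> k"
        unfolding \<rho>_def by (rule chosen_row[OF S0 _ k]) auto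
      moreover have "{c \<in> {(k, 1::nat)}. fst c = k} = {(k, 1)}" by auto
      ultimately show ?thesis using True by simp
    next
      case False
      then show ?thesis
        using chosen_insert_row[OF S0 _ False, of 1] by (simp add: \<rho>_def b0)
    qed
    have "is_partition \<rho>"
      unfolding is_partition_def weak_composition_def
    proof (intro conjI allI impI)
      show "lookup \<rho> 0 = 0" using part k by (simp add: val is_partition_def weak_composition_def)
      fix i :: nat assume i: "1 \<le> i"
      show "lookup \<rho> (i + 1) \<le> lookup \<rho> i"
        using partition_decreasing[OF part i, of "Suc i"] partition_decreasing[OF part k, of "Suc k"] gap
        by (auto simp: val)
    qed
    then have "\<nu> = \<rho>"
    proof (rule alternate_diagram_coefficient[OF _ \<nu> finite_diagram S0 \<rho>_def[symmetric] _ eq])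
      fix S assume S: "S \<subseteq> ?D" and all: "\<And>p. 1 \<le> p \<Longrightarrow> p \<le> N \<Longrightarrow>
        \<exists>i\<in>{1..N}. lookup (chosen ?D S) i + (N - i) = lookup \<rho> p + (N - p)"
      show "S = {(k, 1)}"
        by (rule chosen_unique_gap[OF \<mu> S k kN gap rows all[unfolded val]])
    qed
    then have "lookup \<mu> k = lookup \<mu> k - 1" using nu val[of k] by simp
    with gap show False by simp
  qed
qed

section \<open>Skew-symmetric partitions with a staircase half\<close>

lemma half_less_strict: "is_partition \<rho> \<Longrightarrow> is_strict_partition (half_less \<rho>)"
  using theI'[OF half_less_unique[of \<rho>]] by (simp add: half_less_def)

lemma lookup_half_less:
  assumes \<rho>: "is_partition \<rho>"
  shows "lookup (half_less \<rho>) i = lookup \<rho> i - i"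
proof -
  define \<mu> where "\<mu> = (\<Sum>p\<in>keys \<rho>. single p (lookup \<rho> p - p))"
  have l: "lookup \<mu> p = lookup \<rho> p - p" for p
    by (auto simp: \<mu>_def lookup_sum lookup_single when_def in_keys_iff)
  have zero: "lookup \<mu> 0 = 0" using \<rho> by (simp add: l is_partition_def weak_composition_def)
  have decr: "lookup \<mu> q < lookup \<mu> p \<or> lookup \<mu> q = 0" if "1 \<le> p" "p < q" for p q
    using partition_decreasing[OF \<rho>, of p q] that unfolding l by auto
  have part: "is_partition \<mu>"
    unfolding is_partition_def weak_composition_def
  proof (intro conjI allI impI zero)
    fix i :: nat assume "1 \<le> i"
    then show "lookup \<mu> (i + 1) \<le> lookup \<mu> i" using decr[of i "i + 1"] by auto
  qed
  have "inj_on (lookup \<mu>) (keys \<mu>)"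
  proof (rule linorder_inj_onI)
    fix p q assume pq: "p < q" "p \<in> keys \<mu>" "q \<in> keys \<mu>"
    then have "1 \<le> p" using zero by (cases p) (auto simp: in_keys_iff)
    then show "lookup \<mu> p \<noteq> lookup \<mu> q" using decr[of p q] pq by (auto simp: in_keys_iff)
  qed auto
  moreover have "lookup \<mu> ` keys \<mu> = {lookup \<rho> i - i | i. 1 \<le> i} \<inter> {1..}"
  proof (intro equalityI subsetI)
    fix v assume "v \<in> lookup \<mu> ` keys \<mu>"
    then obtain p where p: "v = lookup \<mu> p" "lookup \<mu> p \<noteq> 0" by (auto simp: in_keys_iff)
    then have "1 \<le> p" using zero by (cases p) auto
    with p show "v \<in> {lookup \<rho> i - i | i. 1 \<le> i} \<inter> {1..}" by (auto simp: l)
  next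
    fix v assume "v \<in> {lookup \<rho> i - i | i. 1 \<le> i} \<inter> {1..}"
    then obtain i where "v = lookup \<mu> i" "lookup \<mu> i \<noteq> 0" by (auto simp: l)
    then show "v \<in> lookup \<mu> ` keys \<mu>" by (auto simp: in_keys_iff)
  qed
  ultimately have "half_less \<rho> = \<mu>"
    unfolding half_less_def using part
    by (intro the1_equality[OF half_less_unique[OF \<rho>]]) (simp add: is_strict_partition_def)
  then show ?thesis by (simp add: l)
qed

lemma block_partition: "is_partition (block {1..N})"
  by (simp add: is_partition_def weak_composition_def lookup_block)

lemma strict_partition_staircase:
  assumes \<mu>: "is_strict_partition \<mu>" and step: "\<And>k. 1 \<le> k \<Longrightarrow> lookup \<mu> k \<le> lookup \<mu> (Suc k) + 1"
    and k: "1 \<le> k"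
  shows "lookup \<mu> k = Suc (lookup \<mu> 1) - k"
  using k
proof (induction k rule: nat_induct_at_least)
  case (Suc k)
  have part: "is_partition \<mu>" using \<mu> by (simp add: is_strict_partition_def)
  have le: "lookup \<mu> (Suc k) \<le> lookup \<mu> k" using partition_decreasing[OF part Suc.hyps, of "Suc k"] by simp
  show ?case
  proof (cases "lookup \<mu> (Suc k) = 0")
    case True
    then show ?thesis using step[OF Suc.hyps] Suc.IH by simp
  next
    case False
    then show ?thesis
      using strict_partition_gap[OF \<mu> Suc.hyps, of "Suc k"] step[OF Suc.hyps] Suc.IH by simp
  qed
qed simp

lemma lookup_partition_transpose:
  "1 \<le> j \<Longrightarrow> lookup (partition_transpose \<rho>) j = card {i. 1 \<le> i \<and> j \<le> lookup \<rho> i}"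
  by (simp add: partition_transpose.rep_eq)

text \<open>
  The half determines the first \<open>n\<close> rows, and self-conjugacy leaves for row \<open>n + 1\<close> only the lengths
  \<open>n\<close> and \<open>n + 1\<close>. Length \<open>n\<close> is the excluded configuration in which the diagonal cell
  \<open>(n + 1, n + 1)\<close> is addable next to the removable corner \<open>(n + 1, n)\<close>.
\<close>

lemma skew_symmetric_square:
  assumes \<rho>: "skew_symmetric_partition \<rho>" and n: "1 \<le> n"
    and half: "\<And>k. 1 \<le> k \<Longrightarrow> lookup \<rho> k - k = Suc n - k"
  shows "\<rho> = block {1..Suc n}"
proof -
  have part: "is_partition \<rho>" and tr: "partition_transpose \<rho> = \<rho>"
    and corners: "addable_corner \<rho> (Suc n, Suc n) \<Longrightarrow> \<not> removable_corner \<rho> (Suc n, n)"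
    using \<rho> unfolding skew_symmetric_partition_def by (auto dest: spec[of _ "Suc n"])
  note decr = partition_decreasing[OF part]
  have rho0: "lookup \<rho> 0 = 0" using part by (simp add: is_partition_def weak_composition_def)
  have col: "card {i. 1 \<le> i \<and> j \<le> lookup \<rho> i} = lookup \<rho> j" if "1 \<le> j" for j
    using lookup_partition_transpose[OF that, of \<rho>] tr by simp
  have fin: "finite {i. 1 \<le> i \<and> j \<le> lookup \<rho> i}" if "1 \<le> j" for j
    by (rule finite_subset[of _ "keys \<rho>"]) (use that in \<open>auto simp: in_keys_iff\<close>)
  have top: "lookup \<rho> k = Suc n" if "1 \<le> k" "k \<le> n" for k
    using half[OF that(1)] that by simp
  have last_le: "lookup \<rho> (Suc n) \<le> Suc n" using half[of "Suc n"] by simp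
  have last_ge: "n \<le> lookup \<rho> (Suc n)"
  proof (rule ccontr)
    assume less: "\<not> ?thesis"
    have "{i. 1 \<le> i \<and> n \<le> lookup \<rho> i} \<subseteq> {1..n}"
    proof
      fix i assume i: "i \<in> {i. 1 \<le> i \<and> n \<le> lookup \<rho> i}"
      then show "i \<in> {1..n}" using less decr[of "Suc n" i] by (cases "i \<le> n") auto
    qed
    then have "card {i. 1 \<le> i \<and> n \<le> lookup \<rho> i} \<le> n" using card_mono[of "{1..n}"] by fastforce
    then show False using col[OF n] top[OF n order_refl] by simp
  qed
  have beyond: "lookup \<rho> (Suc (Suc n)) = 0"
  proof (rule ccontr)
    assume pos: "\<not> ?thesis"
    have "{1..Suc (Suc n)} \<subseteq> {i. 1 \<le> i \<and> 1 \<le> lookup \<rho> i}"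
    proof
      fix i assume "i \<in> {1..Suc (Suc n)}"
      then show "i \<in> {i. 1 \<le> i \<and> 1 \<le> lookup \<rho> i}" using pos decr[of i "Suc (Suc n)"] by auto
    qed
    from card_mono[OF fin this] show False using col[of 1] top[of 1] n by simp
  qed
  have "lookup \<rho> (Suc n) = Suc n"
  proof (rule ccontr)
    assume "\<not> ?thesis"
    with last_le last_ge have last: "lookup \<rho> (Suc n) = n" by simp
    let ?e = "single (Suc n) (1::nat)"
    have "is_partition (\<rho> + ?e)"
      unfolding is_partition_def weak_composition_def
    proof (intro conjI allI impI)
      fix i :: nat assume i: "1 \<le> i"
      show "lookup (\<rho> + ?e) (i + 1) \<le> lookup (\<rho> + ?e) i"
        using decr[OF i, of "Suc i"] top[OF i] last by (auto simp: lookup_add lookup_single when_def)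
    qed (simp add: lookup_add lookup_single rho0)
    moreover have "diagram (\<rho> + ?e) = insert (Suc n, Suc n) (diagram \<rho>)"
      using last by (auto simp: diagram_def lookup_add lookup_single when_def split: if_splits)
    ultimately have "addable_corner \<rho> (Suc n, Suc n)"
      unfolding addable_corner_def using last by (auto simp: diagram_def)
    moreover have "removable_corner \<rho> (Suc n, n)"
    proof -
      have "is_partition (\<rho> - ?e)"
        unfolding is_partition_def weak_composition_def
      proof (intro conjI allI impI)
        fix i :: nat assume i: "1 \<le> i"
        show "lookup (\<rho> - ?e) (i + 1) \<le> lookup (\<rho> - ?e) i"
          using decr[OF i, of "Suc i"] beyond by (auto simp: lookup_minus lookup_single when_def)
      qed (simp add: lookup_minus lookup_single rho0)
      moreover have "diagram (\<rho> - ?e) = diagram \<rho> - {(Suc n, n)}"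
        using last by (auto simp: diagram_def lookup_minus lookup_single when_def split: if_splits)
      ultimately show ?thesis
        unfolding removable_corner_def using last n by (auto simp: diagram_def)
    qed
    ultimately show False using corners by blast
  qed
  show ?thesis
  proof (rule poly_mapping_eqI)
    fix p
    consider "p = 0" | "1 \<le> p" "p \<le> n" | "p = Suc n" | "Suc (Suc n) \<le> p" by linarith
    then show "lookup \<rho> p = lookup (block {1..Suc n}) p"
    proof cases
      case 4
      then show ?thesis using decr[of "Suc (Suc n)" p] beyond by (simp add: lookup_block)
    qed (use rho0 top \<open>lookup \<rho> (Suc n) = Suc n\<close> in \<open>auto simp: lookup_block\<close>)
  qed
qed

lemma half_less_block: "half_less (block {1..N}) = staircase N"
  by (rule poly_mapping_eqI, unfold lookup_half_less[OF block_partition])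
    (simp add: lookup_block lookup_staircase)

lemma prod_diagram_staircase:
  "(\<Prod>(i, j)\<in>diagram (staircase N). var i + var (i + j)) = (\<Prod>i\<in>{1..N}. \<Prod>j\<in>{Suc i..N}. var i + var j)"
proof -
  have "diagram (staircase N) = (SIGMA i:{1..N}. {1..N - i})"
    by (auto simp: diagram_def lookup_staircase)
  then have "(\<Prod>(i, j)\<in>diagram (staircase N). var i + var (i + j))
      = (\<Prod>i\<in>{1..N}. \<Prod>j\<in>{1..N - i}. var i + var (i + j))"
    by (simp add: prod.Sigma)
  also have "\<dots> = (\<Prod>i\<in>{1..N}. \<Prod>j\<in>{Suc i..N}. var i + var j)"
  proof (rule prod.cong[OF refl])
    fix i assume "i \<in> {1..N}"
    then show "(\<Prod>j\<in>{1..N - i}. var i + var (i + j)) = (\<Prod>j\<in>{Suc i..N}. var i + var j)"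
      by (intro prod.reindex_bij_witness[of _ "\<lambda>j. j - i" "\<lambda>j. i + j"]) auto
  qed
  finally show ?thesis .
qed

section \<open>Comparison of the two families\<close>

lemma climbs_key_poly_P:
  assumes "weak_composition \<gamma>"
  shows "climbs (sort_comp \<gamma>) (\<Prod>(i, j)\<in>diagram (half_less (sort_comp \<gamma>)). var i + var (i + j))
    \<gamma> (key_poly_P \<gamma>)"
  unfolding key_poly_P_def by (rule climbs_pi_perm[OF assms])

lemma key_poly_P_block:
  assumes \<gamma>: "weak_composition \<gamma>" and sort: "sort_comp \<gamma> = block {1..N}" and N: "1 \<le> N"
  obtains I where "finite I" "0 \<notin> I" "card I = N" "\<gamma> = block I" "key_poly_P \<gamma> = key_poly (stairs I)"
proof -
  have "climbs (block {1..N}) (\<Prod>i\<in>{1..N}. \<Prod>j\<in>{Suc i..N}. var i + var j) \<gamma> (key_poly_P \<gamma>)"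
    using climbs_key_poly_P[OF \<gamma>] unfolding sort half_less_block prod_diagram_staircase .
  from climbs_block_stairs[OF N this] obtain I where I: "finite I" "0 \<notin> I" "card I = N" "\<gamma> = block I"
    and c: "climbs (staircase N) (single (staircase N) 1) (stairs I) (key_poly_P \<gamma>)" by blast
  have w: "weak_composition (stairs I)" by (rule weak_composition_stairs[OF I(1,2)])
  have "sort_comp (stairs I) = staircase N"
    unfolding sort_comp_iff[OF w] using staircase_partition climbs_rearranges[OF c] by blast
  then have "climbs (staircase N) (single (staircase N) 1) (stairs I) (key_poly (stairs I))"
    using climbs_key_poly[OF w] by simp
  with c have "key_poly_P \<gamma> = key_poly (stairs I)" by (rule climbs_functional[OF staircase_partition])
  with I show ?thesis using that by blast
qed

lemma sort_comp_block:
  assumes I: "finite I" "0 \<notin> I"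
  shows "sort_comp (block I) = block {1..card I}"
proof -
  have w: "weak_composition (block I)" using I by (simp add: weak_composition_def lookup_block)
  obtain v where v: "v \<in> S_inf" "block I = act v (sort_comp (block I))"
    using rearranges_sort_comp[OF w] by (auto simp: rearranges_def)
  have bij: "bij v" by (rule S_inf_bij[OF v(1)])
  have level: "card {i. j \<le> lookup (sort_comp (block I)) i} = card {i. j \<le> lookup (block I) i}" for j
  proof -
    have "{i. j \<le> lookup (block I) i} = v ` {i. j \<le> lookup (sort_comp (block I)) i}"
    proof (intro equalityI subsetI)
      fix i assume "i \<in> {i. j \<le> lookup (block I) i}"
      then have "inv v i \<in> {i. j \<le> lookup (sort_comp (block I)) i}"
        using lookup_act[OF bij, of "sort_comp (block I)" i] v(2) by simp
      moreover have "v (inv v i) = i" using bij by (simp add: bij_is_surj surj_f_inv_f)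
      ultimately show "i \<in> v ` {i. j \<le> lookup (sort_comp (block I)) i}" by force
    next
      fix i assume "i \<in> v ` {i. j \<le> lookup (sort_comp (block I)) i}"
      then obtain i' where i': "i = v i'" "j \<le> lookup (sort_comp (block I)) i'" by blast
      then show "i \<in> {i. j \<le> lookup (block I) i}"
        using lookup_act[OF bij, of "sort_comp (block I)" i] v(2) bij
        by (simp add: bij_is_inj inv_f_f)
    qed
    then show ?thesis
      using card_image[OF inj_on_subset[OF bij_is_inj[OF bij] subset_UNIV],
          of "{i. j \<le> lookup (sort_comp (block I)) i}"] by simp
  qed
  show ?thesis
  proof (rule partition_eqI[OF is_partition_sort_comp[OF w] block_partition])
    fix j :: nat assume j: "1 \<le> j"
    have "{i. j \<le> lookup (block J) i} = (if j \<le> card J then J else {})" if "finite J" for J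
      using j that by (auto simp: lookup_block)
    then show "card {i. j \<le> lookup (sort_comp (block I)) i} = card {i. j \<le> lookup (block {1..card I}) i}"
      unfolding level using I(1) by simp
  qed
qed

text \<open>
  In this form the positions \<open>i\<^sub>0 < \<dots> < i\<^sub>n\<close> are replaced by the set that they form; the condition
  \<open>n \<ge> 1\<close> becomes \<open>card I \<ge> 2\<close>.
\<close>

lemma key_poly_eq_key_poly_P:
  assumes \<alpha>: "weak_composition \<alpha>" "\<alpha> \<noteq> 0" and \<gamma>: "weak_composition \<gamma>" "skew_symmetric \<gamma>"
  shows "key_poly \<alpha> = key_poly_P \<gamma> \<longleftrightarrow>
    (\<exists>I. finite I \<and> 0 \<notin> I \<and> 2 \<le> card I \<and> \<alpha> = stairs I \<and> \<gamma> = block I)" (is "?L \<longleftrightarrow> ?R")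
proof
  assume eq: ?L
  let ?\<nu> = "sort_comp \<alpha>" and ?\<rho> = "sort_comp \<gamma>"
  let ?\<mu> = "half_less ?\<rho>"
  have part: "is_partition ?\<rho>" by (rule is_partition_sort_comp[OF \<gamma>(1)])
  have \<mu>: "is_strict_partition ?\<mu>" by (rule half_less_strict[OF part])
  have \<nu>: "is_partition ?\<nu>" by (rule is_partition_sort_comp[OF \<alpha>(1)])
  have "finite (keys \<alpha> \<union> keys \<gamma> \<union> keys ?\<mu>)" by simp
  then obtain N where N: "\<forall>p \<in> keys \<alpha> \<union> keys \<gamma> \<union> keys ?\<mu>. p < N"
    using finite_nat_set_iff_bounded by blast
  \<comment> \<open>enough variables to contain both climbs and, with a row to spare, the diagram of \<open>\<mu>\<close>\<close>
  have "keys \<beta> \<subseteq> {1..N}" if "weak_composition \<beta>" "\<forall>p\<in>keys \<beta>. p < N" for \<beta>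
  proof
    fix p assume p: "p \<in> keys \<beta>"
    then have "p \<noteq> 0" using that(1) by (cases p) (auto simp: weak_composition_def in_keys_iff)
    then show "p \<in> {1..N}" using that(2) p by (auto intro: less_imp_le)
  qed
  then have supp: "keys \<alpha> \<subseteq> {1..N}" "keys \<gamma> \<subseteq> {1..N}" using \<alpha>(1) \<gamma>(1) N by simp_all
  have alt: "alternate N (single (staircase N) 1 * single ?\<nu> 1)
      = alternate N (single (staircase N) 1 * (\<Prod>(i, j)\<in>diagram ?\<mu>. var i + var (i + j)))"
    using climbs_alternate[OF climbs_key_poly[OF \<alpha>(1)] supp(1)]
      climbs_alternate[OF climbs_key_poly_P[OF \<gamma>(1)] supp(2)] eq by simp
  have keysN: "keys ?\<mu> \<subseteq> {..<N}" using N by auto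
  note forced = alternate_diagram_forces_staircase[OF \<mu> \<nu> keysN alt]
  define n where "n = lookup ?\<mu> 1"
  have stair: "lookup ?\<mu> k = Suc n - k" if "1 \<le> k" for k
    unfolding n_def by (rule strict_partition_staircase[OF \<mu> forced(2) that])
  \<comment> \<open>an empty \<open>\<mu>\<close> would make the sorted \<open>\<alpha>\<close> empty as well\<close>
  have "n \<noteq> 0"
  proof
    assume "n = 0"
    have "?\<nu> = 0"
    proof (rule poly_mapping_eqI)
      fix p
      show "lookup ?\<nu> p = lookup 0 p"
        using stair[of p] \<nu> \<open>n = 0\<close> forced(1)
        by (cases "p = 0") (auto simp: is_partition_def weak_composition_def)
    qed
    moreover obtain w where "w \<in> S_inf" "\<alpha> = act w ?\<nu>"
      using rearranges_sort_comp[OF \<alpha>(1)] by (auto simp: rearranges_def)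
    ultimately have "\<alpha> = 0" using act_zero[OF S_inf_bij[of w]] by simp
    with \<alpha>(2) show False ..
  qed
  then have n: "1 \<le> n" by simp
  have "?\<rho> = block {1..Suc n}"
  proof (rule skew_symmetric_square[OF _ n])
    show "skew_symmetric_partition ?\<rho>" using \<gamma>(2) by (simp add: skew_symmetric_def)
    show "lookup ?\<rho> k - k = Suc n - k" if "1 \<le> k" for k
      using stair[OF that] lookup_half_less[OF part, of k] by simp
  qed
  then obtain I where I: "finite I" "0 \<notin> I" "card I = Suc n" "\<gamma> = block I"
    "key_poly_P \<gamma> = key_poly (stairs I)"
    using key_poly_P_block[OF \<gamma>(1), of "Suc n"] by auto
  have "\<alpha> = stairs I"
    by (rule key_poly_inject[OF \<alpha>(1) weak_composition_stairs[OF I(1,2)]]) (simp add: eq I(5))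
  then show ?R using I n by (intro exI[of _ I]) simp
next
  assume ?R
  then obtain I where I: "finite I" "0 \<notin> I" "2 \<le> card I" "\<alpha> = stairs I" "\<gamma> = block I" by blast
  have "sort_comp \<gamma> = block {1..card I}" unfolding I(5) by (rule sort_comp_block[OF I(1,2)])
  then obtain J where J: "finite J" "\<gamma> = block J" "card J = card I" "key_poly_P \<gamma> = key_poly (stairs J)"
    using key_poly_P_block[OF \<gamma>(1)] I(3) by (metis le_trans one_le_numeral)
  have "p \<in> I \<longleftrightarrow> p \<in> J" for p
    using lookup_block[OF I(1), of p] lookup_block[OF J(1), of p] I(3) I(5) J(2,3)
    by (auto split: if_splits)
  then have "I = J" by blast
  then show ?L using J(4) I(4) by simp
qed

lemma stairs_block_enumerate:
  assumes i: "strict_mono_on {0..n} i"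
  shows "card (i ` {0..n}) = Suc n"
    and "stairs (i ` {0..n}) = (\<Sum>k=1..n. single (i k) k)"
    and "block (i ` {0..n}) = (\<Sum>k=0..n. single (i k) (n + 1))"
proof -
  have inj: "inj_on i {0..n}" by (rule strict_mono_on_imp_inj_on[OF i])
  show card: "card (i ` {0..n}) = Suc n" by (simp add: card_image[OF inj])
  have "card {q \<in> i ` {0..n}. q < i k} = k" if k: "k \<in> {0..n}" for k
  proof -
    have "{q \<in> i ` {0..n}. q < i k} = i ` {0..<k}"
      using k strict_mono_on_less[OF i] by auto
    moreover have "inj_on i {0..<k}" by (rule inj_on_subset[OF inj]) (use k in auto)
    ultimately show ?thesis by (simp add: card_image)
  qed
  then have "stairs (i ` {0..n}) = (\<Sum>k=0..n. single (i k) k)"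
    unfolding stairs_def by (simp add: sum.reindex[OF inj])
  also have "\<dots> = (\<Sum>k=1..n. single (i k) k)"
    by (simp add: sum.atLeast_Suc_atMost)
  finally show "stairs (i ` {0..n}) = (\<Sum>k=1..n. single (i k) k)" .
  show "block (i ` {0..n}) = (\<Sum>k=0..n. single (i k) (n + 1))"
    unfolding block_def card by (simp add: sum.reindex[OF inj])
qed

theorem proposition2p45:
  fixes \<alpha> \<gamma> :: "nat \<Rightarrow>\<^sub>0 nat"
  assumes "weak_composition \<alpha>" and "\<alpha> \<noteq> 0"
    and "weak_composition \<gamma>" and "skew_symmetric \<gamma>"
  shows "key_poly \<alpha> = key_poly_P \<gamma> \<longleftrightarrow>
    (\<exists>(n::nat) (i :: nat \<Rightarrow> nat). n \<ge> 1 \<and> i 0 \<ge> 1 \<and> strict_mono_on {0..n} i \<and>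
       \<alpha> = (\<Sum>k=1..n. Poly_Mapping.single (i k) k) \<and>
       \<gamma> = (\<Sum>k=0..n. Poly_Mapping.single (i k) (n + 1)))"
  unfolding key_poly_eq_key_poly_P[OF assms]
proof
  assume "\<exists>I. finite I \<and> 0 \<notin> I \<and> 2 \<le> card I \<and> \<alpha> = stairs I \<and> \<gamma> = block I"
  then obtain I where I: "finite I" "0 \<notin> I" "2 \<le> card I" "\<alpha> = stairs I" "\<gamma> = block I" by blast
  obtain i where bij: "bij_betw i {..<card I} I" and mono: "strict_mono_on {..<card I} i"
    by (rule ex_bij_betw_strict_mono_card[OF I(1)])
  define n where "n = card I - 1"
  have dom: "{..<card I} = {0..n}" using I(3) by (auto simp: n_def)
  have img: "I = i ` {0..n}" using bij unfolding dom by (simp add: bij_betw_def)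
  have mono: "strict_mono_on {0..n} i" using mono unfolding dom .
  have "i 0 \<in> I" using img by auto
  then have "i 0 \<ge> 1" using I(2) by (metis less_one not_le)
  moreover have "n \<ge> 1" using I(3) by (simp add: n_def)
  ultimately show "\<exists>n i. n \<ge> 1 \<and> i 0 \<ge> 1 \<and> strict_mono_on {0..n} i \<and>
       \<alpha> = (\<Sum>k=1..n. single (i k) k) \<and> \<gamma> = (\<Sum>k=0..n. single (i k) (n + 1))"
    using mono stairs_block_enumerate(2,3)[OF mono] I(4,5) unfolding img
    by (intro exI[of _ n] exI[of _ i] conjI) simp_all
next
  assume "\<exists>n i. n \<ge> 1 \<and> i 0 \<ge> 1 \<and> strict_mono_on {0..n} i \<and>
       \<alpha> = (\<Sum>k=1..n. single (i k) k) \<and> \<gamma> = (\<Sum>k=0..n. single (i k) (n + 1))"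
  then obtain n i where n: "n \<ge> 1" "i 0 \<ge> 1" and i: "strict_mono_on {0..n} i"
    and \<alpha>: "\<alpha> = (\<Sum>k=1..n. single (i k) k)" and \<gamma>: "\<gamma> = (\<Sum>k=0..n. single (i k) (n + 1))" by blast
  have "i 0 \<le> i k" if "k \<in> {0..n}" for k
    using strict_mono_on_leD[OF i, of 0 k] that by simp
  then have "0 \<notin> i ` {0..n}" using n(2) by fastforce
  then show "\<exists>I. finite I \<and> 0 \<notin> I \<and> 2 \<le> card I \<and> \<alpha> = stairs I \<and> \<gamma> = block I"
    using stairs_block_enumerate[OF i] n(1) \<alpha> \<gamma> by (intro exI[of _ "i ` {0..n}"]) simp
qed

end
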